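(* Let $\mathbb{F}$ be an algebraically closed field of characteristic not $2$ or $3$, let $\mathfrak{J}$ be a Jacobi-Jordan algebra over $\mathbb{F}$ with $\dim \mathrm{H}^2(\mathfrak{J},\mathfrak{J})<\infty$, and let $\eta_{\mathfrak{J}}$ be the infinitesimal deformation of $\mathfrak{J}$ with base $\mathbb{F}\oplus \mathrm{H}^2(\mathfrak{J},\mathfrak{J})'$ described in the context. Then $\eta_{\mathfrak{J}}$ is a universal infinitesimal deformation of $\mathfrak{J}$; that is, for every infinitesimal deformation $\lambda$ of $\mathfrak{J}$ with a finite-dimensional base $B$ there exists a unique homomorphism $\varphi:\mathbb{F}\oplus \mathrm{H}^2(\mathfrak{J},\mathfrak{J})'\to B$ such that $\lambda$ is equivalent to the push-out $\varphi_*\eta_{\mathfrak{J}}$.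
   Context: A Jacobi-Jordan (JJ) algebra over a commutative ring is a module with a bilinear product satisfying $x\cdot y=y\cdot x$ and $x\cdot(y\cdot z)+y\cdot(z\cdot x)+z\cdot(x\cdot y)=0$. Cohomology. $\mathrm{S}^n(\mathfrak{J},\mathfrak{J})$ is the space of symmetric $n$-linear maps $\mathfrak{J}^n\to\mathfrak{J}$. For $\varphi\in \mathrm{S}^1$: $\mathrm{d}\varphi(x,y)=\varphi(x\cdot y)-x\cdot\varphi(y)-y\cdot\varphi(x)$. For $\varphi\in \mathrm{S}^2$: $\mathrm{d}\varphi(x,y,z)=\varphi(x,y\cdot z)+\varphi(y,z\cdot x)+\varphi(z,x\cdot y)+x\cdot\varphi(y,z)+y\cdot\varphi(z,x)+z\cdot\varphi(x,y)$. $\mathrm{Z}^2=\ker(\mathrm{d}:\mathrm{S}^2\to \mathrm{S}^3)$ (cocycles), $\mathrm{B}^2=\mathrm{Im}(\mathrm{d}:\mathrm{S}^1\to \mathrm{S}^2)$, $\mathbb{H}:=\mathrm{H}^2(\mathfrak{J},\mathfrak{J})=\mathrm{Z}^2/\mathrm{B}^2$. A prime denotes the dual vector space. Deformations. Let $A$ be a commutative unital $\mathbb{F}$-algebra with a maximal ideal $\mathfrak{m}_A$ and augmentation $\varepsilon_A:A\to\mathbb{F}$, an algebra homomorphism with $\varepsilon_A(1)=1$, $\ker\varepsilon_A=\mathfrak{m}_A$. A deformation of $\mathfrak{J}$ with base $A$ is an $A$-bilinear JJ algebra structure on $A\otimes_{\mathbb{F}}\mathfrak{J}$ such that $\varepsilon_A\otimes\mathrm{id}:A\otimes\mathfrak{J}\to\mathbb{F}\otimes\mathfrak{J}=\mathfrak{J}$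 is a JJ algebra homomorphism. It is infinitesimal if $A$ is local and $\mathfrak{m}_A^2=0$. Two deformations $\lambda,\lambda'$ with the same base $A$ are equivalent if there is an $A$-linear JJ algebra isomorphism $\rho:(A\otimes\mathfrak{J},\lambda)\to(A\otimes\mathfrak{J},\lambda')$ with $(\varepsilon_A\otimes\mathrm{id})\circ\rho=\varepsilon_A\otimes\mathrm{id}$. Homomorphisms of bases $\varphi:A\to B$ are algebra homomorphisms with $\varphi(1)=1$ and $\varepsilon_B\circ\varphi=\varepsilon_A$. The push-out $\varphi_*\lambda$ is the deformation with base $B$ on $B\otimes_{\mathbb{F}}\mathfrak{J}=B\otimes_A(A\otimes_{\mathbb{F}}\mathfrak{J})$ obtained by $B$-bilinear extension of $\lambda$; explicitly, if $((1\otimes x_1)\cdot(1\otimes x_2))_\lambda=1\otimes x_1x_2+\sum_i m_i\otimes y_i$ with $m_i\in\mathfrak{m}_A$, $y_i\in\mathfrak{J}$, then $((1\otimes x_1)\cdot(1\otimes x_2))_{\varphi_*\lambda}=1\otimes x_1x_2+\sum_i\varphi(m_i)\otimes y_i$. The deformation $\eta_{\mathfrak{J}}$. Let $A=\mathbb{F}\oplus\mathbb{H}'$, where $\mathbb{H}'$ is an ideal with zero multiplication (so $\mathfrak{m}_A=\mathbb{H}'$). Let $\mu:\mathbb{H}\to \mathrm{Z}^2(\mathfrak{J},\mathfrak{J})$ be a linear map assigning to each class $\alpha$ a cocycle $\mu(\alpha)$ representing it. Identify $A\otimes\mathfrak{J}=\mathfrak{J}\oplus\mathrm{Hom}(\mathbb{H},\mathfrak{J})$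 and define $(x_1,\varphi_1)\cdot(x_2,\varphi_2)=(x_1x_2,\psi)$ with $\psi(\alpha)=\mu(\alpha)(x_1,x_2)+x_1\varphi_2(\alpha)+x_2\varphi_1(\alpha)$ for $\alpha\in\mathbb{H}$. This is an infinitesimal deformation with base $A$, denoted $\eta_{\mathfrak{J}}$ (its equivalence class does not depend on the choice of $\mu$). In terms of a basis $\{h_i\}$ of $\mathbb{H}$ with dual basis $\{h_i'\}$: $(1\otimes x_1\cdot 1\otimes x_2)_{\eta_{\mathfrak{J}}}=1\otimes x_1x_2+\sum_i h_i'\otimes\mu(h_i)(x_1,x_2)$. *)

theory Defs
  imports "HOL-Algebra.Algebraic_Closure" "Jordan_Normal_Form.Missing_VectorSpace"
begin

hide_const (open) Multiset.mult

text \<open>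
  Everything is carrier-based, on the module records of HOL-Algebra. Where a record only serves
  as a module, its fields \<open>mult\<close> and \<open>one\<close> are junk; for a
  Jacobi-Jordan algebra \<open>mult\<close> is the product and \<open>one\<close> is junk. Functions that are elements of a module are
  made extensional, so that equality of elements is equality on the carriers.
\<close>

definition characteristic :: "('a, 'm) ring_scheme \<Rightarrow> nat" where
  "characteristic R =
     (if \<exists>n::nat>0. add_pow R n \<one>\<^bsub>R\<^esub> = \<zero>\<^bsub>R\<^esub>
      then LEAST n::nat. n > 0 \<and> add_pow R n \<one>\<^bsub>R\<^esub> = \<zero>\<^bsub>R\<^esub> else 0)"


section \<open>Constructions of modules\<close>

definition regular_module :: "('a, 'm) ring_scheme \<Rightarrow> ('a, 'a) module" where
  "regular_module R = \<lparr>carrier = carrier R, mult = mult R, one = one R, zero = zero R,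
     add = add R, smult = mult R\<rparr>"

definition hom_module ::
  "('a, 'm) ring_scheme \<Rightarrow> ('a, 'v, 'n) module_scheme \<Rightarrow> ('a, 'w, 'p) module_scheme
    \<Rightarrow> ('a, 'v \<Rightarrow> 'w) module" where
  "hom_module R V W = \<lparr>carrier = module_hom R V W \<inter> extensional (carrier V),
     mult = (\<lambda>f g. \<lambda>v\<in>carrier V. \<zero>\<^bsub>W\<^esub>), one = (\<lambda>v\<in>carrier V. \<zero>\<^bsub>W\<^esub>),
     zero = (\<lambda>v\<in>carrier V. \<zero>\<^bsub>W\<^esub>),
     add = (\<lambda>f g. \<lambda>v\<in>carrier V. f v \<oplus>\<^bsub>W\<^esub> g v),
     smult = (\<lambda>a f. \<lambda>v\<in>carrier V. a \<odot>\<^bsub>W\<^esub> f v)\<rparr>"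

definition dual_module ::
  "('a, 'm) ring_scheme \<Rightarrow> ('a, 'v, 'n) module_scheme \<Rightarrow> ('a, 'v \<Rightarrow> 'a) module" where
  "dual_module R V = hom_module R V (regular_module R)"

definition quotient_module :: "('a, 'v, 'n) module_scheme \<Rightarrow> 'v set \<Rightarrow> ('a, 'v set) module" where
  "quotient_module M N = \<lparr>carrier = a_rcosets\<^bsub>M\<^esub> N, mult = (\<lambda>U W. N), one = N, zero = N,
     add = set_add M,
     smult = (\<lambda>a U. \<Union>x\<in>U. N +>\<^bsub>M\<^esub> (a \<odot>\<^bsub>M\<^esub> x))\<rparr>"

definition free_module :: "('a, 'm) ring_scheme \<Rightarrow> 'x set \<Rightarrow> ('a, 'x \<Rightarrow> 'a) module" where
  "free_module R I = \<lparr>carrier = {f \<in> I \<rightarrow>\<^sub>E carrier R. finite {p \<in> I. f p \<noteq> \<zero>\<^bsub>R\<^esub>}},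
     mult = (\<lambda>f g. \<lambda>p\<in>I. \<zero>\<^bsub>R\<^esub>), one = (\<lambda>p\<in>I. \<zero>\<^bsub>R\<^esub>), zero = (\<lambda>p\<in>I. \<zero>\<^bsub>R\<^esub>),
     add = (\<lambda>f g. \<lambda>p\<in>I. f p \<oplus>\<^bsub>R\<^esub> g p),
     smult = (\<lambda>a f. \<lambda>p\<in>I. a \<otimes>\<^bsub>R\<^esub> f p)\<rparr>"

definition free_gen :: "('a, 'm) ring_scheme \<Rightarrow> 'x set \<Rightarrow> 'x \<Rightarrow> 'x \<Rightarrow> 'a" where
  "free_gen R I p = (\<lambda>q\<in>I. if q = p then \<one>\<^bsub>R\<^esub> else \<zero>\<^bsub>R\<^esub>)"


section \<open>Tensor products\<close>

definition tensor_free ::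
  "('f, 'm) ring_scheme \<Rightarrow> ('f, 'a, 'n) module_scheme \<Rightarrow> ('f, 'j, 'p) module_scheme
    \<Rightarrow> ('f, 'a \<times> 'j \<Rightarrow> 'f) module" where
  "tensor_free F A J = free_module F (carrier A \<times> carrier J)"

definition tensor_gen ::
  "('f, 'm) ring_scheme \<Rightarrow> ('f, 'a, 'n) module_scheme \<Rightarrow> ('f, 'j, 'p) module_scheme
    \<Rightarrow> 'a \<Rightarrow> 'j \<Rightarrow> 'a \<times> 'j \<Rightarrow> 'f" where
  "tensor_gen F A J a x = free_gen F (carrier A \<times> carrier J) (a, x)"

definition tensor_relations ::
  "('f, 'm) ring_scheme \<Rightarrow> ('f, 'a, 'n) module_scheme \<Rightarrow> ('f, 'j, 'p) module_scheme
    \<Rightarrow> ('a \<times> 'j \<Rightarrow> 'f) set" where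
  "tensor_relations F A J = (let T = tensor_free F A J; g = tensor_gen F A J in
     module.span F T
      ({g (a \<oplus>\<^bsub>A\<^esub> b) x \<ominus>\<^bsub>T\<^esub> (g a x \<oplus>\<^bsub>T\<^esub> g b x) | a b x.
          a \<in> carrier A \<and> b \<in> carrier A \<and> x \<in> carrier J}
       \<union> {g a (x \<oplus>\<^bsub>J\<^esub> y) \<ominus>\<^bsub>T\<^esub> (g a x \<oplus>\<^bsub>T\<^esub> g a y) | a x y.
          a \<in> carrier A \<and> x \<in> carrier J \<and> y \<in> carrier J}
       \<union> {g (c \<odot>\<^bsub>A\<^esub> a) x \<ominus>\<^bsub>T\<^esub> (c \<odot>\<^bsub>T\<^esub> g a x) | c a x.
          c \<in> carrier F \<and> a \<in> carrier A \<and> x \<in> carrier J}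
       \<union> {g a (c \<odot>\<^bsub>J\<^esub> x) \<ominus>\<^bsub>T\<^esub> (c \<odot>\<^bsub>T\<^esub> g a x) | c a x.
          c \<in> carrier F \<and> a \<in> carrier A \<and> x \<in> carrier J}))"

definition tensor_space ::
  "('f, 'm) ring_scheme \<Rightarrow> ('f, 'a, 'n) module_scheme \<Rightarrow> ('f, 'j, 'p) module_scheme
    \<Rightarrow> ('f, ('a \<times> 'j \<Rightarrow> 'f) set) module" where
  "tensor_space F A J = quotient_module (tensor_free F A J) (tensor_relations F A J)"

definition tensor ::
  "('f, 'm) ring_scheme \<Rightarrow> ('f, 'a, 'n) module_scheme \<Rightarrow> ('f, 'j, 'p) module_scheme
    \<Rightarrow> 'a \<Rightarrow> 'j \<Rightarrow> ('a \<times> 'j \<Rightarrow> 'f) set" where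
  "tensor F A J a x = tensor_relations F A J +>\<^bsub>tensor_free F A J\<^esub> tensor_gen F A J a x"

text \<open>
  The linear map \<open>A \<otimes> J \<rightarrow> M\<close>, \<open>a \<otimes> x \<mapsto> \<beta> a x\<close> induced by a bilinear \<open>\<beta>\<close>; it is only used for
  bilinear \<open>\<beta>\<close>, for which the value does not depend on the representative of the coset \<open>t\<close>.
\<close>
definition tensor_lift ::
  "('f, 'm) ring_scheme \<Rightarrow> ('f, 'a, 'n) module_scheme \<Rightarrow> ('f, 'j, 'p) module_scheme
    \<Rightarrow> ('f, 'v, 'q) module_scheme \<Rightarrow> ('a \<Rightarrow> 'j \<Rightarrow> 'v) \<Rightarrow> ('a \<times> 'j \<Rightarrow> 'f) set \<Rightarrow> 'v" where
  "tensor_lift F A J M \<beta> t = the_elem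
     ((\<lambda>f. \<Oplus>\<^bsub>M\<^esub>p\<in>{p \<in> carrier A \<times> carrier J. f p \<noteq> \<zero>\<^bsub>F\<^esub>}. f p \<odot>\<^bsub>M\<^esub> \<beta> (fst p) (snd p)) ` t)"

definition tensor_smult ::
  "('f, 'm) ring_scheme \<Rightarrow> ('f, 'a, 'n) module_scheme \<Rightarrow> ('f, 'j, 'p) module_scheme
    \<Rightarrow> 'a \<Rightarrow> ('a \<times> 'j \<Rightarrow> 'f) set \<Rightarrow> ('a \<times> 'j \<Rightarrow> 'f) set" where
  "tensor_smult F A J a =
     tensor_lift F A J (tensor_space F A J) (\<lambda>b x. tensor F A J (a \<otimes>\<^bsub>A\<^esub> b) x)"

text \<open>The \<open>A\<close>-module \<open>A \<otimes>\<^sub>F J\<close>, equipped with the product \<open>l\<close>.\<close>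
definition tensor_algebra ::
  "('f, 'm) ring_scheme \<Rightarrow> ('f, 'a, 'n) module_scheme \<Rightarrow> ('f, 'j, 'p) module_scheme
    \<Rightarrow> (('a \<times> 'j \<Rightarrow> 'f) set \<Rightarrow> ('a \<times> 'j \<Rightarrow> 'f) set \<Rightarrow> ('a \<times> 'j \<Rightarrow> 'f) set)
    \<Rightarrow> ('a, ('a \<times> 'j \<Rightarrow> 'f) set) module" where
  "tensor_algebra F A J l = \<lparr>carrier = carrier (tensor_space F A J), mult = l,
     one = zero (tensor_space F A J), zero = zero (tensor_space F A J),
     add = add (tensor_space F A J), smult = tensor_smult F A J\<rparr>"


section \<open>Jacobi-Jordan algebras and their second cohomology\<close>

locale jacobi_jordan_algebra = module R J for R and J (structure) +
  assumes jj_closed: "\<lbrakk>x \<in> carrier J; y \<in> carrier J\<rbrakk> \<Longrightarrow> x \<otimes> y \<in> carrier J"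
    and jj_add_left: "\<lbrakk>x \<in> carrier J; y \<in> carrier J; z \<in> carrier J\<rbrakk>
      \<Longrightarrow> (x \<oplus> y) \<otimes> z = x \<otimes> z \<oplus> y \<otimes> z"
    and jj_add_right: "\<lbrakk>x \<in> carrier J; y \<in> carrier J; z \<in> carrier J\<rbrakk>
      \<Longrightarrow> x \<otimes> (y \<oplus> z) = x \<otimes> y \<oplus> x \<otimes> z"
    and jj_smult_left: "\<lbrakk>c \<in> carrier R; x \<in> carrier J; y \<in> carrier J\<rbrakk>
      \<Longrightarrow> (c \<odot> x) \<otimes> y = c \<odot> (x \<otimes> y)"
    and jj_smult_right: "\<lbrakk>c \<in> carrier R; x \<in> carrier J; y \<in> carrier J\<rbrakk>
      \<Longrightarrow> x \<otimes> (c \<odot> y) = c \<odot> (x \<otimes> y)"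
    and jj_comm: "\<lbrakk>x \<in> carrier J; y \<in> carrier J\<rbrakk> \<Longrightarrow> x \<otimes> y = y \<otimes> x"
    and jj_jacobi: "\<lbrakk>x \<in> carrier J; y \<in> carrier J; z \<in> carrier J\<rbrakk>
      \<Longrightarrow> x \<otimes> (y \<otimes> z) \<oplus> y \<otimes> (z \<otimes> x) \<oplus> z \<otimes> (x \<otimes> y) = \<zero>"

definition jj_hom ::
  "('a, 'm) ring_scheme \<Rightarrow> ('a, 'v, 'n) module_scheme \<Rightarrow> ('a, 'w, 'p) module_scheme
    \<Rightarrow> ('v \<Rightarrow> 'w) set" where
  "jj_hom R M N = {h \<in> module_hom R M N.
     \<forall>x\<in>carrier M. \<forall>y\<in>carrier M. h (x \<otimes>\<^bsub>M\<^esub> y) = h x \<otimes>\<^bsub>N\<^esub> h y}"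

definition cochains2 ::
  "('f, 'm) ring_scheme \<Rightarrow> ('f, 'j, 'n) module_scheme \<Rightarrow> ('f, 'j \<Rightarrow> 'j \<Rightarrow> 'j) module" where
  "cochains2 F J = \<lparr>carrier = {\<phi> \<in> carrier J \<rightarrow>\<^sub>E (carrier J \<rightarrow>\<^sub>E carrier J).
       (\<forall>x\<in>carrier J. \<phi> x \<in> module_hom F J J) \<and>
       (\<forall>y\<in>carrier J. (\<lambda>x. \<phi> x y) \<in> module_hom F J J) \<and>
       (\<forall>x\<in>carrier J. \<forall>y\<in>carrier J. \<phi> x y = \<phi> y x)},
     mult = (\<lambda>\<phi> \<psi>. \<lambda>x\<in>carrier J. \<lambda>y\<in>carrier J. \<zero>\<^bsub>J\<^esub>),
     one = (\<lambda>x\<in>carrier J. \<lambda>y\<in>carrier J. \<zero>\<^bsub>J\<^esub>),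
     zero = (\<lambda>x\<in>carrier J. \<lambda>y\<in>carrier J. \<zero>\<^bsub>J\<^esub>),
     add = (\<lambda>\<phi> \<psi>. \<lambda>x\<in>carrier J. \<lambda>y\<in>carrier J. \<phi> x y \<oplus>\<^bsub>J\<^esub> \<psi> x y),
     smult = (\<lambda>c \<phi>. \<lambda>x\<in>carrier J. \<lambda>y\<in>carrier J. c \<odot>\<^bsub>J\<^esub> \<phi> x y)\<rparr>"

definition coboundary1 ::
  "('f, 'j, 'n) module_scheme \<Rightarrow> ('j \<Rightarrow> 'j) \<Rightarrow> 'j \<Rightarrow> 'j \<Rightarrow> 'j" where
  "coboundary1 J \<phi> = (\<lambda>x\<in>carrier J. \<lambda>y\<in>carrier J.
     \<phi> (x \<otimes>\<^bsub>J\<^esub> y) \<ominus>\<^bsub>J\<^esub> x \<otimes>\<^bsub>J\<^esub> \<phi> y \<ominus>\<^bsub>J\<^esub> y \<otimes>\<^bsub>J\<^esub> \<phi> x)"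

definition coboundary2 ::
  "('f, 'j, 'n) module_scheme \<Rightarrow> ('j \<Rightarrow> 'j \<Rightarrow> 'j) \<Rightarrow> 'j \<Rightarrow> 'j \<Rightarrow> 'j \<Rightarrow> 'j" where
  "coboundary2 J \<phi> x y z =
     \<phi> x (y \<otimes>\<^bsub>J\<^esub> z) \<oplus>\<^bsub>J\<^esub> \<phi> y (z \<otimes>\<^bsub>J\<^esub> x) \<oplus>\<^bsub>J\<^esub> \<phi> z (x \<otimes>\<^bsub>J\<^esub> y)
     \<oplus>\<^bsub>J\<^esub> x \<otimes>\<^bsub>J\<^esub> \<phi> y z \<oplus>\<^bsub>J\<^esub> y \<otimes>\<^bsub>J\<^esub> \<phi> z x \<oplus>\<^bsub>J\<^esub> z \<otimes>\<^bsub>J\<^esub> \<phi> x y"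

definition Z2 ::
  "('f, 'm) ring_scheme \<Rightarrow> ('f, 'j, 'n) module_scheme \<Rightarrow> ('f, 'j \<Rightarrow> 'j \<Rightarrow> 'j) module" where
  "Z2 F J = (cochains2 F J)\<lparr>carrier := {\<phi> \<in> carrier (cochains2 F J).
     \<forall>x\<in>carrier J. \<forall>y\<in>carrier J. \<forall>z\<in>carrier J. coboundary2 J \<phi> x y z = \<zero>\<^bsub>J\<^esub>}\<rparr>"

definition B2 ::
  "('f, 'm) ring_scheme \<Rightarrow> ('f, 'j, 'n) module_scheme \<Rightarrow> ('j \<Rightarrow> 'j \<Rightarrow> 'j) set" where
  "B2 F J = coboundary1 J ` module_hom F J J"

definition H2 ::
  "('f, 'm) ring_scheme \<Rightarrow> ('f, 'j, 'n) module_scheme \<Rightarrow> ('f, ('j \<Rightarrow> 'j \<Rightarrow> 'j) set) module" where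
  "H2 F J = quotient_module (Z2 F J) (B2 F J)"


section \<open>Deformations\<close>

locale augmented_algebra = algebra F A + field F
  for F and A (structure) and \<epsilon> +
  assumes aug_ring_hom: "\<epsilon> \<in> ring_hom A F"
    and aug_smult: "\<lbrakk>c \<in> carrier F; a \<in> carrier A\<rbrakk> \<Longrightarrow> \<epsilon> (c \<odot> a) = c \<otimes>\<^bsub>F\<^esub> \<epsilon> a"
    and aug_maximal: "maximalideal (a_kernel A F \<epsilon>) A"

definition local_ring :: "('a, 'm) ring_scheme \<Rightarrow> bool" where
  "local_ring A \<longleftrightarrow> cring A \<and> (\<exists>!I. maximalideal I A)"

text \<open>The map \<open>\<epsilon> \<otimes> id\<close>, followed by the identification \<open>F \<otimes> J = J\<close>.\<close>
definition tensor_aug ::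
  "('f, 'm) ring_scheme \<Rightarrow> ('f, 'j, 'p) module_scheme \<Rightarrow> ('f, 'a, 'n) module_scheme
    \<Rightarrow> ('a \<Rightarrow> 'f) \<Rightarrow> ('a \<times> 'j \<Rightarrow> 'f) set \<Rightarrow> 'j" where
  "tensor_aug F J A \<epsilon> = tensor_lift F A J J (\<lambda>a x. \<epsilon> a \<odot>\<^bsub>J\<^esub> x)"

definition deformation ::
  "('f, 'm) ring_scheme \<Rightarrow> ('f, 'j, 'p) module_scheme \<Rightarrow> ('f, 'a, 'n) module_scheme
    \<Rightarrow> ('a \<Rightarrow> 'f)
    \<Rightarrow> (('a \<times> 'j \<Rightarrow> 'f) set \<Rightarrow> ('a \<times> 'j \<Rightarrow> 'f) set \<Rightarrow> ('a \<times> 'j \<Rightarrow> 'f) set) \<Rightarrow> bool" where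
  "deformation F J A \<epsilon> l \<longleftrightarrow>
     augmented_algebra F A \<epsilon> \<and>
     jacobi_jordan_algebra A (tensor_algebra F A J l) \<and>
     tensor_aug F J A \<epsilon> \<in> jj_hom F ((tensor_space F A J)\<lparr>mult := l\<rparr>) J"

definition infinitesimal_deformation ::
  "('f, 'm) ring_scheme \<Rightarrow> ('f, 'j, 'p) module_scheme \<Rightarrow> ('f, 'a, 'n) module_scheme
    \<Rightarrow> ('a \<Rightarrow> 'f)
    \<Rightarrow> (('a \<times> 'j \<Rightarrow> 'f) set \<Rightarrow> ('a \<times> 'j \<Rightarrow> 'f) set \<Rightarrow> ('a \<times> 'j \<Rightarrow> 'f) set) \<Rightarrow> bool" where
  "infinitesimal_deformation F J A \<epsilon> l \<longleftrightarrow>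
     deformation F J A \<epsilon> l \<and> local_ring A \<and>
     (\<forall>a\<in>a_kernel A F \<epsilon>. \<forall>b\<in>a_kernel A F \<epsilon>. a \<otimes>\<^bsub>A\<^esub> b = \<zero>\<^bsub>A\<^esub>)"

definition equivalent_deformations ::
  "('f, 'm) ring_scheme \<Rightarrow> ('f, 'j, 'p) module_scheme \<Rightarrow> ('f, 'a, 'n) module_scheme
    \<Rightarrow> ('a \<Rightarrow> 'f)
    \<Rightarrow> (('a \<times> 'j \<Rightarrow> 'f) set \<Rightarrow> ('a \<times> 'j \<Rightarrow> 'f) set \<Rightarrow> ('a \<times> 'j \<Rightarrow> 'f) set)
    \<Rightarrow> (('a \<times> 'j \<Rightarrow> 'f) set \<Rightarrow> ('a \<times> 'j \<Rightarrow> 'f) set \<Rightarrow> ('a \<times> 'j \<Rightarrow> 'f) set) \<Rightarrow> bool" where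
  "equivalent_deformations F J A \<epsilon> l l' \<longleftrightarrow>
     (\<exists>\<rho> \<in> jj_hom A (tensor_algebra F A J l) (tensor_algebra F A J l').
        bij_betw \<rho> (carrier (tensor_space F A J)) (carrier (tensor_space F A J)) \<and>
        (\<forall>t\<in>carrier (tensor_space F A J). tensor_aug F J A \<epsilon> (\<rho> t) = tensor_aug F J A \<epsilon> t))"

text \<open>Extensional, so that two homomorphisms are equal iff they agree on the carrier of \<open>A\<close>.\<close>
definition base_homs ::
  "('f, 'm) ring_scheme \<Rightarrow> ('f, 'a, 'n) module_scheme \<Rightarrow> ('a \<Rightarrow> 'f)
    \<Rightarrow> ('f, 'b, 'p) module_scheme \<Rightarrow> ('b \<Rightarrow> 'f) \<Rightarrow> ('a \<Rightarrow> 'b) set" where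
  "base_homs F A \<epsilon>A B \<epsilon>B = {\<phi> \<in> ring_hom A B \<inter> module_hom F A B \<inter> extensional (carrier A).
     \<forall>a\<in>carrier A. \<epsilon>B (\<phi> a) = \<epsilon>A a}"

definition tensor_base_map ::
  "('f, 'm) ring_scheme \<Rightarrow> ('f, 'j, 'p) module_scheme \<Rightarrow> ('f, 'a, 'n) module_scheme
    \<Rightarrow> ('f, 'b, 'q) module_scheme \<Rightarrow> ('a \<Rightarrow> 'b)
    \<Rightarrow> ('a \<times> 'j \<Rightarrow> 'f) set \<Rightarrow> ('b \<times> 'j \<Rightarrow> 'f) set" where
  "tensor_base_map F J A B \<phi> =
     tensor_lift F A J (tensor_space F B J) (\<lambda>a x. tensor F B J (\<phi> a) x)"

text \<open>
  The push-out: the \<open>B\<close>-bilinear product on \<open>B \<otimes> J\<close> that sends \<open>1 \<otimes> x\<close> and \<open>1 \<otimes> y\<close> to the image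
  of \<open>l (1 \<otimes> x) (1 \<otimes> y)\<close> under \<open>\<phi> \<otimes> id\<close>.
\<close>
definition pushout ::
  "('f, 'm) ring_scheme \<Rightarrow> ('f, 'j, 'p) module_scheme \<Rightarrow> ('f, 'a, 'n) module_scheme
    \<Rightarrow> ('f, 'b, 'q) module_scheme \<Rightarrow> ('a \<Rightarrow> 'b)
    \<Rightarrow> (('a \<times> 'j \<Rightarrow> 'f) set \<Rightarrow> ('a \<times> 'j \<Rightarrow> 'f) set \<Rightarrow> ('a \<times> 'j \<Rightarrow> 'f) set)
    \<Rightarrow> (('b \<times> 'j \<Rightarrow> 'f) set \<Rightarrow> ('b \<times> 'j \<Rightarrow> 'f) set \<Rightarrow> ('b \<times> 'j \<Rightarrow> 'f) set)" where
  "pushout F J A B \<phi> l s t =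
     tensor_lift F B J (tensor_space F B J) (\<lambda>b x.
       tensor_lift F B J (tensor_space F B J) (\<lambda>c y.
         tensor_smult F B J (b \<otimes>\<^bsub>B\<^esub> c)
           (tensor_base_map F J A B \<phi> (l (tensor F A J \<one>\<^bsub>A\<^esub> x) (tensor F A J \<one>\<^bsub>A\<^esub> y)))) t) s"


section \<open>The deformation with base \<open>F \<oplus> H'\<close>\<close>

text \<open>The algebra \<open>F \<oplus> V\<close>, in which \<open>V\<close> is an ideal with zero multiplication.\<close>
definition null_extension ::
  "('f, 'm) ring_scheme \<Rightarrow> ('f, 'v, 'n) module_scheme \<Rightarrow> ('f, 'f \<times> 'v) module" where
  "null_extension F V = \<lparr>carrier = carrier F \<times> carrier V,
     mult = (\<lambda>(a, v) (b, w). (a \<otimes>\<^bsub>F\<^esub> b, a \<odot>\<^bsub>V\<^esub> w \<oplus>\<^bsub>V\<^esub> b \<odot>\<^bsub>V\<^esub> v)),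
     one = (\<one>\<^bsub>F\<^esub>, \<zero>\<^bsub>V\<^esub>), zero = (\<zero>\<^bsub>F\<^esub>, \<zero>\<^bsub>V\<^esub>),
     add = (\<lambda>(a, v) (b, w). (a \<oplus>\<^bsub>F\<^esub> b, v \<oplus>\<^bsub>V\<^esub> w)),
     smult = (\<lambda>c (a, v). (c \<otimes>\<^bsub>F\<^esub> a, c \<odot>\<^bsub>V\<^esub> v))\<rparr>"

definition eta_base ::
  "('f, 'm) ring_scheme \<Rightarrow> ('f, 'j, 'n) module_scheme
    \<Rightarrow> ('f, 'f \<times> (('j \<Rightarrow> 'j \<Rightarrow> 'j) set \<Rightarrow> 'f)) module" where
  "eta_base F J = null_extension F (dual_module F (H2 F J))"

text \<open>
  The identification of \<open>A \<otimes> J\<close> with \<open>J \<oplus> Hom(H, J)\<close>: \<open>(a + \<xi>) \<otimes> x\<close> corresponds to \<open>a x\<close>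
  together with \<open>\<alpha> \<mapsto> \<xi>(\<alpha>) x\<close>. It is bijective if \<open>H\<close> is finite-dimensional.
\<close>
definition eta_ident ::
  "('f, 'm) ring_scheme \<Rightarrow> ('f, 'j) module
    \<Rightarrow> (('f \<times> (('j \<Rightarrow> 'j \<Rightarrow> 'j) set \<Rightarrow> 'f)) \<times> 'j \<Rightarrow> 'f) set
    \<Rightarrow> 'j \<times> (('j \<Rightarrow> 'j \<Rightarrow> 'j) set \<Rightarrow> 'j)" where
  "eta_ident F J = tensor_lift F (eta_base F J) J (direct_sum J (hom_module F (H2 F J) J))
     (\<lambda>(a, \<xi>) x. (a \<odot>\<^bsub>J\<^esub> x, \<lambda>\<alpha>\<in>carrier (H2 F J). \<xi> \<alpha> \<odot>\<^bsub>J\<^esub> x))"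

definition eta_prod ::
  "('f, 'm) ring_scheme \<Rightarrow> ('f, 'j) module
    \<Rightarrow> (('j \<Rightarrow> 'j \<Rightarrow> 'j) set \<Rightarrow> 'j \<Rightarrow> 'j \<Rightarrow> 'j)
    \<Rightarrow> 'j \<times> (('j \<Rightarrow> 'j \<Rightarrow> 'j) set \<Rightarrow> 'j) \<Rightarrow> 'j \<times> (('j \<Rightarrow> 'j \<Rightarrow> 'j) set \<Rightarrow> 'j)
    \<Rightarrow> 'j \<times> (('j \<Rightarrow> 'j \<Rightarrow> 'j) set \<Rightarrow> 'j)" where
  "eta_prod F J \<mu> = (\<lambda>(x1, \<phi>1) (x2, \<phi>2). (x1 \<otimes>\<^bsub>J\<^esub> x2,
     \<lambda>\<alpha>\<in>carrier (H2 F J). \<mu> \<alpha> x1 x2 \<oplus>\<^bsub>J\<^esub> x1 \<otimes>\<^bsub>J\<^esub> \<phi>2 \<alpha> \<oplus>\<^bsub>J\<^esub> x2 \<otimes>\<^bsub>J\<^esub> \<phi>1 \<alpha>))"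

definition eta ::
  "('f, 'm) ring_scheme \<Rightarrow> ('f, 'j) module
    \<Rightarrow> (('j \<Rightarrow> 'j \<Rightarrow> 'j) set \<Rightarrow> 'j \<Rightarrow> 'j \<Rightarrow> 'j)
    \<Rightarrow> (('f \<times> (('j \<Rightarrow> 'j \<Rightarrow> 'j) set \<Rightarrow> 'f)) \<times> 'j \<Rightarrow> 'f) set
    \<Rightarrow> (('f \<times> (('j \<Rightarrow> 'j \<Rightarrow> 'j) set \<Rightarrow> 'f)) \<times> 'j \<Rightarrow> 'f) set
    \<Rightarrow> (('f \<times> (('j \<Rightarrow> 'j \<Rightarrow> 'j) set \<Rightarrow> 'f)) \<times> 'j \<Rightarrow> 'f) set" where
  "eta F J \<mu> s t = inv_into (carrier (tensor_space F (eta_base F J) J)) (eta_ident F J)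
     (eta_prod F J \<mu> (eta_ident F J s) (eta_ident F J t))"

end

theory Submission
  imports Defs
begin

text \<open>
  Let \<open>B\<close> be a finite-dimensional local base with \<open>\<mm>\<^sup>2 = 0\<close>, let \<open>m i\<close> be a basis of \<open>\<mm>\<close> and \<open>u i\<close>
  the dual functionals, extended to \<open>B\<close> by \<open>u i 1 = 0\<close>. An element \<open>s\<close> of \<open>B \<otimes> J\<close> is given by its
  coordinates \<open>aug s = (\<epsilon> \<otimes> id) s\<close> and \<open>coord i s = (u i \<otimes> id) s\<close>, which can be prescribed arbitrarily.
  In these coordinates a product is a deformation iff it multiplies \<open>aug\<close> as \<open>J\<close> does and satisfies
  \<open>coord i (s s') = \<psi> i (aug s) (aug s') + aug s coord i s' + aug s' coord i s\<close> with 2-cocycles \<open>\<psi> i\<close>,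
  and two deformations are equivalent iff their cocycles are cohomologous.
  The push-out of \<open>\<eta>\<close> along \<open>\<phi>\<close> has the cocycles \<open>\<mu> (\<alpha> i)\<close>, where \<open>\<alpha> i \<in> H\<close> represents the functional
  \<open>u i \<circ> \<phi>\<close> on \<open>H'\<close>. Hence it is equivalent to the given deformation iff \<open>\<alpha> i\<close> is the class of \<open>\<psi> i\<close>
  for all \<open>i\<close>, and these classes determine \<open>\<phi>\<close>.
\<close>


section \<open>Modules of homomorphisms and quotient modules\<close>

text \<open>\<open>A \<otimes> J\<close> is a quotient of a free module, so equality of its elements
  cannot be read off; the functionals \<open>\<epsilon>\<close> and \<open>u i\<close> induce linear
  maps back to \<open>J\<close>, and \<open>tensor_coord_eqI\<close> turns identities of tensors
  into identities in \<open>J\<close>. The square-zero condition enters these computations as the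
  product rule \<open>u_mult\<close>. Cohomology appears because a map \<open>\<rho>\<close> linear
  over \<open>A\<close> and compatible with \<open>aug\<close> sends \<open>1 \<otimes> x\<close> to
  \<open>1 \<otimes> x + \<Sum> m i \<otimes> g i x\<close>. As the ideal has square zero,
  \<open>\<rho>\<close> adds \<open>g i (aug s)\<close> to \<open>coord i s\<close>, and
  multiplicativity of \<open>\<rho>\<close> says that the two cocycles differ by the coboundary of
  \<open>g i\<close>. The obstacle for push-outs is that the classes \<open>\<alpha> i\<close> need
  not belong to the basis of \<open>H\<close> used as coordinates for \<open>\<eta>\<close>. The
  product formula of \<open>\<eta>\<close> is therefore extended from basis classes to all classes,
  and linearity of \<open>\<mu>\<close> makes this possible. Finite dimension of \<open>H\<close>
  enters through \<open>H'' = H\<close>, which provides the \<open>\<alpha> i\<close>. Products are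
  known only on carriers, hence the hypotheses that \<open>l\<close> agrees there with
  \<open>standard_product\<close>.\<close>

lemma module_homI:
  assumes "\<And>x. x \<in> carrier M \<Longrightarrow> f x \<in> carrier N"
    and "\<And>x y. \<lbrakk>x \<in> carrier M; y \<in> carrier M\<rbrakk> \<Longrightarrow> f (x \<oplus>\<^bsub>M\<^esub> y) = f x \<oplus>\<^bsub>N\<^esub> f y"
    and "\<And>c x. \<lbrakk>c \<in> carrier R; x \<in> carrier M\<rbrakk> \<Longrightarrow> f (c \<odot>\<^bsub>M\<^esub> x) = c \<odot>\<^bsub>N\<^esub> f x"
  shows "f \<in> module_hom R M N"
  using assms by (simp add: module_hom_def)

text \<open>Negation is obtained from the scalar \<open>-1\<close>, so all axioms are equational.\<close>
lemma module_axiomsI: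
  assumes "cring R"
    and "\<zero>\<^bsub>M\<^esub> \<in> carrier M"
    and "\<And>x y. \<lbrakk>x \<in> carrier M; y \<in> carrier M\<rbrakk> \<Longrightarrow> x \<oplus>\<^bsub>M\<^esub> y \<in> carrier M"
    and "\<And>c x. \<lbrakk>c \<in> carrier R; x \<in> carrier M\<rbrakk> \<Longrightarrow> c \<odot>\<^bsub>M\<^esub> x \<in> carrier M"
    and "\<And>x y. \<lbrakk>x \<in> carrier M; y \<in> carrier M\<rbrakk> \<Longrightarrow> x \<oplus>\<^bsub>M\<^esub> y = y \<oplus>\<^bsub>M\<^esub> x"
    and "\<And>x y z. \<lbrakk>x \<in> carrier M; y \<in> carrier M; z \<in> carrier M\<rbrakk>
      \<Longrightarrow> (x \<oplus>\<^bsub>M\<^esub> y) \<oplus>\<^bsub>M\<^esub> z = x \<oplus>\<^bsub>M\<^esub> (y \<oplus>\<^bsub>M\<^esub> z)"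
    and "\<And>x. x \<in> carrier M \<Longrightarrow> x \<oplus>\<^bsub>M\<^esub> \<zero>\<^bsub>M\<^esub> = x"
    and "\<And>a b x. \<lbrakk>a \<in> carrier R; b \<in> carrier R; x \<in> carrier M\<rbrakk>
      \<Longrightarrow> (a \<otimes>\<^bsub>R\<^esub> b) \<odot>\<^bsub>M\<^esub> x = a \<odot>\<^bsub>M\<^esub> (b \<odot>\<^bsub>M\<^esub> x)"
    and "\<And>x. x \<in> carrier M \<Longrightarrow> \<one>\<^bsub>R\<^esub> \<odot>\<^bsub>M\<^esub> x = x"
    and "\<And>x. x \<in> carrier M \<Longrightarrow> \<zero>\<^bsub>R\<^esub> \<odot>\<^bsub>M\<^esub> x = \<zero>\<^bsub>M\<^esub>"
    and "\<And>a b x. \<lbrakk>a \<in> carrier R; b \<in> carrier R; x \<in> carrier M\<rbrakk>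
      \<Longrightarrow> (a \<oplus>\<^bsub>R\<^esub> b) \<odot>\<^bsub>M\<^esub> x = a \<odot>\<^bsub>M\<^esub> x \<oplus>\<^bsub>M\<^esub> b \<odot>\<^bsub>M\<^esub> x"
    and "\<And>a x y. \<lbrakk>a \<in> carrier R; x \<in> carrier M; y \<in> carrier M\<rbrakk>
      \<Longrightarrow> a \<odot>\<^bsub>M\<^esub> (x \<oplus>\<^bsub>M\<^esub> y) = a \<odot>\<^bsub>M\<^esub> x \<oplus>\<^bsub>M\<^esub> a \<odot>\<^bsub>M\<^esub> y"
  shows "module R M"
proof (rule module_criteria)
  interpret cring R by fact
  show "\<forall>x\<in>carrier M. \<exists>y\<in>carrier M. x \<oplus>\<^bsub>M\<^esub> y = \<zero>\<^bsub>M\<^esub>"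
  proof
    fix x assume x: "x \<in> carrier M"
    have "x \<oplus>\<^bsub>M\<^esub> (\<ominus>\<^bsub>R\<^esub> \<one>\<^bsub>R\<^esub>) \<odot>\<^bsub>M\<^esub> x = (\<one>\<^bsub>R\<^esub> \<oplus>\<^bsub>R\<^esub> \<ominus>\<^bsub>R\<^esub> \<one>\<^bsub>R\<^esub>) \<odot>\<^bsub>M\<^esub> x"
      using x by (simp only: assms(9,11) one_closed a_inv_closed)
    also have "\<dots> = \<zero>\<^bsub>M\<^esub>" using x by (simp only: r_neg one_closed assms(10))
    finally show "\<exists>y\<in>carrier M. x \<oplus>\<^bsub>M\<^esub> y = \<zero>\<^bsub>M\<^esub>"
      using x assms(4) by blast
  qed
  show "cring R" by fact
qed (((intro allI ballI impI; (elim conjE)?)?, rule assms(2-9,11,12); assumption)+)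

lemma module_hom_in: "\<lbrakk>f \<in> module_hom R M N; x \<in> carrier M\<rbrakk> \<Longrightarrow> f x \<in> carrier N"
  by (auto dest: module_hom_closed)

lemma module_hom_compose:
  assumes "f \<in> module_hom R M N" "g \<in> module_hom R N P"
  shows "(\<lambda>x. g (f x)) \<in> module_hom R M P"
  by (rule module_homI)
    (simp_all add: module_hom_in[OF assms(1)] module_hom_in[OF assms(2)]
      module_hom_add[OF assms(1)] module_hom_add[OF assms(2)]
      module_hom_smult[OF assms(1)] module_hom_smult[OF assms(2)])

text \<open>The maps agree only on the carrier, so sums and multiples must stay in it before
  \<open>f\<close> can be replaced by \<open>g\<close> there; this is what \<open>module R M\<close>
  supplies. It serves to pass to extensional restrictions and back.\<close>

lemma module_hom_cong:
  assumes "module R M" "f \<in> module_hom R M N" "\<And>x. x \<in> carrier M \<Longrightarrow> f x = g x"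
  shows "g \<in> module_hom R M N"
proof -
  interpret module R M by fact
  show ?thesis
    by (rule module_homI)
      (simp_all add: assms(3)[symmetric] module_hom_in[OF assms(2)] module_hom_add[OF assms(2)]
        module_hom_smult[OF assms(2)])
qed

lemma (in module) module_hom_self_smult:
  "c \<in> carrier R \<Longrightarrow> (\<lambda>x. c \<odot>\<^bsub>M\<^esub> x) \<in> module_hom R M M"
  by (rule module_homI) (simp_all add: smult_r_distr smult_assoc1[symmetric] R.m_comm)

lemma module_hom_add_maps:
  assumes "module R N" "f \<in> module_hom R M N" "g \<in> module_hom R M N"
  shows "(\<lambda>x. f x \<oplus>\<^bsub>N\<^esub> g x) \<in> module_hom R M N"
proof -
  interpret module R N by fact
  show ?thesis
    by (rule module_homI)
      (simp_all add: module_hom_in[OF assms(2)] module_hom_in[OF assms(3)]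
      module_hom_add[OF assms(2)] module_hom_add[OF assms(3)]
      module_hom_smult[OF assms(2)] module_hom_smult[OF assms(3)] smult_r_distr M.a_ac)
qed

lemma module_hom_finsum:
  assumes "module R M" "module R N" "f \<in> module_hom R M N"
    and "g \<in> S \<rightarrow> carrier M"
  shows "f (\<Oplus>\<^bsub>M\<^esub>i\<in>S. g i) = (\<Oplus>\<^bsub>N\<^esub>i\<in>S. f (g i))"
proof -
  interpret M: module R M by fact
  interpret N: module R N by fact
  interpret mod_hom R M N f by unfold_locales fact
  show ?thesis using assms(4)
  proof (induct S rule: infinite_finite_induct)
    case (insert a S)
    then show ?case by (simp add: M.finsum_insert N.finsum_insert Pi_iff)
  qed auto
qed

lemma module_hom_zero:
  assumes "module R M" "module R N" "f \<in> module_hom R M N"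
  shows "f \<zero>\<^bsub>M\<^esub> = \<zero>\<^bsub>N\<^esub>"
  using module_hom_finsum[OF assms, of undefined "{}"] assms(1,2)
  by (simp add: module_def abelian_group_def abelian_monoid.finsum_empty)

lemma module_hom_uminus:
  assumes "module R M" "module R N" "f \<in> module_hom R M N" "x \<in> carrier M"
  shows "f (\<ominus>\<^bsub>M\<^esub> x) = \<ominus>\<^bsub>N\<^esub> f x"
proof -
  interpret M: module R M by fact
  interpret N: module R N by fact
  interpret mod_hom R M N f by unfold_locales fact
  show ?thesis using assms(4) by (rule f_neg)
qed

lemma module_hom_minus:
  assumes "module R M" "module R N" "f \<in> module_hom R M N" "x \<in> carrier M" "y \<in> carrier M"
  shows "f (x \<ominus>\<^bsub>M\<^esub> y) = f x \<ominus>\<^bsub>N\<^esub> f y"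
proof -
  have "\<ominus>\<^bsub>M\<^esub> y \<in> carrier M"
    using assms(1,5) by (simp add: module_def abelian_group.a_inv_closed)
  then show ?thesis
    using assms by (simp add: a_minus_def module_hom_add module_hom_uminus)
qed

lemma kernel_submodule:
  assumes "module R M" "module R N" "f \<in> module_hom R M N"
  shows "submodule R {x \<in> carrier M. f x = \<zero>\<^bsub>N\<^esub>} M"
proof -
  interpret M: module R M by fact
  interpret N: module R N by fact
  show ?thesis
    by unfold_locales
      (use assms in \<open>auto simp: module_hom_add module_hom_smult module_hom_zero\<close>)
qed

text \<open>Coset arithmetic is available for additive subgroups; a submodule is one because
  \<open>\<ominus> x\<close> is the multiple of \<open>x\<close> by \<open>-1\<close>.\<close>

lemma abelian_subgroup_submodule:
  assumes "submodule R N M"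
  shows "abelian_subgroup N M"
proof -
  interpret submodule R N M by fact
  interpret module R M by (rule module)
  have "\<ominus>\<^bsub>M\<^esub> x \<in> N" if "x \<in> N" for x
  proof -
    have "(\<ominus>\<^bsub>R\<^esub> \<one>\<^bsub>R\<^esub>) \<odot>\<^bsub>M\<^esub> x \<in> N"
      by (rule submodule.smult_closed[OF assms]) (use that in simp_all)
    moreover have "x \<in> carrier M" using that subset by blast
    ultimately show ?thesis by (simp add: smult_minus_1)
  qed
  moreover have "N \<noteq> {}" using submodule.zero_closed[OF assms] by blast
  ultimately have "additive_subgroup N M"
    by (intro additive_subgroup.intro M.add.subgroupI)
      (use subset zero_closed in \<open>auto simp: a_inv_def\<close>)
  then show ?thesis
    by (intro abelian_subgroupI3 M.abelian_group_axioms)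
qed

section \<open>Arithmetic of cosets modulo a submodule\<close>

context
  fixes R and M (structure) and N
  assumes N: "submodule R N M"
begin

interpretation submodule R N M by (rule N)
interpretation module R M by (rule module)
interpretation abelian_subgroup N M by (rule abelian_subgroup_submodule[OF N])

lemma quotient_carrier: "carrier (quotient_module M N) = (\<lambda>x. N +> x) ` carrier M"
  by (auto simp: quotient_module_def A_RCOSETS_def' )

lemma quotient_eq_iff:
  assumes "x \<in> carrier M" "y \<in> carrier M"
  shows "N +> x = N +> y \<longleftrightarrow> x \<ominus> y \<in> N"
  using assms a_rcos_module[of y x] a_rcos_self[of x] a_repr_independence'[of x y]
  by (auto simp: a_minus_def)

lemma quotient_zero: "\<zero>\<^bsub>quotient_module M N\<^esub> = N +> \<zero>"
  by (simp add: quotient_module_def M.a_coset_add_zero[OF subset])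

lemma quotient_add:
  assumes "x \<in> carrier M" "y \<in> carrier M"
  shows "(N +> x) \<oplus>\<^bsub>quotient_module M N\<^esub> (N +> y) = N +> (x \<oplus> y)"
  using assms by (simp add: quotient_module_def a_rcos_sum)

text \<open>The quotient defines a multiple of a coset as a union of cosets over all its
  representatives. If \<open>y - x\<close> lies in \<open>N\<close>, so does
  \<open>c (y - x)\<close>; hence these cosets coincide and the union is a single one.\<close>

lemma quotient_smult:
  assumes c: "c \<in> carrier R" and x: "x \<in> carrier M"
  shows "c \<odot>\<^bsub>quotient_module M N\<^esub> (N +> x) = N +> (c \<odot> x)"
proof -
  have "N +> (c \<odot> y) = N +> (c \<odot> x)" if y: "y \<in> N +> x" for y
  proof -
    have y': "y \<in> carrier M"
      using y x a_elemrcos_carrier by blast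
    with y x c have "y \<ominus> x \<in> N"
      by (simp add: a_rcos_module a_minus_def)
    then have "c \<odot> (y \<ominus> x) \<in> N" using c by simp
    then have "c \<odot> y \<ominus> c \<odot> x \<in> N"
      using c x y' by (simp add: a_minus_def smult_r_distr smult_r_minus)
    then show ?thesis using c x y' by (simp add: quotient_eq_iff)
  qed
  moreover have "N +> x \<noteq> {}" using a_rcos_self[OF x] by blast
  ultimately have "(\<Union>y\<in>N +> x. N +> (c \<odot> y)) = N +> (c \<odot> x)"
    by (intro SUP_eq_const) auto
  then show ?thesis by (simp add: quotient_module_def)
qed

lemma quotient_module: "module R (quotient_module M N)"
proof -
  note [simp] = quotient_carrier quotient_add quotient_smult quotient_zero
  show ?thesis
    by (rule module_axiomsI)
      (auto simp: M.a_ac smult_l_distr smult_r_distr smult_assoc1 R.is_cring)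
qed

lemma quotient_map_hom: "(\<lambda>x. N +> x) \<in> module_hom R M (quotient_module M N)"
  by (rule module_homI) (simp_all add: quotient_carrier quotient_add quotient_smult)

lemma in_quotient_self: "x \<in> carrier M \<Longrightarrow> x \<in> N +> x"
  by (rule a_rcos_self)

lemma quotient_of_mem:
  assumes "U \<in> carrier (quotient_module M N)" "x \<in> U"
  shows "x \<in> carrier M" "U = N +> x"
proof -
  obtain y where y: "y \<in> carrier M" "U = N +> y"
    using assms(1) by (auto simp: quotient_carrier)
  then show "x \<in> carrier M" using assms(2) a_elemrcos_carrier by blast
  show "U = N +> x" using a_repr_independence'[of x y] y assms(2) by simp
qed

end

section \<open>The ground ring as a module, and modules of homomorphisms\<close>

lemma regular_module: "cring R \<Longrightarrow> module R (regular_module R)"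
proof -
  assume "cring R"
  then interpret cring R .
  show ?thesis
    by (rule module_axiomsI) (auto simp: regular_module_def a_ac m_assoc l_distr r_distr is_cring)
qed

lemma regular_module_simps [simp]:
  "carrier (regular_module R) = carrier R" "add (regular_module R) = add R"
  "zero (regular_module R) = zero R" "smult (regular_module R) = mult R"
  by (simp_all add: regular_module_def)

lemma hom_module_simps:
  "carrier (hom_module R V W) = module_hom R V W \<inter> extensional (carrier V)"
  "zero (hom_module R V W) = (\<lambda>v\<in>carrier V. \<zero>\<^bsub>W\<^esub>)"
  "f \<oplus>\<^bsub>hom_module R V W\<^esub> g = (\<lambda>v\<in>carrier V. f v \<oplus>\<^bsub>W\<^esub> g v)"
  "c \<odot>\<^bsub>hom_module R V W\<^esub> f = (\<lambda>v\<in>carrier V. c \<odot>\<^bsub>W\<^esub> f v)"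
  by (simp_all add: hom_module_def)

lemma restrict_in_hom_module:
  assumes "module R V" "f \<in> module_hom R V W"
  shows "(\<lambda>v\<in>carrier V. f v) \<in> carrier (hom_module R V W)"
  using module_hom_cong[OF assms, of "\<lambda>v\<in>carrier V. f v"] by (simp add: hom_module_simps)

lemma module_hom_zero_map:
  "module R W \<Longrightarrow> (\<lambda>v. \<zero>\<^bsub>W\<^esub>) \<in> module_hom R V W"
proof -
  assume "module R W"
  then interpret module R W .
  show ?thesis by (rule module_homI) auto
qed

lemma hom_module:
  assumes V: "module R V" and W: "module R W"
  shows "module R (hom_module R V W)"
proof -
  interpret V: module R V by fact
  interpret W: module R W by fact
  have in_W: "f v \<in> carrier W" if "f \<in> carrier (hom_module R V W)" "v \<in> carrier V" for f v
    using that by (auto simp: hom_module_simps module_hom_in)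
  have smult_hom: "(\<lambda>v. c \<odot>\<^bsub>W\<^esub> f v) \<in> module_hom R V W"
    if "c \<in> carrier R" "f \<in> module_hom R V W" for c f
    using module_hom_compose[OF that(2) W.module_hom_self_smult[OF that(1)]] .
  have ext: "f = g" if "f \<in> carrier (hom_module R V W)" "g \<in> carrier (hom_module R V W)"
    "\<And>v. v \<in> carrier V \<Longrightarrow> f v = g v" for f g
    using that by (auto simp: hom_module_simps intro: extensionalityI)
  have closed: "\<zero>\<^bsub>hom_module R V W\<^esub> \<in> carrier (hom_module R V W)"
    "\<lbrakk>f \<in> carrier (hom_module R V W); g \<in> carrier (hom_module R V W)\<rbrakk>
      \<Longrightarrow> f \<oplus>\<^bsub>hom_module R V W\<^esub> g \<in> carrier (hom_module R V W)"
    "\<lbrakk>c \<in> carrier R; f \<in> carrier (hom_module R V W)\<rbrakk>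
      \<Longrightarrow> c \<odot>\<^bsub>hom_module R V W\<^esub> f \<in> carrier (hom_module R V W)" for c f g
    using restrict_in_hom_module[OF V module_hom_zero_map[OF W]]
      restrict_in_hom_module[OF V module_hom_add_maps[OF W, of f V g]]
      restrict_in_hom_module[OF V smult_hom[of c f]]
    by (simp_all add: hom_module_simps)
  let ?H = "hom_module R V W"
  note app = hom_module_simps(2-4) in_W
  have zero: "f \<oplus>\<^bsub>?H\<^esub> \<zero>\<^bsub>?H\<^esub> = f" "\<one>\<^bsub>R\<^esub> \<odot>\<^bsub>?H\<^esub> f = f" "\<zero>\<^bsub>R\<^esub> \<odot>\<^bsub>?H\<^esub> f = \<zero>\<^bsub>?H\<^esub>"
    if f: "f \<in> carrier ?H" for f
    by (rule ext; (intro closed f V.R.one_closed V.R.zero_closed)?; simp add: app f)+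
  have add: "f \<oplus>\<^bsub>?H\<^esub> g = g \<oplus>\<^bsub>?H\<^esub> f"
      "f \<oplus>\<^bsub>?H\<^esub> g \<oplus>\<^bsub>?H\<^esub> h = f \<oplus>\<^bsub>?H\<^esub> (g \<oplus>\<^bsub>?H\<^esub> h)"
    if f: "f \<in> carrier ?H" "g \<in> carrier ?H" "h \<in> carrier ?H" for f g h
    by (rule ext; (intro closed f)?; simp add: app f W.a_ac)+
  have smult: "(a \<otimes>\<^bsub>R\<^esub> b) \<odot>\<^bsub>?H\<^esub> f = a \<odot>\<^bsub>?H\<^esub> (b \<odot>\<^bsub>?H\<^esub> f)"
      "(a \<oplus>\<^bsub>R\<^esub> b) \<odot>\<^bsub>?H\<^esub> f = a \<odot>\<^bsub>?H\<^esub> f \<oplus>\<^bsub>?H\<^esub> b \<odot>\<^bsub>?H\<^esub> f"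
      "a \<odot>\<^bsub>?H\<^esub> (f \<oplus>\<^bsub>?H\<^esub> g) = a \<odot>\<^bsub>?H\<^esub> f \<oplus>\<^bsub>?H\<^esub> a \<odot>\<^bsub>?H\<^esub> g"
    if f: "f \<in> carrier ?H" "g \<in> carrier ?H" "a \<in> carrier R" "b \<in> carrier R" for f g a b
    by (rule ext; (intro closed f V.R.m_closed V.R.a_closed)?;
        simp add: app f W.smult_l_distr W.smult_r_distr W.smult_assoc1)+
  show ?thesis
    by (rule module_axiomsI)
      (simp_all only: V.R.is_cring closed zero add(2) smult, simp_all only: add(1))
qed

section \<open>Free modules\<close>

lemma free_module_simps:
  "carrier (free_module R I) = {f \<in> I \<rightarrow>\<^sub>E carrier R. finite {p \<in> I. f p \<noteq> \<zero>\<^bsub>R\<^esub>}}"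
  "\<zero>\<^bsub>free_module R I\<^esub> = (\<lambda>p\<in>I. \<zero>\<^bsub>R\<^esub>)"
  "f \<oplus>\<^bsub>free_module R I\<^esub> g = (\<lambda>p\<in>I. f p \<oplus>\<^bsub>R\<^esub> g p)"
  "c \<odot>\<^bsub>free_module R I\<^esub> f = (\<lambda>p\<in>I. c \<otimes>\<^bsub>R\<^esub> f p)"
  by (simp_all add: free_module_def)

lemma free_module_apply:
  "\<lbrakk>f \<in> carrier (free_module R I); p \<in> I\<rbrakk> \<Longrightarrow> f p \<in> carrier R"
  by (auto simp: free_module_simps PiE_iff)

lemma free_module:
  assumes "cring R"
  shows "module R (free_module R I)"
proof -
  interpret cring R by fact
  let ?M = "free_module R I"
  have ext: "f = g" if "f \<in> carrier ?M" "g \<in> carrier ?M" "\<And>p. p \<in> I \<Longrightarrow> f p = g p" for f g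
    using that by (auto simp: free_module_simps intro: PiE_ext)
  have zeroM: "\<zero>\<^bsub>?M\<^esub> \<in> carrier ?M"
    by (auto simp: free_module_simps)
  have add_closed: "f \<oplus>\<^bsub>?M\<^esub> g \<in> carrier ?M" if "f \<in> carrier ?M" "g \<in> carrier ?M" for f g
  proof -
    have "finite ({p \<in> I. f p \<noteq> \<zero>\<^bsub>R\<^esub>} \<union> {p \<in> I. g p \<noteq> \<zero>\<^bsub>R\<^esub>})"
      using that by (simp add: free_module_simps)
    moreover have "{p \<in> I. f p \<oplus>\<^bsub>R\<^esub> g p \<noteq> \<zero>\<^bsub>R\<^esub>} \<subseteq> {p \<in> I. f p \<noteq> \<zero>\<^bsub>R\<^esub>} \<union> {p \<in> I. g p \<noteq> \<zero>\<^bsub>R\<^esub>}"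
      by auto
    ultimately have "finite {p \<in> I. f p \<oplus>\<^bsub>R\<^esub> g p \<noteq> \<zero>\<^bsub>R\<^esub>}" by (rule rev_finite_subset)
    moreover have "{p \<in> I. (f \<oplus>\<^bsub>?M\<^esub> g) p \<noteq> \<zero>\<^bsub>R\<^esub>} = {p \<in> I. f p \<oplus>\<^bsub>R\<^esub> g p \<noteq> \<zero>\<^bsub>R\<^esub>}"
      by (auto simp: free_module_simps)
    ultimately show ?thesis
      using that by (auto simp: free_module_simps(1,3))
  qed
  have smult_closed: "c \<odot>\<^bsub>?M\<^esub> f \<in> carrier ?M" if "c \<in> carrier R" "f \<in> carrier ?M" for c f
  proof -
    have "finite {p \<in> I. f p \<noteq> \<zero>\<^bsub>R\<^esub>}" using that by (simp add: free_module_simps)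
    moreover have "{p \<in> I. c \<otimes>\<^bsub>R\<^esub> f p \<noteq> \<zero>\<^bsub>R\<^esub>} \<subseteq> {p \<in> I. f p \<noteq> \<zero>\<^bsub>R\<^esub>}"
      using that by auto
    ultimately have "finite {p \<in> I. c \<otimes>\<^bsub>R\<^esub> f p \<noteq> \<zero>\<^bsub>R\<^esub>}" by (rule rev_finite_subset)
    moreover have "{p \<in> I. (c \<odot>\<^bsub>?M\<^esub> f) p \<noteq> \<zero>\<^bsub>R\<^esub>} = {p \<in> I. c \<otimes>\<^bsub>R\<^esub> f p \<noteq> \<zero>\<^bsub>R\<^esub>}"
      by (auto simp: free_module_simps)
    ultimately show ?thesis
      using that by (auto simp: free_module_simps(1,4))
  qed
  note closed = zeroM add_closed smult_closed
  have F: "f p \<in> carrier R" if "f \<in> carrier ?M" "p \<in> I" for f p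
    using that by (rule free_module_apply)
  note app = free_module_simps(2-4) F
  have zero: "f \<oplus>\<^bsub>?M\<^esub> \<zero>\<^bsub>?M\<^esub> = f" "\<one>\<^bsub>R\<^esub> \<odot>\<^bsub>?M\<^esub> f = f" "\<zero>\<^bsub>R\<^esub> \<odot>\<^bsub>?M\<^esub> f = \<zero>\<^bsub>?M\<^esub>"
    if f: "f \<in> carrier ?M" for f
    by (rule ext; (intro closed f one_closed zero_closed)?; simp add: app f)+
  have add: "f \<oplus>\<^bsub>?M\<^esub> g = g \<oplus>\<^bsub>?M\<^esub> f"
      "f \<oplus>\<^bsub>?M\<^esub> g \<oplus>\<^bsub>?M\<^esub> h = f \<oplus>\<^bsub>?M\<^esub> (g \<oplus>\<^bsub>?M\<^esub> h)"
    if f: "f \<in> carrier ?M" "g \<in> carrier ?M" "h \<in> carrier ?M" for f g h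
    by (rule ext; (intro closed f)?; simp add: app f a_ac)+
  have smult: "(a \<otimes>\<^bsub>R\<^esub> b) \<odot>\<^bsub>?M\<^esub> f = a \<odot>\<^bsub>?M\<^esub> (b \<odot>\<^bsub>?M\<^esub> f)"
      "(a \<oplus>\<^bsub>R\<^esub> b) \<odot>\<^bsub>?M\<^esub> f = a \<odot>\<^bsub>?M\<^esub> f \<oplus>\<^bsub>?M\<^esub> b \<odot>\<^bsub>?M\<^esub> f"
      "a \<odot>\<^bsub>?M\<^esub> (f \<oplus>\<^bsub>?M\<^esub> g) = a \<odot>\<^bsub>?M\<^esub> f \<oplus>\<^bsub>?M\<^esub> a \<odot>\<^bsub>?M\<^esub> g"
    if f: "f \<in> carrier ?M" "g \<in> carrier ?M" "a \<in> carrier R" "b \<in> carrier R" for f g a b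
    by (rule ext; (intro closed f m_closed a_closed)?;
        simp add: app f l_distr r_distr m_assoc)+
  show ?thesis
    by (rule module_axiomsI)
      (simp_all only: is_cring closed zero add(2) smult, simp_all only: add(1))
qed

lemma free_gen_closed: "cring R \<Longrightarrow> p \<in> I \<Longrightarrow> free_gen R I p \<in> carrier (free_module R I)"
proof -
  assume "cring R"
  then interpret cring R .
  have "finite {q \<in> I. free_gen R I p q \<noteq> \<zero>\<^bsub>R\<^esub>}"
    by (rule finite_subset[of _ "{p}"]) (auto simp: free_gen_def)
  then show ?thesis by (auto simp: free_module_simps free_gen_def)
qed

text \<open>Induction on the support, which is finite for elements of the free module: splitting off
  one generator with its coefficient shrinks it.\<close>

lemma free_module_induct [consumes 2, case_names zero gen add smult]:
  assumes R: "cring R" and f: "f \<in> carrier (free_module R I)"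
    and P_zero: "P \<zero>\<^bsub>free_module R I\<^esub>"
    and P_gen: "\<And>p. p \<in> I \<Longrightarrow> P (free_gen R I p)"
    and P_add: "\<And>f g. \<lbrakk>f \<in> carrier (free_module R I); g \<in> carrier (free_module R I); P f; P g\<rbrakk>
      \<Longrightarrow> P (f \<oplus>\<^bsub>free_module R I\<^esub> g)"
    and P_smult: "\<And>c f. \<lbrakk>c \<in> carrier R; f \<in> carrier (free_module R I); P f\<rbrakk>
      \<Longrightarrow> P (c \<odot>\<^bsub>free_module R I\<^esub> f)"
  shows "P f"
proof -
  interpret cring R by fact
  let ?M = "free_module R I"
  interpret M: module R ?M by (rule free_module[OF R])
  have "finite {p \<in> I. f p \<noteq> \<zero>\<^bsub>R\<^esub>}" using f by (simp add: free_module_simps)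
  then show ?thesis using f
  proof (induct "{p \<in> I. f p \<noteq> \<zero>\<^bsub>R\<^esub>}" arbitrary: f rule: finite_induct)
    case empty
    then have "f = \<zero>\<^bsub>?M\<^esub>"
      by (intro PiE_ext[of f I "\<lambda>_. carrier R"]) (auto simp: free_module_simps)
    then show ?case using P_zero by simp
  next
    case (insert p S)
    define g where "g = (\<lambda>q\<in>I. if q = p then \<zero>\<^bsub>R\<^esub> else f q)"
    have p: "p \<in> I" using insert.hyps(4) by auto
    have supp: "S = {q \<in> I. g q \<noteq> \<zero>\<^bsub>R\<^esub>}"
      using insert.hyps(2,4) by (auto simp: g_def split: if_splits)
    have g: "g \<in> carrier ?M"
      using insert.prems insert.hyps(1) supp by (auto simp: g_def free_module_simps)
    have fp: "f p \<in> carrier R" using insert.prems p by (rule free_module_apply)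
    let ?h = "f p \<odot>\<^bsub>?M\<^esub> free_gen R I p"
    have h: "?h \<in> carrier ?M" using fp p by (simp add: free_gen_closed[OF R])
    have "f = g \<oplus>\<^bsub>?M\<^esub> ?h"
    proof (rule PiE_ext[of _ I "\<lambda>_. carrier R"])
      show "f \<in> I \<rightarrow>\<^sub>E carrier R" using insert.prems by (simp add: free_module_simps)
      show "g \<oplus>\<^bsub>?M\<^esub> ?h \<in> I \<rightarrow>\<^sub>E carrier R"
        using M.a_closed[OF g h] by (simp add: free_module_simps(1))
      show "f q = (g \<oplus>\<^bsub>?M\<^esub> ?h) q" if "q \<in> I" for q
        using that fp free_module_apply[OF insert.prems that]
        by (simp add: free_module_simps g_def free_gen_def)
    qed
    moreover have "P g" using insert.hyps(3) supp g by blast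
    moreover have "P ?h" using P_smult[OF fp free_gen_closed[OF R p] P_gen[OF p]] .
    ultimately show ?case using P_add[OF g h] by simp
  qed
qed

text \<open>The linear extension of \<open>b\<close> from the generators. Its body is the sum that
  \<open>tensor_lift\<close> applies to each representative of a coset, so
  \<open>tensor_lift\<close> can be analysed through it.\<close>

definition free_lift ::
  "('a, 'm) ring_scheme \<Rightarrow> 'x set \<Rightarrow> ('a, 'v, 'n) module_scheme \<Rightarrow> ('x \<Rightarrow> 'v) \<Rightarrow> ('x \<Rightarrow> 'a) \<Rightarrow> 'v" where
  "free_lift R I M b f = (\<Oplus>\<^bsub>M\<^esub>p\<in>{p \<in> I. f p \<noteq> \<zero>\<^bsub>R\<^esub>}. f p \<odot>\<^bsub>M\<^esub> b p)"

context
  fixes R and M (structure) and I and b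
  assumes M: "module R M" and b: "b \<in> I \<rightarrow> carrier M"
begin

interpretation module R M by (rule M)

text \<open>The supports of \<open>f\<close>, \<open>g\<close> and \<open>f + g\<close> differ, so
  additivity needs all three sums over one index set; the points added carry coefficient
  zero.\<close>

lemma free_lift_superset:
  assumes f: "f \<in> carrier (free_module R I)" and "finite S" "{p \<in> I. f p \<noteq> \<zero>\<^bsub>R\<^esub>} \<subseteq> S" "S \<subseteq> I"
  shows "free_lift R I M b f = (\<Oplus>p\<in>S. f p \<odot> b p)"
proof -
  have "f p \<odot> b p \<in> carrier M" "f p = \<zero>\<^bsub>R\<^esub> \<Longrightarrow> f p \<odot> b p = \<zero>" if "p \<in> S" for p
    using that assms(4) b free_module_apply[OF f, of p] by (auto simp: Pi_iff)
  then show ?thesis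
    unfolding free_lift_def using assms(2-4)
    by (intro M.add.finprod_mono_neutral_cong_left) auto
qed

lemma free_lift_hom: "free_lift R I M b \<in> module_hom R (free_module R I) M"
proof (rule module_homI)
  note F = free_module_apply
  have fin: "finite {p \<in> I. f p \<noteq> \<zero>\<^bsub>R\<^esub>}" if "f \<in> carrier (free_module R I)" for f
    using that by (simp add: free_module_simps)
  interpret FM: module R "free_module R I" by (rule free_module[OF R.is_cring])
  show "free_lift R I M b f \<in> carrier M" if "f \<in> carrier (free_module R I)" for f
    unfolding free_lift_def using b F[OF that] by (intro M.finsum_closed) auto
  show "free_lift R I M b (f \<oplus>\<^bsub>free_module R I\<^esub> g) = free_lift R I M b f \<oplus> free_lift R I M b g"
    if f: "f \<in> carrier (free_module R I)" and g: "g \<in> carrier (free_module R I)" for f g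
  proof -
    let ?S = "{p \<in> I. f p \<noteq> \<zero>\<^bsub>R\<^esub>} \<union> {p \<in> I. g p \<noteq> \<zero>\<^bsub>R\<^esub>}"
    have S: "finite ?S" using fin[OF f] fin[OF g] by simp
    have "free_lift R I M b (f \<oplus>\<^bsub>free_module R I\<^esub> g)
        = (\<Oplus>p\<in>?S. (f \<oplus>\<^bsub>free_module R I\<^esub> g) p \<odot> b p)"
      using FM.M.a_closed[OF f g] S by (intro free_lift_superset) (auto simp: free_module_simps(3))
    also have "\<dots> = (\<Oplus>p\<in>?S. f p \<odot> b p \<oplus> g p \<odot> b p)"
      using b F[OF f] F[OF g]
      by (intro M.finsum_cong') (auto simp: free_module_simps smult_l_distr Pi_iff)
    also have "\<dots> = (\<Oplus>p\<in>?S. f p \<odot> b p) \<oplus> (\<Oplus>p\<in>?S. g p \<odot> b p)"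
      using b F[OF f] F[OF g] by (intro M.finsum_addf) auto
    also have "\<dots> = free_lift R I M b f \<oplus> free_lift R I M b g"
      using S f g by (simp add: free_lift_superset[of f ?S] free_lift_superset[of g ?S])
    finally show ?thesis .
  qed
  show "free_lift R I M b (c \<odot>\<^bsub>free_module R I\<^esub> f) = c \<odot> free_lift R I M b f"
    if c: "c \<in> carrier R" and f: "f \<in> carrier (free_module R I)" for c f
  proof -
    let ?S = "{p \<in> I. f p \<noteq> \<zero>\<^bsub>R\<^esub>}"
    have "free_lift R I M b (c \<odot>\<^bsub>free_module R I\<^esub> f)
        = (\<Oplus>p\<in>?S. (c \<odot>\<^bsub>free_module R I\<^esub> f) p \<odot> b p)"
      using fin[OF f] FM.smult_closed[OF c f] c
      by (intro free_lift_superset) (auto simp: free_module_simps(4))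
    also have "\<dots> = (\<Oplus>p\<in>?S. c \<odot> (f p \<odot> b p))"
      using b F[OF f] c
      by (intro M.finsum_cong') (auto simp: free_module_simps smult_assoc1 Pi_iff)
    also have "\<dots> = c \<odot> free_lift R I M b f"
      unfolding free_lift_def
      using fin[OF f] c b F[OF f] by (intro finsum_smult_ldistr[symmetric]) auto
    finally show ?thesis .
  qed
qed

lemma free_lift_gen:
  assumes "p \<in> I"
  shows "free_lift R I M b (free_gen R I p) = b p"
proof -
  have "free_lift R I M b (free_gen R I p) = (\<Oplus>q\<in>{p}. free_gen R I p q \<odot> b q)"
    using assms free_gen_closed[OF R.is_cring assms]
    by (intro free_lift_superset) (auto simp: free_gen_def)
  also have "\<dots> = b p"
    using assms b by (subst M.finsum_insert) (auto simp: free_gen_def Pi_iff)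
  finally show ?thesis .
qed

end

section \<open>The universal property of the tensor product\<close>

definition bilinear_map ::
  "('a, 'm) ring_scheme \<Rightarrow> ('a, 'u, 'n) module_scheme \<Rightarrow> ('a, 'v, 'p) module_scheme
    \<Rightarrow> ('a, 'w, 'q) module_scheme \<Rightarrow> ('u \<Rightarrow> 'v \<Rightarrow> 'w) \<Rightarrow> bool" where
  "bilinear_map R M N P \<beta> \<longleftrightarrow>
     (\<forall>y\<in>carrier N. (\<lambda>x. \<beta> x y) \<in> module_hom R M P) \<and>
     (\<forall>x\<in>carrier M. \<beta> x \<in> module_hom R N P)"

lemma bilinear_mapI:
  assumes "\<And>x y. \<lbrakk>x \<in> carrier M; y \<in> carrier N\<rbrakk> \<Longrightarrow> \<beta> x y \<in> carrier P"
    and "\<And>x x' y. \<lbrakk>x \<in> carrier M; x' \<in> carrier M; y \<in> carrier N\<rbrakk>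
      \<Longrightarrow> \<beta> (x \<oplus>\<^bsub>M\<^esub> x') y = \<beta> x y \<oplus>\<^bsub>P\<^esub> \<beta> x' y"
    and "\<And>x y y'. \<lbrakk>x \<in> carrier M; y \<in> carrier N; y' \<in> carrier N\<rbrakk>
      \<Longrightarrow> \<beta> x (y \<oplus>\<^bsub>N\<^esub> y') = \<beta> x y \<oplus>\<^bsub>P\<^esub> \<beta> x y'"
    and "\<And>c x y. \<lbrakk>c \<in> carrier R; x \<in> carrier M; y \<in> carrier N\<rbrakk>
      \<Longrightarrow> \<beta> (c \<odot>\<^bsub>M\<^esub> x) y = c \<odot>\<^bsub>P\<^esub> \<beta> x y"
    and "\<And>c x y. \<lbrakk>c \<in> carrier R; x \<in> carrier M; y \<in> carrier N\<rbrakk>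
      \<Longrightarrow> \<beta> x (c \<odot>\<^bsub>N\<^esub> y) = c \<odot>\<^bsub>P\<^esub> \<beta> x y"
  shows "bilinear_map R M N P \<beta>"
  unfolding bilinear_map_def by (intro conjI ballI module_homI; rule assms)

lemma bilinear_mapD:
  assumes "bilinear_map R M N P \<beta>"
  shows "y \<in> carrier N \<Longrightarrow> (\<lambda>x. \<beta> x y) \<in> module_hom R M P"
    and "x \<in> carrier M \<Longrightarrow> \<beta> x \<in> module_hom R N P"
  using assms by (auto simp: bilinear_map_def)

lemma bilinear_map_simps:
  assumes "bilinear_map R M N P \<beta>"
  shows "\<lbrakk>x \<in> carrier M; y \<in> carrier N\<rbrakk> \<Longrightarrow> \<beta> x y \<in> carrier P"
    and "\<lbrakk>x \<in> carrier M; x' \<in> carrier M; y \<in> carrier N\<rbrakk>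
      \<Longrightarrow> \<beta> (x \<oplus>\<^bsub>M\<^esub> x') y = \<beta> x y \<oplus>\<^bsub>P\<^esub> \<beta> x' y"
    and "\<lbrakk>x \<in> carrier M; y \<in> carrier N; y' \<in> carrier N\<rbrakk>
      \<Longrightarrow> \<beta> x (y \<oplus>\<^bsub>N\<^esub> y') = \<beta> x y \<oplus>\<^bsub>P\<^esub> \<beta> x y'"
    and "\<lbrakk>c \<in> carrier R; x \<in> carrier M; y \<in> carrier N\<rbrakk>
      \<Longrightarrow> \<beta> (c \<odot>\<^bsub>M\<^esub> x) y = c \<odot>\<^bsub>P\<^esub> \<beta> x y"
    and "\<lbrakk>c \<in> carrier R; x \<in> carrier M; y \<in> carrier N\<rbrakk>
      \<Longrightarrow> \<beta> x (c \<odot>\<^bsub>N\<^esub> y) = c \<odot>\<^bsub>P\<^esub> \<beta> x y"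
  using bilinear_mapD[OF assms]
  by (auto dest: module_hom_in module_hom_add module_hom_smult)

locale tensor_product = A: module F A + J: module F J
  for F :: "('f, 'm) ring_scheme" and A :: "('f, 'a, 'n) module_scheme"
    and J :: "('f, 'j, 'p) module_scheme"
begin

abbreviation "T \<equiv> tensor_space F A J"
abbreviation "t \<equiv> tensor F A J"

text \<open>The generating set inside \<open>tensor_relations\<close>, named separately so that
  facts about spans and their generators apply to it.\<close>

definition "relators = (let T = tensor_free F A J; g = tensor_gen F A J in
      ({g (a \<oplus>\<^bsub>A\<^esub> b) x \<ominus>\<^bsub>T\<^esub> (g a x \<oplus>\<^bsub>T\<^esub> g b x) | a b x.
          a \<in> carrier A \<and> b \<in> carrier A \<and> x \<in> carrier J}
       \<union> {g a (x \<oplus>\<^bsub>J\<^esub> y) \<ominus>\<^bsub>T\<^esub> (g a x \<oplus>\<^bsub>T\<^esub> g a y) | a x y.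
          a \<in> carrier A \<and> x \<in> carrier J \<and> y \<in> carrier J}
       \<union> {g (c \<odot>\<^bsub>A\<^esub> a) x \<ominus>\<^bsub>T\<^esub> (c \<odot>\<^bsub>T\<^esub> g a x) | c a x.
          c \<in> carrier F \<and> a \<in> carrier A \<and> x \<in> carrier J}
       \<union> {g a (c \<odot>\<^bsub>J\<^esub> x) \<ominus>\<^bsub>T\<^esub> (c \<odot>\<^bsub>T\<^esub> g a x) | c a x.
          c \<in> carrier F \<and> a \<in> carrier A \<and> x \<in> carrier J}))"

lemma tensor_relations_eq: "tensor_relations F A J = module.span F (tensor_free F A J) relators"
  by (simp add: tensor_relations_def relators_def Let_def)

sublocale free: module F "tensor_free F A J"
  unfolding tensor_free_def by (rule free_module[OF A.R.is_cring])

lemma tensor_gen_closed: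
  "\<lbrakk>a \<in> carrier A; x \<in> carrier J\<rbrakk> \<Longrightarrow> tensor_gen F A J a x \<in> carrier (tensor_free F A J)"
  by (simp add: tensor_gen_def tensor_free_def free_gen_closed[OF A.R.is_cring])

lemma relators_subset: "relators \<subseteq> carrier (tensor_free F A J)"
  unfolding relators_def Let_def by (auto simp: tensor_gen_closed)

lemma tensor_relations_submodule: "submodule F (tensor_relations F A J) (tensor_free F A J)"
  unfolding tensor_relations_eq by (rule free.span_is_submodule[OF relators_subset])

sublocale T: module F T
  unfolding tensor_space_def by (rule quotient_module[OF tensor_relations_submodule])

lemma tensor_closed [simp]: "\<lbrakk>a \<in> carrier A; x \<in> carrier J\<rbrakk> \<Longrightarrow> t a x \<in> carrier T"
  by (simp add: tensor_def tensor_space_def quotient_carrier[OF tensor_relations_submodule]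
      tensor_gen_closed)

lemma relator_in: "r \<in> relators \<Longrightarrow> r \<in> tensor_relations F A J"
  using free.in_own_span[OF relators_subset] by (auto simp: tensor_relations_eq)

lemma tensor_add_left:
  assumes "a \<in> carrier A" "b \<in> carrier A" "x \<in> carrier J"
  shows "t (a \<oplus>\<^bsub>A\<^esub> b) x = t a x \<oplus>\<^bsub>T\<^esub> t b x"
proof -
  let ?g = "tensor_gen F A J" and ?T = "tensor_free F A J"
  have "?g (a \<oplus>\<^bsub>A\<^esub> b) x \<ominus>\<^bsub>?T\<^esub> (?g a x \<oplus>\<^bsub>?T\<^esub> ?g b x) \<in> tensor_relations F A J"
    using assms by (intro relator_in) (unfold relators_def Let_def, blast)
  then show ?thesis
    using assms unfolding tensor_def tensor_space_def
    by (simp add: quotient_add[OF tensor_relations_submodule]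
        quotient_eq_iff[OF tensor_relations_submodule] tensor_gen_closed)
qed

lemma tensor_add_right:
  assumes "a \<in> carrier A" "x \<in> carrier J" "y \<in> carrier J"
  shows "t a (x \<oplus>\<^bsub>J\<^esub> y) = t a x \<oplus>\<^bsub>T\<^esub> t a y"
proof -
  let ?g = "tensor_gen F A J" and ?T = "tensor_free F A J"
  have "?g a (x \<oplus>\<^bsub>J\<^esub> y) \<ominus>\<^bsub>?T\<^esub> (?g a x \<oplus>\<^bsub>?T\<^esub> ?g a y) \<in> tensor_relations F A J"
    using assms by (intro relator_in) (unfold relators_def Let_def, blast)
  then show ?thesis
    using assms unfolding tensor_def tensor_space_def
    by (simp add: quotient_add[OF tensor_relations_submodule]
        quotient_eq_iff[OF tensor_relations_submodule] tensor_gen_closed)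
qed

lemma tensor_smult_left:
  assumes "c \<in> carrier F" "a \<in> carrier A" "x \<in> carrier J"
  shows "t (c \<odot>\<^bsub>A\<^esub> a) x = c \<odot>\<^bsub>T\<^esub> t a x"
proof -
  let ?g = "tensor_gen F A J" and ?T = "tensor_free F A J"
  have "?g (c \<odot>\<^bsub>A\<^esub> a) x \<ominus>\<^bsub>?T\<^esub> (c \<odot>\<^bsub>?T\<^esub> ?g a x) \<in> tensor_relations F A J"
    using assms by (intro relator_in) (unfold relators_def Let_def, blast)
  then show ?thesis
    using assms unfolding tensor_def tensor_space_def
    by (simp add: quotient_smult[OF tensor_relations_submodule]
        quotient_eq_iff[OF tensor_relations_submodule] tensor_gen_closed)
qed

lemma tensor_smult_right:
  assumes "c \<in> carrier F" "a \<in> carrier A" "x \<in> carrier J"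
  shows "t a (c \<odot>\<^bsub>J\<^esub> x) = c \<odot>\<^bsub>T\<^esub> t a x"
proof -
  let ?g = "tensor_gen F A J" and ?T = "tensor_free F A J"
  have "?g a (c \<odot>\<^bsub>J\<^esub> x) \<ominus>\<^bsub>?T\<^esub> (c \<odot>\<^bsub>?T\<^esub> ?g a x) \<in> tensor_relations F A J"
    using assms by (intro relator_in) (unfold relators_def Let_def, blast)
  then show ?thesis
    using assms unfolding tensor_def tensor_space_def
    by (simp add: quotient_smult[OF tensor_relations_submodule]
        quotient_eq_iff[OF tensor_relations_submodule] tensor_gen_closed)
qed

lemma bilinear_tensor: "bilinear_map F A J T t"
  by (rule bilinear_mapI)
    (simp_all add: tensor_add_left tensor_add_right tensor_smult_left tensor_smult_right)

text \<open>There is no case for scalars because a multiple of a pure tensor is again pure: the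
  scalar moves into the left factor.\<close>

lemma tensor_induct [consumes 1, case_names zero tensor add]:
  assumes s: "s \<in> carrier T"
    and zero: "P \<zero>\<^bsub>T\<^esub>"
    and tensor: "\<And>a x. \<lbrakk>a \<in> carrier A; x \<in> carrier J\<rbrakk> \<Longrightarrow> P (t a x)"
    and add: "\<And>u v. \<lbrakk>u \<in> carrier T; v \<in> carrier T; P u; P v\<rbrakk> \<Longrightarrow> P (u \<oplus>\<^bsub>T\<^esub> v)"
  shows "P s"
proof -
  let ?q = "\<lambda>f. tensor_relations F A J +>\<^bsub>tensor_free F A J\<^esub> f"
  have q: "?q \<in> module_hom F (tensor_free F A J) T"
    unfolding tensor_space_def by (rule quotient_map_hom[OF tensor_relations_submodule])
  obtain f where f: "f \<in> carrier (tensor_free F A J)" "s = ?q f"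
    using s unfolding tensor_space_def
    by (auto simp: quotient_carrier[OF tensor_relations_submodule])
  \<comment> \<open>Strengthened to all multiples, so that the scalar case of the free module passes
    through the induction; \<open>c = 1\<close> recovers \<open>P s\<close>.\<close>
  have "\<forall>c\<in>carrier F. P (c \<odot>\<^bsub>T\<^esub> ?q f)"
    using A.R.is_cring f(1) unfolding tensor_free_def
  proof (induct rule: free_module_induct)
    case zero
    show ?case
      using assms(2) module_hom_zero[OF free.module_axioms T.module_axioms q]
      by (simp add: tensor_free_def)
  next
    case (gen p)
    obtain a x where p: "p = (a, x)" "a \<in> carrier A" "x \<in> carrier J" using gen by auto
    have "P (c \<odot>\<^bsub>T\<^esub> t a x)" if "c \<in> carrier F" for c
      using p that assms(3)[of "c \<odot>\<^bsub>A\<^esub> a" x] by (simp add: tensor_smult_left)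
    then show ?case by (simp add: p(1) tensor_def tensor_gen_def tensor_free_def)
  next
    case (add f g)
    have "?q f \<in> carrier T" "?q g \<in> carrier T"
      using add(1,2) module_hom_in[OF q] by (auto simp: tensor_free_def)
    with add(3,4) show ?case
      using assms(4) module_hom_add[OF q, of f g] add(1,2)
      by (simp add: tensor_free_def T.smult_r_distr)
  next
    case (smult c f)
    then show ?case
      using module_hom_smult[OF q, of c f] module_hom_in[OF q, of f]
      by (simp add: tensor_free_def T.smult_assoc1[symmetric])
  qed
  then have "P (\<one>\<^bsub>F\<^esub> \<odot>\<^bsub>T\<^esub> s)" using f(2) by (simp add: tensor_free_def)
  then show ?thesis using s by simp
qed

lemma tensor_hom_eqI:
  assumes "module F M" "h \<in> module_hom F T M" "h' \<in> module_hom F T M"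
    and "\<And>a x. \<lbrakk>a \<in> carrier A; x \<in> carrier J\<rbrakk> \<Longrightarrow> h (t a x) = h' (t a x)"
    and "s \<in> carrier T"
  shows "h s = h' s"
  using assms(5)
  by (induct rule: tensor_induct)
    (simp_all add: module_hom_zero[OF T.module_axioms assms(1)] assms(2-4)
      module_hom_add[OF assms(2)] module_hom_add[OF assms(3)])

section \<open>The linear map induced by a bilinear map, and its independence of
  representatives\<close>

context
  fixes M :: "('f, 'v, 'q) module_scheme" and \<beta>
  assumes M: "module F M" and \<beta>: "bilinear_map F A J M \<beta>"
begin

interpretation M: module F M by (rule M)

private abbreviation "L \<equiv> free_lift F (carrier A \<times> carrier J) M (\<lambda>p. \<beta> (fst p) (snd p))"

private lemma L_hom: "L \<in> module_hom F (tensor_free F A J) M"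
  unfolding tensor_free_def
  by (rule free_lift_hom[OF M]) (auto simp: bilinear_map_simps[OF \<beta>])

private lemma L_gen:
  "\<lbrakk>a \<in> carrier A; x \<in> carrier J\<rbrakk> \<Longrightarrow> L (tensor_gen F A J a x) = \<beta> a x"
  unfolding tensor_gen_def
  by (subst free_lift_gen[OF M]) (auto simp: bilinear_map_simps[OF \<beta>])

text \<open>The kernel of \<open>L\<close> is a submodule and contains the relators because
  \<open>\<beta>\<close> is bilinear; hence it contains their span.\<close>

private lemma L_relations: "r \<in> tensor_relations F A J \<Longrightarrow> L r = \<zero>\<^bsub>M\<^esub>"
proof -
  let ?K = "{f \<in> carrier (tensor_free F A J). L f = \<zero>\<^bsub>M\<^esub>}"
  have "relators \<subseteq> ?K"
    using module_hom_minus[OF free.module_axioms M L_hom] module_hom_add[OF L_hom]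
      module_hom_smult[OF L_hom]
    unfolding relators_def Let_def
    by (auto simp: tensor_gen_closed L_gen bilinear_map_simps[OF \<beta>])
  then have "tensor_relations F A J \<subseteq> ?K"
    unfolding tensor_relations_eq
    by (rule free.span_is_subset) (rule kernel_submodule[OF free.module_axioms M L_hom])
  then show "r \<in> tensor_relations F A J \<Longrightarrow> L r = \<zero>\<^bsub>M\<^esub>" by blast
qed

text \<open>\<open>tensor_lift\<close> takes \<open>the_elem\<close> of the image of a coset, so
  that image must be a singleton: two representatives differ by a relation, and \<open>L\<close>
  vanishes there.\<close>

private lemma lift_coset:
  assumes f: "f \<in> carrier (tensor_free F A J)"
  shows "tensor_lift F A J M \<beta> (tensor_relations F A J +>\<^bsub>tensor_free F A J\<^esub> f) = L f"
proof -
  let ?U = "tensor_relations F A J +>\<^bsub>tensor_free F A J\<^esub> f"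
  have *: "L g = L f" if g: "g \<in> ?U" for g
  proof -
    have U: "?U \<in> carrier (quotient_module (tensor_free F A J) (tensor_relations F A J))"
      using f by (simp add: quotient_carrier[OF tensor_relations_submodule])
    have g': "g \<in> carrier (tensor_free F A J)"
      by (rule quotient_of_mem(1)[OF tensor_relations_submodule U g])
    have "f \<ominus>\<^bsub>tensor_free F A J\<^esub> g \<in> tensor_relations F A J"
      using quotient_of_mem(2)[OF tensor_relations_submodule U g]
        quotient_eq_iff[OF tensor_relations_submodule f g'] by simp
    from L_relations[OF this] show ?thesis
      using module_hom_minus[OF free.module_axioms M L_hom f g'] module_hom_in[OF L_hom] f g' by simp
  qed
  have "f \<in> ?U" by (rule in_quotient_self[OF tensor_relations_submodule f])
  then have "L ` ?U = {L f}" using * by blast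
  then show ?thesis
    unfolding tensor_lift_def free_lift_def by simp
qed

lemma tensor_lift_tensor:
  "\<lbrakk>a \<in> carrier A; x \<in> carrier J\<rbrakk> \<Longrightarrow> tensor_lift F A J M \<beta> (t a x) = \<beta> a x"
  unfolding tensor_def by (simp add: lift_coset tensor_gen_closed L_gen)

lemma tensor_lift_hom: "tensor_lift F A J M \<beta> \<in> module_hom F T M"
proof (rule module_homI)
  let ?q = "\<lambda>f. tensor_relations F A J +>\<^bsub>tensor_free F A J\<^esub> f"
  note S = tensor_relations_submodule
  have ex: "\<exists>f\<in>carrier (tensor_free F A J). s = ?q f" if "s \<in> carrier T" for s
    using that unfolding tensor_space_def by (auto simp: quotient_carrier[OF S])
  show "tensor_lift F A J M \<beta> s \<in> carrier M" if "s \<in> carrier T" for s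
    using ex[OF that] by (auto simp: lift_coset module_hom_in[OF L_hom])
  show "tensor_lift F A J M \<beta> (s \<oplus>\<^bsub>T\<^esub> s') = tensor_lift F A J M \<beta> s \<oplus>\<^bsub>M\<^esub> tensor_lift F A J M \<beta> s'"
    if "s \<in> carrier T" "s' \<in> carrier T" for s s'
    using ex[OF that(1)] ex[OF that(2)] unfolding tensor_space_def
    by (auto simp: lift_coset quotient_add[OF S] module_hom_add[OF L_hom])
  show "tensor_lift F A J M \<beta> (c \<odot>\<^bsub>T\<^esub> s) = c \<odot>\<^bsub>M\<^esub> tensor_lift F A J M \<beta> s"
    if "c \<in> carrier F" "s \<in> carrier T" for c s
    using that(1) ex[OF that(2)] unfolding tensor_space_def
    by (auto simp: lift_coset quotient_smult[OF S] module_hom_smult[OF L_hom])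
qed

end

end

section \<open>Coordinates on tensor products\<close>

context tensor_product
begin

text \<open>This is \<open>w \<otimes> id\<close> followed by \<open>F \<otimes> J = J\<close>. The
  case \<open>w = \<epsilon>\<close> is \<open>tensor_aug\<close>; the cases \<open>w = u i\<close>
  are the remaining coordinates.\<close>

definition contraction :: "('a \<Rightarrow> 'f) \<Rightarrow> ('a \<times> 'j \<Rightarrow> 'f) set \<Rightarrow> 'j" where
  "contraction w = tensor_lift F A J J (\<lambda>a x. w a \<odot>\<^bsub>J\<^esub> x)"

lemma tensor_aug_eq: "tensor_aug F J A \<epsilon> = contraction \<epsilon>"
  by (simp add: tensor_aug_def contraction_def)

lemma bilinear_functional_smult:
  assumes w: "w \<in> module_hom F A (regular_module F)"
  shows "bilinear_map F A J J (\<lambda>a x. w a \<odot>\<^bsub>J\<^esub> x)"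
  using module_hom_in[OF w] module_hom_add[OF w] module_hom_smult[OF w]
  by (intro bilinear_mapI)
    (simp_all add: J.smult_l_distr J.smult_r_distr J.smult_assoc1[symmetric] A.R.m_comm)

lemma contraction_hom:
  "w \<in> module_hom F A (regular_module F) \<Longrightarrow> contraction w \<in> module_hom F T J"
  unfolding contraction_def
  by (rule tensor_lift_hom[OF J.module_axioms bilinear_functional_smult])

lemma contraction_tensor:
  "\<lbrakk>w \<in> module_hom F A (regular_module F); a \<in> carrier A; x \<in> carrier J\<rbrakk>
    \<Longrightarrow> contraction w (t a x) = w a \<odot>\<^bsub>J\<^esub> x"
  unfolding contraction_def
  by (rule tensor_lift_tensor[OF J.module_axioms bilinear_functional_smult])

end

locale tensor_algebra_product = A: algebra F A + tensor_product F A J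
  for F :: "('f, 'm) ring_scheme" and A :: "('f, 'a, 'n) module_scheme"
    and J :: "('f, 'j, 'p) module_scheme"
begin

lemma bilinear_tensor_mult:
  assumes "b \<in> carrier A"
  shows "bilinear_map F A J T (\<lambda>a x. t (b \<otimes>\<^bsub>A\<^esub> a) x)"
proof (rule bilinear_mapI)
  fix c a x assume "c \<in> carrier F" "a \<in> carrier A" "x \<in> carrier J"
  moreover from this have "b \<otimes>\<^bsub>A\<^esub> (c \<odot>\<^bsub>A\<^esub> a) = c \<odot>\<^bsub>A\<^esub> (b \<otimes>\<^bsub>A\<^esub> a)"
    using assms A.smult_assoc2[of c a b] by (simp add: A.m_comm)
  ultimately show "t (b \<otimes>\<^bsub>A\<^esub> (c \<odot>\<^bsub>A\<^esub> a)) x = c \<odot>\<^bsub>T\<^esub> t (b \<otimes>\<^bsub>A\<^esub> a) x"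
    using assms by (simp add: tensor_smult_left)
qed (use assms in \<open>simp_all add: A.r_distr tensor_add_left tensor_add_right tensor_smult_right\<close>)

lemma tensor_smult_hom: "b \<in> carrier A \<Longrightarrow> tensor_smult F A J b \<in> module_hom F T T"
  unfolding tensor_smult_def
  by (rule tensor_lift_hom[OF T.module_axioms bilinear_tensor_mult])

lemma tensor_smult_tensor:
  "\<lbrakk>b \<in> carrier A; a \<in> carrier A; x \<in> carrier J\<rbrakk>
    \<Longrightarrow> tensor_smult F A J b (t a x) = t (b \<otimes>\<^bsub>A\<^esub> a) x"
  unfolding tensor_smult_def
  by (rule tensor_lift_tensor[OF T.module_axioms bilinear_tensor_mult])

end

text \<open>
  The functionals \<open>\<epsilon>, u i\<close> are dual to the basis \<open>1, m i\<close> of \<open>A\<close>. The rule \<open>u_mult\<close> encodes that the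
  product of any two elements of the kernel of \<open>\<epsilon>\<close> vanishes.
\<close>
locale coordinatized_base = field F + A: algebra F A + tensor_algebra_product F A J +
    J: jacobi_jordan_algebra F J
  for F :: "('f, 'm) ring_scheme" and A :: "('f, 'a, 'n) module_scheme"
    and J :: "('f, 'j, 'p) module_scheme" +
  fixes \<epsilon> :: "'a \<Rightarrow> 'f" and I :: "'i set" and u :: "'i \<Rightarrow> 'a \<Rightarrow> 'f" and m :: "'i \<Rightarrow> 'a"
  assumes finite_I: "finite I"
    and eps_hom: "\<epsilon> \<in> module_hom F A (regular_module F)"
    and u_hom: "i \<in> I \<Longrightarrow> u i \<in> module_hom F A (regular_module F)"
    and m_closed [simp]: "i \<in> I \<Longrightarrow> m i \<in> carrier A"
    and eps_one [simp]: "\<epsilon> \<one>\<^bsub>A\<^esub> = \<one>\<^bsub>F\<^esub>"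
    and u_one [simp]: "i \<in> I \<Longrightarrow> u i \<one>\<^bsub>A\<^esub> = \<zero>\<^bsub>F\<^esub>"
    and eps_m [simp]: "i \<in> I \<Longrightarrow> \<epsilon> (m i) = \<zero>\<^bsub>F\<^esub>"
    and u_m: "\<lbrakk>i \<in> I; j \<in> I\<rbrakk> \<Longrightarrow> u i (m j) = (if i = j then \<one>\<^bsub>F\<^esub> else \<zero>\<^bsub>F\<^esub>)"
    and coord_eqI: "\<lbrakk>a \<in> carrier A; b \<in> carrier A; \<epsilon> a = \<epsilon> b; \<And>i. i \<in> I \<Longrightarrow> u i a = u i b\<rbrakk> \<Longrightarrow> a = b"
    and eps_mult: "\<lbrakk>a \<in> carrier A; b \<in> carrier A\<rbrakk> \<Longrightarrow> \<epsilon> (a \<otimes>\<^bsub>A\<^esub> b) = \<epsilon> a \<otimes>\<^bsub>F\<^esub> \<epsilon> b"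
    and u_mult: "\<lbrakk>i \<in> I; a \<in> carrier A; b \<in> carrier A\<rbrakk>
      \<Longrightarrow> u i (a \<otimes>\<^bsub>A\<^esub> b) = \<epsilon> a \<otimes>\<^bsub>F\<^esub> u i b \<oplus>\<^bsub>F\<^esub> u i a \<otimes>\<^bsub>F\<^esub> \<epsilon> b"
begin

lemma regular_F: "module F (regular_module F)"
  by (rule regular_module[OF is_cring])

lemma eps_simps [simp]:
  "a \<in> carrier A \<Longrightarrow> \<epsilon> a \<in> carrier F"
  "\<lbrakk>a \<in> carrier A; b \<in> carrier A\<rbrakk> \<Longrightarrow> \<epsilon> (a \<oplus>\<^bsub>A\<^esub> b) = \<epsilon> a \<oplus>\<^bsub>F\<^esub> \<epsilon> b"
  "\<lbrakk>c \<in> carrier F; a \<in> carrier A\<rbrakk> \<Longrightarrow> \<epsilon> (c \<odot>\<^bsub>A\<^esub> a) = c \<otimes>\<^bsub>F\<^esub> \<epsilon> a"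
  using module_hom_in[OF eps_hom] module_hom_add[OF eps_hom] module_hom_smult[OF eps_hom] by auto

lemma u_simps [simp]:
  "\<lbrakk>i \<in> I; a \<in> carrier A\<rbrakk> \<Longrightarrow> u i a \<in> carrier F"
  "\<lbrakk>i \<in> I; a \<in> carrier A; b \<in> carrier A\<rbrakk> \<Longrightarrow> u i (a \<oplus>\<^bsub>A\<^esub> b) = u i a \<oplus>\<^bsub>F\<^esub> u i b"
  "\<lbrakk>i \<in> I; c \<in> carrier F; a \<in> carrier A\<rbrakk> \<Longrightarrow> u i (c \<odot>\<^bsub>A\<^esub> a) = c \<otimes>\<^bsub>F\<^esub> u i a"
  using module_hom_in[OF u_hom] module_hom_add[OF u_hom] module_hom_smult[OF u_hom] by auto

lemma finsum_delta:
  assumes "module F M" "i \<in> I" "\<And>j. j \<in> I \<Longrightarrow> g j \<in> carrier M"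
  shows "(\<Oplus>\<^bsub>M\<^esub>j\<in>I. (if i = j then \<one>\<^bsub>F\<^esub> else \<zero>\<^bsub>F\<^esub>) \<odot>\<^bsub>M\<^esub> g j) = g i"
proof -
  interpret M: module F M by fact
  have "(\<Oplus>\<^bsub>M\<^esub>j\<in>I. (if i = j then \<one>\<^bsub>F\<^esub> else \<zero>\<^bsub>F\<^esub>) \<odot>\<^bsub>M\<^esub> g j)
      = (\<Oplus>\<^bsub>M\<^esub>j\<in>I. if i = j then g j else \<zero>\<^bsub>M\<^esub>)"
    using assms(3) by (intro M.M.finsum_cong') auto
  also have "\<dots> = g i"
    using assms finite_I by (intro M.M.add.finprod_singleton) auto
  finally show ?thesis .
qed

text \<open>Duality leaves one term when a functional is applied to the sum. Besides the expansion
  of an element, this shows that coordinates in \<open>A\<close> can be prescribed, which the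
  classifying homomorphism relies on.\<close>

lemma base_combination:
  assumes c: "c \<in> carrier F" and f: "\<And>i. i \<in> I \<Longrightarrow> f i \<in> carrier F"
  defines "b \<equiv> c \<odot>\<^bsub>A\<^esub> \<one>\<^bsub>A\<^esub> \<oplus>\<^bsub>A\<^esub> (\<Oplus>\<^bsub>A\<^esub>i\<in>I. f i \<odot>\<^bsub>A\<^esub> m i)"
  shows "b \<in> carrier A" "\<epsilon> b = c" "j \<in> I \<Longrightarrow> u j b = f j"
proof -
  let ?s = "\<Oplus>\<^bsub>A\<^esub>i\<in>I. f i \<odot>\<^bsub>A\<^esub> m i"
  have s: "(\<lambda>i. f i \<odot>\<^bsub>A\<^esub> m i) \<in> I \<rightarrow> carrier A" using f by simp
  interpret RF: module F "regular_module F" by (rule regular_F)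
  show "b \<in> carrier A" using c s by (simp add: b_def)
  have "\<epsilon> ?s = \<zero>\<^bsub>F\<^esub>"
    unfolding module_hom_finsum[OF A.module_axioms regular_F eps_hom s]
    using f RF.M.add.finprod_one_eqI[of I "\<lambda>i. \<epsilon> (f i \<odot>\<^bsub>A\<^esub> m i)"] by simp
  then show "\<epsilon> b = c" using c s by (simp add: b_def)
  assume j: "j \<in> I"
  have "u j ?s = (\<Oplus>\<^bsub>regular_module F\<^esub>i\<in>I.
      (if j = i then \<one>\<^bsub>F\<^esub> else \<zero>\<^bsub>F\<^esub>) \<odot>\<^bsub>regular_module F\<^esub> f i)"
    unfolding module_hom_finsum[OF A.module_axioms regular_F u_hom[OF j] s]
    using f j by (intro RF.M.finsum_cong') (auto simp: u_m)
  also have "\<dots> = f j"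
    using f j by (intro finsum_delta[OF regular_F]) auto
  finally show "u j b = f j" using c f s j by (simp add: b_def)
qed

lemma base_expansion:
  assumes a: "a \<in> carrier A"
  shows "a = \<epsilon> a \<odot>\<^bsub>A\<^esub> \<one>\<^bsub>A\<^esub> \<oplus>\<^bsub>A\<^esub> (\<Oplus>\<^bsub>A\<^esub>i\<in>I. u i a \<odot>\<^bsub>A\<^esub> m i)"
  by (rule coord_eqI) (use a base_combination[of "\<epsilon> a" "\<lambda>i. u i a"] in simp_all)

abbreviation "aug \<equiv> contraction \<epsilon>"
abbreviation "coord i \<equiv> contraction (u i)"

text \<open>The inverse of the coordinate map \<open>s \<mapsto> (aug s, coord i s)\<close>; it
  exhibits the tensor product as \<open>J\<close> plus one further copy of \<open>J\<close> for each
  \<open>i\<close>.\<close>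

definition assemble :: "'j \<Rightarrow> ('i \<Rightarrow> 'j) \<Rightarrow> ('a \<times> 'j \<Rightarrow> 'f) set" where
  "assemble x g = t \<one>\<^bsub>A\<^esub> x \<oplus>\<^bsub>T\<^esub> (\<Oplus>\<^bsub>T\<^esub>i\<in>I. t (m i) (g i))"

lemma aug_hom: "aug \<in> module_hom F T J"
  by (rule contraction_hom[OF eps_hom])

lemma coord_hom: "i \<in> I \<Longrightarrow> coord i \<in> module_hom F T J"
  by (rule contraction_hom[OF u_hom])

lemma aug_simps [simp]:
  "s \<in> carrier T \<Longrightarrow> aug s \<in> carrier J"
  "\<lbrakk>s \<in> carrier T; s' \<in> carrier T\<rbrakk> \<Longrightarrow> aug (s \<oplus>\<^bsub>T\<^esub> s') = aug s \<oplus>\<^bsub>J\<^esub> aug s'"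
  "\<lbrakk>c \<in> carrier F; s \<in> carrier T\<rbrakk> \<Longrightarrow> aug (c \<odot>\<^bsub>T\<^esub> s) = c \<odot>\<^bsub>J\<^esub> aug s"
  "\<lbrakk>a \<in> carrier A; x \<in> carrier J\<rbrakk> \<Longrightarrow> aug (t a x) = \<epsilon> a \<odot>\<^bsub>J\<^esub> x"
  "aug \<zero>\<^bsub>T\<^esub> = \<zero>\<^bsub>J\<^esub>"
  using module_hom_in[OF aug_hom] module_hom_add[OF aug_hom] module_hom_smult[OF aug_hom]
    contraction_tensor[OF eps_hom] module_hom_zero[OF T.module_axioms J.module_axioms aug_hom]
  by auto

lemma coord_simps [simp]:
  "\<lbrakk>i \<in> I; s \<in> carrier T\<rbrakk> \<Longrightarrow> coord i s \<in> carrier J"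
  "\<lbrakk>i \<in> I; s \<in> carrier T; s' \<in> carrier T\<rbrakk> \<Longrightarrow> coord i (s \<oplus>\<^bsub>T\<^esub> s') = coord i s \<oplus>\<^bsub>J\<^esub> coord i s'"
  "\<lbrakk>i \<in> I; c \<in> carrier F; s \<in> carrier T\<rbrakk> \<Longrightarrow> coord i (c \<odot>\<^bsub>T\<^esub> s) = c \<odot>\<^bsub>J\<^esub> coord i s"
  "\<lbrakk>i \<in> I; a \<in> carrier A; x \<in> carrier J\<rbrakk> \<Longrightarrow> coord i (t a x) = u i a \<odot>\<^bsub>J\<^esub> x"
  "i \<in> I \<Longrightarrow> coord i \<zero>\<^bsub>T\<^esub> = \<zero>\<^bsub>J\<^esub>"
  using module_hom_in[OF coord_hom] module_hom_add[OF coord_hom] module_hom_smult[OF coord_hom]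
    contraction_tensor[OF u_hom] module_hom_zero[OF T.module_axioms J.module_axioms coord_hom]
  by auto

lemma assemble_closed [simp]:
  "\<lbrakk>x \<in> carrier J; \<And>i. i \<in> I \<Longrightarrow> g i \<in> carrier J\<rbrakk> \<Longrightarrow> assemble x g \<in> carrier T"
  unfolding assemble_def by (intro T.M.a_closed T.M.finsum_closed) auto

lemma aug_assemble [simp]:
  assumes "x \<in> carrier J" and g: "\<And>i. i \<in> I \<Longrightarrow> g i \<in> carrier J"
  shows "aug (assemble x g) = x"
proof -
  have "aug (\<Oplus>\<^bsub>T\<^esub>i\<in>I. t (m i) (g i)) = (\<Oplus>\<^bsub>J\<^esub>i\<in>I. aug (t (m i) (g i)))"
    using g by (intro module_hom_finsum[OF T.module_axioms J.module_axioms aug_hom]) auto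
  also have "\<dots> = \<zero>\<^bsub>J\<^esub>"
    using g by (intro J.M.add.finprod_one_eqI) auto
  finally show ?thesis using assms unfolding assemble_def by simp
qed

lemma coord_assemble [simp]:
  assumes "x \<in> carrier J" and g: "\<And>i. i \<in> I \<Longrightarrow> g i \<in> carrier J" and i: "i \<in> I"
  shows "coord i (assemble x g) = g i"
proof -
  have "coord i (\<Oplus>\<^bsub>T\<^esub>j\<in>I. t (m j) (g j)) = (\<Oplus>\<^bsub>J\<^esub>j\<in>I. coord i (t (m j) (g j)))"
    using g by (intro module_hom_finsum[OF T.module_axioms J.module_axioms coord_hom[OF i]]) auto
  also have "\<dots> = (\<Oplus>\<^bsub>J\<^esub>j\<in>I. (if i = j then \<one>\<^bsub>F\<^esub> else \<zero>\<^bsub>F\<^esub>) \<odot>\<^bsub>J\<^esub> g j)"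
    using g i by (intro J.M.finsum_cong') (auto simp: u_m)
  also have "\<dots> = g i"
    using g i by (intro finsum_delta[OF J.module_axioms])
  finally show ?thesis using assms unfolding assemble_def by simp
qed

lemma assemble_cong:
  assumes "x \<in> carrier J" "\<And>i. i \<in> I \<Longrightarrow> g i = g' i" "\<And>i. i \<in> I \<Longrightarrow> g' i \<in> carrier J"
  shows "assemble x g = assemble x g'"
  unfolding assemble_def
  using assms by (intro arg_cong2[where f = "add T"] T.M.finsum_cong') auto

text \<open>This makes the coordinates faithful on a space given by generators and relations. For a
  pure tensor, \<open>a\<close> is expanded in the basis and its coefficients are moved across the
  tensor sign; the rest is additivity.\<close>

lemma assemble_coords: "s \<in> carrier T \<Longrightarrow> assemble (aug s) (\<lambda>i. coord i s) = s"
proof (induct rule: tensor_induct)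
  case zero
  have "(\<Oplus>\<^bsub>T\<^esub>i\<in>I. t (m i) \<zero>\<^bsub>J\<^esub>) = \<zero>\<^bsub>T\<^esub>"
    using module_hom_zero[OF J.module_axioms T.module_axioms bilinear_mapD(2)[OF bilinear_tensor]]
    by (intro T.M.add.finprod_one_eqI) simp
  moreover have "assemble (aug \<zero>\<^bsub>T\<^esub>) (\<lambda>i. coord i \<zero>\<^bsub>T\<^esub>) = assemble \<zero>\<^bsub>J\<^esub> (\<lambda>i. \<zero>\<^bsub>J\<^esub>)"
    by simp (rule assemble_cong; simp)
  ultimately show ?case
    using module_hom_zero[OF J.module_axioms T.module_axioms bilinear_mapD(2)[OF bilinear_tensor]]
    by (simp add: assemble_def)
next
  case (tensor a x)
  then have fin: "(\<lambda>i. u i a \<odot>\<^bsub>A\<^esub> m i) \<in> I \<rightarrow> carrier A" by auto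
  have "(\<Oplus>\<^bsub>T\<^esub>i\<in>I. t (m i) (coord i (t a x))) = (\<Oplus>\<^bsub>T\<^esub>i\<in>I. t (u i a \<odot>\<^bsub>A\<^esub> m i) x)"
    using tensor
    by (intro T.M.finsum_cong') (auto simp: tensor_smult_left tensor_smult_right)
  also have "\<dots> = t (\<Oplus>\<^bsub>A\<^esub>i\<in>I. u i a \<odot>\<^bsub>A\<^esub> m i) x"
    using module_hom_finsum[OF A.module_axioms T.module_axioms
        bilinear_mapD(1)[OF bilinear_tensor tensor(2)] fin] by simp
  finally have "assemble (aug (t a x)) (\<lambda>i. coord i (t a x))
      = t (\<epsilon> a \<odot>\<^bsub>A\<^esub> \<one>\<^bsub>A\<^esub> \<oplus>\<^bsub>A\<^esub> (\<Oplus>\<^bsub>A\<^esub>i\<in>I. u i a \<odot>\<^bsub>A\<^esub> m i)) x"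
    using tensor fin
    by (simp add: assemble_def tensor_add_left tensor_smult_left tensor_smult_right)
  then show ?case using base_expansion[OF tensor(1)] by simp
next
  case (add s s')
  have "(\<Oplus>\<^bsub>T\<^esub>i\<in>I. t (m i) (coord i (s \<oplus>\<^bsub>T\<^esub> s')))
      = (\<Oplus>\<^bsub>T\<^esub>i\<in>I. t (m i) (coord i s) \<oplus>\<^bsub>T\<^esub> t (m i) (coord i s'))"
    using add(1,2) by (intro T.M.finsum_cong') (auto simp: tensor_add_right)
  also have "\<dots> = (\<Oplus>\<^bsub>T\<^esub>i\<in>I. t (m i) (coord i s)) \<oplus>\<^bsub>T\<^esub> (\<Oplus>\<^bsub>T\<^esub>i\<in>I. t (m i) (coord i s'))"
    using add(1,2) by (intro T.M.finsum_addf) auto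
  finally have "assemble (aug (s \<oplus>\<^bsub>T\<^esub> s')) (\<lambda>i. coord i (s \<oplus>\<^bsub>T\<^esub> s'))
      = (t \<one>\<^bsub>A\<^esub> (aug s) \<oplus>\<^bsub>T\<^esub> t \<one>\<^bsub>A\<^esub> (aug s')) \<oplus>\<^bsub>T\<^esub>
        ((\<Oplus>\<^bsub>T\<^esub>i\<in>I. t (m i) (coord i s)) \<oplus>\<^bsub>T\<^esub> (\<Oplus>\<^bsub>T\<^esub>i\<in>I. t (m i) (coord i s')))"
    using add(1,2) by (simp add: assemble_def tensor_add_right)
  also have "\<dots> = assemble (aug s) (\<lambda>i. coord i s) \<oplus>\<^bsub>T\<^esub> assemble (aug s') (\<lambda>i. coord i s')"
    using add(1,2) T.M.finsum_closed[of "\<lambda>i. t (m i) (coord i s)" I]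
      T.M.finsum_closed[of "\<lambda>i. t (m i) (coord i s')" I]
    by (simp add: assemble_def T.M.a_ac)
  finally show ?case using add(3,4) by simp
qed

lemma tensor_coord_eqI:
  assumes "s \<in> carrier T" "s' \<in> carrier T" "aug s = aug s'"
    and "\<And>i. i \<in> I \<Longrightarrow> coord i s = coord i s'"
  shows "s = s'"
  using assemble_coords[OF assms(1)] assemble_coords[OF assms(2)]
    assemble_cong[of "aug s" "\<lambda>i. coord i s" "\<lambda>i. coord i s'"] assms by simp

lemma tensor_smult_closed [simp]:
  "\<lbrakk>a \<in> carrier A; s \<in> carrier T\<rbrakk> \<Longrightarrow> tensor_smult F A J a s \<in> carrier T"
  by (rule module_hom_in[OF tensor_smult_hom])

lemma aug_tensor_smult [simp]:
  assumes "a \<in> carrier A" "s \<in> carrier T"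
  shows "aug (tensor_smult F A J a s) = \<epsilon> a \<odot>\<^bsub>J\<^esub> aug s"
  by (rule tensor_hom_eqI[OF J.module_axioms module_hom_compose[OF tensor_smult_hom aug_hom]
        module_hom_compose[OF aug_hom J.module_hom_self_smult] _ assms(2)])
    (use assms(1) in \<open>simp_all add: tensor_smult_tensor eps_mult J.smult_assoc1\<close>)

text \<open>On pure tensors this is \<open>u_mult\<close>: \<open>\<epsilon> a\<close> acts on the
  ideal part of \<open>s\<close>, while \<open>u i a\<close> carries the part over \<open>1\<close>
  into coordinate \<open>i\<close>.\<close>

lemma coord_tensor_smult [simp]:
  assumes "i \<in> I" "a \<in> carrier A" "s \<in> carrier T"
  shows "coord i (tensor_smult F A J a s) = \<epsilon> a \<odot>\<^bsub>J\<^esub> coord i s \<oplus>\<^bsub>J\<^esub> u i a \<odot>\<^bsub>J\<^esub> aug s"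
  by (rule tensor_hom_eqI[OF J.module_axioms
        module_hom_compose[OF tensor_smult_hom coord_hom]
        module_hom_add_maps[OF J.module_axioms
          module_hom_compose[OF coord_hom J.module_hom_self_smult]
          module_hom_compose[OF aug_hom J.module_hom_self_smult]] _ assms(3)])
    (use assms(1,2) in \<open>simp_all add: tensor_smult_tensor u_mult J.smult_assoc1 J.smult_l_distr\<close>)

end

section \<open>Deformations in coordinates\<close>

lemma cochains2_simps:
  assumes "\<phi> \<in> carrier (cochains2 F J)"
  shows "\<lbrakk>x \<in> carrier J; y \<in> carrier J\<rbrakk> \<Longrightarrow> \<phi> x y \<in> carrier J"
    and "\<lbrakk>x \<in> carrier J; x' \<in> carrier J; y \<in> carrier J\<rbrakk> \<Longrightarrow> \<phi> (x \<oplus>\<^bsub>J\<^esub> x') y = \<phi> x y \<oplus>\<^bsub>J\<^esub> \<phi> x' y"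
    and "\<lbrakk>x \<in> carrier J; y \<in> carrier J; y' \<in> carrier J\<rbrakk> \<Longrightarrow> \<phi> x (y \<oplus>\<^bsub>J\<^esub> y') = \<phi> x y \<oplus>\<^bsub>J\<^esub> \<phi> x y'"
    and "\<lbrakk>c \<in> carrier F; x \<in> carrier J; y \<in> carrier J\<rbrakk> \<Longrightarrow> \<phi> (c \<odot>\<^bsub>J\<^esub> x) y = c \<odot>\<^bsub>J\<^esub> \<phi> x y"
    and "\<lbrakk>c \<in> carrier F; x \<in> carrier J; y \<in> carrier J\<rbrakk> \<Longrightarrow> \<phi> x (c \<odot>\<^bsub>J\<^esub> y) = c \<odot>\<^bsub>J\<^esub> \<phi> x y"
    and "\<lbrakk>x \<in> carrier J; y \<in> carrier J\<rbrakk> \<Longrightarrow> \<phi> x y = \<phi> y x"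
  using assms by (auto simp: cochains2_def dest: module_hom_in module_hom_add module_hom_smult)

lemma cochains2I:
  assumes "bilinear_map F J J J \<phi>"
    and "\<And>x y. \<lbrakk>x \<in> carrier J; y \<in> carrier J\<rbrakk> \<Longrightarrow> \<phi> x y = \<phi> y x"
    and "module F J"
  shows "(\<lambda>x\<in>carrier J. \<lambda>y\<in>carrier J. \<phi> x y) \<in> carrier (cochains2 F J)" (is "?\<phi> \<in> _")
proof -
  note b = bilinear_map_simps[OF assms(1)]
  have "(\<lambda>y\<in>carrier J. \<phi> x y) \<in> module_hom F J J" if "x \<in> carrier J" for x
    by (rule module_hom_cong[OF assms(3) bilinear_mapD(2)[OF assms(1) that]]) simp
  moreover have "(\<lambda>x. (\<lambda>x\<in>carrier J. \<lambda>y\<in>carrier J. \<phi> x y) x y) \<in> module_hom F J J"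
    if "y \<in> carrier J" for y
    by (rule module_hom_cong[OF assms(3) bilinear_mapD(1)[OF assms(1) that]]) (simp add: that)
  moreover have "?\<phi> \<in> carrier J \<rightarrow>\<^sub>E (carrier J \<rightarrow>\<^sub>E carrier J)"
    using b(1) by auto
  ultimately show ?thesis
    using assms(2) unfolding cochains2_def by simp
qed

lemma Z2_carrier:
  "carrier (Z2 F J) = {\<phi> \<in> carrier (cochains2 F J).
     \<forall>x\<in>carrier J. \<forall>y\<in>carrier J. \<forall>z\<in>carrier J. coboundary2 J \<phi> x y z = \<zero>\<^bsub>J\<^esub>}"
  by (simp add: Z2_def)

lemma Z2_cocycle:
  "\<lbrakk>\<phi> \<in> carrier (Z2 F J); x \<in> carrier J; y \<in> carrier J; z \<in> carrier J\<rbrakk>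
    \<Longrightarrow> coboundary2 J \<phi> x y z = \<zero>\<^bsub>J\<^esub>"
  by (simp add: Z2_carrier)

context coordinatized_base
begin

text \<open>The product of \<open>1 \<otimes> x + \<Sum> m i \<otimes> p i\<close> and
  \<open>1 \<otimes> y + \<Sum> m i \<otimes> q i\<close> over a square-zero ideal, when
  \<open>\<psi> i x y\<close> is the coefficient of \<open>m i\<close> in the product of
  \<open>1 \<otimes> x\<close> and \<open>1 \<otimes> y\<close>: terms with two factors from the
  ideal vanish.\<close>

definition standard_product ::
  "('i \<Rightarrow> 'j \<Rightarrow> 'j \<Rightarrow> 'j) \<Rightarrow> ('a \<times> 'j \<Rightarrow> 'f) set \<Rightarrow> ('a \<times> 'j \<Rightarrow> 'f) set \<Rightarrow> ('a \<times> 'j \<Rightarrow> 'f) set" where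
  "standard_product \<psi> s s' = assemble (aug s \<otimes>\<^bsub>J\<^esub> aug s')
     (\<lambda>i. \<psi> i (aug s) (aug s') \<oplus>\<^bsub>J\<^esub> (aug s \<otimes>\<^bsub>J\<^esub> coord i s' \<oplus>\<^bsub>J\<^esub> aug s' \<otimes>\<^bsub>J\<^esub> coord i s))"

declare J.jj_closed [simp]

context
  fixes \<psi> :: "'i \<Rightarrow> 'j \<Rightarrow> 'j \<Rightarrow> 'j"
  assumes \<psi>: "\<And>i. i \<in> I \<Longrightarrow> \<psi> i \<in> carrier (cochains2 F J)"
begin

private lemma \<psi>_closed: "\<lbrakk>i \<in> I; x \<in> carrier J; y \<in> carrier J\<rbrakk> \<Longrightarrow> \<psi> i x y \<in> carrier J"
  using cochains2_simps(1)[OF \<psi>] .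

lemma standard_product_closed:
  "\<lbrakk>s \<in> carrier T; s' \<in> carrier T\<rbrakk> \<Longrightarrow> standard_product \<psi> s s' \<in> carrier T"
  unfolding standard_product_def by (rule assemble_closed) (simp_all add: \<psi>_closed)

lemma aug_standard_product:
  "\<lbrakk>s \<in> carrier T; s' \<in> carrier T\<rbrakk> \<Longrightarrow> aug (standard_product \<psi> s s') = aug s \<otimes>\<^bsub>J\<^esub> aug s'"
  unfolding standard_product_def by (rule aug_assemble) (simp_all add: \<psi>_closed)

lemma coord_standard_product:
  "\<lbrakk>i \<in> I; s \<in> carrier T; s' \<in> carrier T\<rbrakk> \<Longrightarrow> coord i (standard_product \<psi> s s')
     = \<psi> i (aug s) (aug s') \<oplus>\<^bsub>J\<^esub> (aug s \<otimes>\<^bsub>J\<^esub> coord i s' \<oplus>\<^bsub>J\<^esub> aug s' \<otimes>\<^bsub>J\<^esub> coord i s)"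
  unfolding standard_product_def
  by (subst coord_assemble) (simp_all add: \<psi>_closed)

end

lemma tensor_algebra_simps:
  "carrier (tensor_algebra F A J l) = carrier T" "mult (tensor_algebra F A J l) = l"
  "zero (tensor_algebra F A J l) = \<zero>\<^bsub>T\<^esub>" "add (tensor_algebra F A J l) = add T"
  "smult (tensor_algebra F A J l) = tensor_smult F A J"
  by (simp_all add: tensor_algebra_def)

lemma eps_zero [simp]: "\<epsilon> \<zero>\<^bsub>A\<^esub> = \<zero>\<^bsub>F\<^esub>"
  using module_hom_zero[OF A.module_axioms regular_F eps_hom] by simp

lemma u_zero [simp]: "i \<in> I \<Longrightarrow> u i \<zero>\<^bsub>A\<^esub> = \<zero>\<^bsub>F\<^esub>"
  using module_hom_zero[OF A.module_axioms regular_F u_hom] by simp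

text \<open>So far \<open>T\<close> is a module over \<open>F\<close>. Over \<open>A\<close>,
  associativity of the action reduces in coordinates to \<open>eps_mult\<close> and
  \<open>u_mult\<close>.\<close>

lemma tensor_algebra_module: "module A (tensor_algebra F A J l)"
proof (rule module_axiomsI; (unfold tensor_algebra_simps)?)
  show "cring A" by (rule A.M_cring)
  fix a b s assume [simp]: "a \<in> carrier A" "b \<in> carrier A" "s \<in> carrier T"
  show "tensor_smult F A J (a \<otimes>\<^bsub>A\<^esub> b) s = tensor_smult F A J a (tensor_smult F A J b s)"
    by (rule tensor_coord_eqI)
      (simp_all add: eps_mult u_mult J.smult_assoc1 J.smult_l_distr J.smult_r_distr J.M.a_ac)
  show "tensor_smult F A J (a \<oplus>\<^bsub>A\<^esub> b) s = tensor_smult F A J a s \<oplus>\<^bsub>T\<^esub> tensor_smult F A J b s"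
    by (rule tensor_coord_eqI) (simp_all add: J.smult_l_distr J.M.a_ac)
next
  fix s assume [simp]: "s \<in> carrier T"
  show "tensor_smult F A J \<one>\<^bsub>A\<^esub> s = s" by (rule tensor_coord_eqI) simp_all
  show "tensor_smult F A J \<zero>\<^bsub>A\<^esub> s = \<zero>\<^bsub>T\<^esub>" by (rule tensor_coord_eqI) simp_all
qed (simp_all add: T.M.a_ac module_hom_add[OF tensor_smult_hom])

text \<open>\<open>l\<close> is only required to agree with \<open>standard_product\<close> on the
  carrier, because \<open>eta\<close> is computed only there. The rules in the right argument follow
  from those in the left by commutativity.\<close>

theorem standard_product_jacobi_jordan:
  assumes \<psi>: "\<And>i. i \<in> I \<Longrightarrow> \<psi> i \<in> carrier (Z2 F J)"
    and l: "\<And>s s'. \<lbrakk>s \<in> carrier T; s' \<in> carrier T\<rbrakk> \<Longrightarrow> l s s' = standard_product \<psi> s s'"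
  shows "jacobi_jordan_algebra A (tensor_algebra F A J l)"
proof -
  have \<psi>': "\<psi> i \<in> carrier (cochains2 F J)" if "i \<in> I" for i
    using \<psi>[OF that] by (simp add: Z2_carrier)
  note \<psi>_simps = cochains2_simps[OF \<psi>']
  have closed [simp]: "l s s' \<in> carrier T" if "s \<in> carrier T" "s' \<in> carrier T" for s s'
    using that by (simp add: l standard_product_closed[OF \<psi>'])
  have aug [simp]: "aug (l s s') = aug s \<otimes>\<^bsub>J\<^esub> aug s'" if "s \<in> carrier T" "s' \<in> carrier T" for s s'
    using that by (simp add: l aug_standard_product[OF \<psi>'])
  have coord [simp]: "coord i (l s s')
     = \<psi> i (aug s) (aug s') \<oplus>\<^bsub>J\<^esub> (aug s \<otimes>\<^bsub>J\<^esub> coord i s' \<oplus>\<^bsub>J\<^esub> aug s' \<otimes>\<^bsub>J\<^esub> coord i s)"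
    if "i \<in> I" "s \<in> carrier T" "s' \<in> carrier T" for i s s'
    using that by (simp add: l coord_standard_product[OF \<psi>'])
  note J_simps = J.jj_add_left J.jj_add_right J.jj_smult_left J.jj_smult_right
    J.smult_l_distr J.smult_r_distr
  have comm: "l s s' = l s' s" if "s \<in> carrier T" "s' \<in> carrier T" for s s'
    by (rule tensor_coord_eqI)
      (use that in \<open>simp_all add: J.jj_comm[of "aug s" "aug s'"] \<psi>_simps(1)
        \<psi>_simps(6)[of _ "aug s" "aug s'"] J.M.a_ac\<close>)
  have add_left: "l (s \<oplus>\<^bsub>T\<^esub> s') r = l s r \<oplus>\<^bsub>T\<^esub> l s' r"
    if "s \<in> carrier T" "s' \<in> carrier T" "r \<in> carrier T" for s s' r
    by (rule tensor_coord_eqI)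
      (use that in \<open>simp_all add: J_simps \<psi>_simps(1,2) J.M.a_ac\<close>)
  have smult_left: "l (tensor_smult F A J a s) r = tensor_smult F A J a (l s r)"
    if "a \<in> carrier A" "s \<in> carrier T" "r \<in> carrier T" for a s r
    by (rule tensor_coord_eqI)
      (use that in \<open>simp_all add: J_simps \<psi>_simps(1,4) J.M.a_ac J.jj_comm[of "aug r" "aug s"]\<close>)
  have jacobi: "l s (l s' r) \<oplus>\<^bsub>T\<^esub> l s' (l r s) \<oplus>\<^bsub>T\<^esub> l r (l s s') = \<zero>\<^bsub>T\<^esub>"
    if st: "s \<in> carrier T" "s' \<in> carrier T" "r \<in> carrier T" for s s' r
  proof (rule tensor_coord_eqI)
    fix i assume i: "i \<in> I"
    define x y z where "x = aug s" and "y = aug s'" and "z = aug r"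
    define p q w where "p = coord i s" and "q = coord i s'" and "w = coord i r"
    have [simp]: "x \<in> carrier J" "y \<in> carrier J" "z \<in> carrier J"
      "p \<in> carrier J" "q \<in> carrier J" "w \<in> carrier J"
      using st i by (simp_all add: x_def y_def z_def p_def q_def w_def)
    \<comment> \<open>Coordinate \<open>i\<close> of the Jacobi sum is the cocycle expression of
      \<open>\<psi> i\<close> plus three Jacobi sums in \<open>J\<close>, in which one of
      \<open>x\<close>, \<open>y\<close>, \<open>z\<close> is replaced by the corresponding
      \<open>p\<close>, \<open>q\<close>, \<open>w\<close>.\<close>
    let ?c = "coboundary2 J (\<psi> i) x y z"
    let ?jw = "x \<otimes>\<^bsub>J\<^esub> (y \<otimes>\<^bsub>J\<^esub> w) \<oplus>\<^bsub>J\<^esub> y \<otimes>\<^bsub>J\<^esub> (w \<otimes>\<^bsub>J\<^esub> x) \<oplus>\<^bsub>J\<^esub> w \<otimes>\<^bsub>J\<^esub> (x \<otimes>\<^bsub>J\<^esub> y)"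
    let ?jp = "y \<otimes>\<^bsub>J\<^esub> (z \<otimes>\<^bsub>J\<^esub> p) \<oplus>\<^bsub>J\<^esub> z \<otimes>\<^bsub>J\<^esub> (p \<otimes>\<^bsub>J\<^esub> y) \<oplus>\<^bsub>J\<^esub> p \<otimes>\<^bsub>J\<^esub> (y \<otimes>\<^bsub>J\<^esub> z)"
    let ?jq = "z \<otimes>\<^bsub>J\<^esub> (x \<otimes>\<^bsub>J\<^esub> q) \<oplus>\<^bsub>J\<^esub> x \<otimes>\<^bsub>J\<^esub> (q \<otimes>\<^bsub>J\<^esub> z) \<oplus>\<^bsub>J\<^esub> q \<otimes>\<^bsub>J\<^esub> (z \<otimes>\<^bsub>J\<^esub> x)"
    have "coord i (l s (l s' r) \<oplus>\<^bsub>T\<^esub> l s' (l r s) \<oplus>\<^bsub>T\<^esub> l r (l s s')) = ?c \<oplus>\<^bsub>J\<^esub> ?jw \<oplus>\<^bsub>J\<^esub> ?jp \<oplus>\<^bsub>J\<^esub> ?jq"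
      using st i
      by (simp add: x_def[symmetric] y_def[symmetric] z_def[symmetric] p_def[symmetric]
          q_def[symmetric] w_def[symmetric] coboundary2_def J.jj_add_right \<psi>_simps(1)
          J.jj_comm[of w] J.jj_comm[of p] J.jj_comm[of q] J.M.a_ac)
    also have "\<dots> = \<zero>\<^bsub>J\<^esub>"
      using Z2_cocycle[OF \<psi>[OF i]] J.jj_jacobi by simp
    finally show "coord i (l s (l s' r) \<oplus>\<^bsub>T\<^esub> l s' (l r s) \<oplus>\<^bsub>T\<^esub> l r (l s s')) = coord i \<zero>\<^bsub>T\<^esub>"
      using i by simp
  qed (use st in \<open>simp_all add: J.jj_jacobi\<close>)
  show ?thesis
  proof (rule jacobi_jordan_algebra.intro[OF tensor_algebra_module],
      rule jacobi_jordan_algebra_axioms.intro; unfold tensor_algebra_simps)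
    fix s s' assume [simp]: "s \<in> carrier T" "s' \<in> carrier T"
    show "l s s' = l s' s" by (rule comm) simp_all
    show "l s s' \<in> carrier T" by simp
    show "l (tensor_smult F A J a s) s' = tensor_smult F A J a (l s s')" if "a \<in> carrier A" for a
      using that by (rule smult_left) simp_all
    show "l s (tensor_smult F A J a s') = tensor_smult F A J a (l s s')" if "a \<in> carrier A" for a
      using smult_left[of a s' s] that by (simp add: comm[of s])
    fix r assume [simp]: "r \<in> carrier T"
    show "l (s \<oplus>\<^bsub>T\<^esub> s') r = l s r \<oplus>\<^bsub>T\<^esub> l s' r" by (rule add_left) simp_all
    show "l s (s' \<oplus>\<^bsub>T\<^esub> r) = l s s' \<oplus>\<^bsub>T\<^esub> l s r"
      using add_left[of s' r s] by (simp add: comm[of s])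
    show "l s (l s' r) \<oplus>\<^bsub>T\<^esub> l s' (l r s) \<oplus>\<^bsub>T\<^esub> l r (l s s') = \<zero>\<^bsub>T\<^esub>"
      by (rule jacobi) simp_all
  qed
qed

end

lemma (in abelian_group) minus_minus_add:
  assumes "x \<in> carrier G" "y \<in> carrier G" "z \<in> carrier G"
  shows "x \<ominus> y \<ominus> z \<oplus> (y \<oplus> z) = x"
proof -
  have "x \<ominus> y \<ominus> z \<oplus> (y \<oplus> z) = x \<oplus> (\<ominus> (y \<oplus> z) \<oplus> (y \<oplus> z))"
    using assms by (simp only: a_minus_def minus_add a_assoc a_inv_closed a_closed)
  then show ?thesis using assms by (simp add: l_neg)
qed

lemma (in jacobi_jordan_algebra) jj_zero_right [simp]:
  assumes "x \<in> carrier J"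
  shows "x \<otimes> \<zero> = \<zero>"
  using jj_smult_right[of "\<zero>\<^bsub>R\<^esub>" x \<zero>] jj_closed[of x \<zero>] assms by simp

context coordinatized_base
begin

lemma standard_product_bilinear:
  assumes \<psi>: "\<And>i. i \<in> I \<Longrightarrow> \<psi> i \<in> carrier (cochains2 F J)"
  shows "bilinear_map F T T T (standard_product \<psi>)"
proof -
  note \<psi>_simps = cochains2_simps[OF \<psi>]
  note [simp] = standard_product_closed[OF \<psi>] aug_standard_product[OF \<psi>]
    coord_standard_product[OF \<psi>]
  note J_simps = J.jj_add_left J.jj_add_right J.jj_smult_left J.jj_smult_right
    J.smult_l_distr J.smult_r_distr
  show ?thesis
    by (rule bilinear_mapI; (rule tensor_coord_eqI)?)
      (simp_all add: J_simps \<psi>_simps(1-5) J.M.a_ac)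
qed

text \<open>Scalars of \<open>F\<close> act through \<open>c \<mapsto> c \<odot> 1\<close> in
  \<open>A\<close>. Hence maps linear over \<open>A\<close> are linear over \<open>F\<close>, and
  comparison on pure tensors applies to deformations and their isomorphisms.\<close>

lemma tensor_smult_scalar:
  assumes "c \<in> carrier F" "s \<in> carrier T"
  shows "tensor_smult F A J (c \<odot>\<^bsub>A\<^esub> \<one>\<^bsub>A\<^esub>) s = c \<odot>\<^bsub>T\<^esub> s"
  by (rule tensor_coord_eqI) (use assms in simp_all)

lemma base_linear_imp_linear:
  assumes "\<rho> \<in> module_hom A (tensor_algebra F A J l) (tensor_algebra F A J l')"
  shows "\<rho> \<in> module_hom F T T"
proof (rule module_homI)
  fix c s assume cs: "c \<in> carrier F" "s \<in> carrier T"
  then have "\<rho> (tensor_smult F A J (c \<odot>\<^bsub>A\<^esub> \<one>\<^bsub>A\<^esub>) s) = tensor_smult F A J (c \<odot>\<^bsub>A\<^esub> \<one>\<^bsub>A\<^esub>) (\<rho> s)"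
    using module_hom_smult[OF assms, of "c \<odot>\<^bsub>A\<^esub> \<one>\<^bsub>A\<^esub>" s] by (simp add: tensor_algebra_simps)
  moreover have "\<rho> s \<in> carrier T"
    using module_hom_in[OF assms, of s] cs by (simp add: tensor_algebra_simps)
  ultimately show "\<rho> (c \<odot>\<^bsub>T\<^esub> s) = c \<odot>\<^bsub>T\<^esub> \<rho> s" using cs by (simp add: tensor_smult_scalar)
qed (use module_hom_in[OF assms] module_hom_add[OF assms] in \<open>simp_all add: tensor_algebra_simps\<close>)

lemma jacobi_jordan_bilinear:
  assumes "jacobi_jordan_algebra A (tensor_algebra F A J l)"
  shows "bilinear_map F T T T l"
proof -
  interpret l: jacobi_jordan_algebra A "tensor_algebra F A J l" by fact
  show ?thesis
  proof (rule bilinear_mapI)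
    fix c s s' assume cs: "c \<in> carrier F" "s \<in> carrier T" "s' \<in> carrier T"
    show "l (c \<odot>\<^bsub>T\<^esub> s) s' = c \<odot>\<^bsub>T\<^esub> l s s'"
      using cs l.jj_smult_left[of "c \<odot>\<^bsub>A\<^esub> \<one>\<^bsub>A\<^esub>" s s'] l.jj_closed[of s s']
      by (simp add: tensor_algebra_simps tensor_smult_scalar)
    show "l s (c \<odot>\<^bsub>T\<^esub> s') = c \<odot>\<^bsub>T\<^esub> l s s'"
      using cs l.jj_smult_right[of "c \<odot>\<^bsub>A\<^esub> \<one>\<^bsub>A\<^esub>" s s'] l.jj_closed[of s s']
      by (simp add: tensor_algebra_simps tensor_smult_scalar)
  qed (use l.jj_closed l.jj_add_left l.jj_add_right in \<open>simp_all add: tensor_algebra_simps\<close>)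
qed

lemma bilinear_tensor_eqI:
  assumes "bilinear_map F T T T l" "bilinear_map F T T T l'"
    and "\<And>a b x y. \<lbrakk>a \<in> carrier A; b \<in> carrier A; x \<in> carrier J; y \<in> carrier J\<rbrakk>
      \<Longrightarrow> l (t a x) (t b y) = l' (t a x) (t b y)"
    and "s \<in> carrier T" "s' \<in> carrier T"
  shows "l s s' = l' s s'"
proof -
  have *: "l (t a x) s' = l' (t a x) s'" if "a \<in> carrier A" "x \<in> carrier J" for a x
  proof (rule tensor_hom_eqI[OF T.module_axioms, where h = "l (t a x)" and h' = "l' (t a x)"])
    show "l (t a x) \<in> module_hom F T T" "l' (t a x) \<in> module_hom F T T"
      using that by (auto intro: bilinear_mapD(2)[OF assms(1)] bilinear_mapD(2)[OF assms(2)])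
  qed (use assms(3,5) that in simp_all)
  show ?thesis
  proof (rule tensor_hom_eqI[OF T.module_axioms, where h = "\<lambda>s. l s s'" and h' = "\<lambda>s. l' s s'"])
    show "(\<lambda>s. l s s') \<in> module_hom F T T" "(\<lambda>s. l' s s') \<in> module_hom F T T"
      using assms(5) by (auto intro: bilinear_mapD(1)[OF assms(1)] bilinear_mapD(1)[OF assms(2)])
  qed (use assms(4) * in simp_all)
qed

section \<open>Every deformation is the standard product of a family of cocycles\<close>

context
  fixes l
  assumes l: "jacobi_jordan_algebra A (tensor_algebra F A J l)"
    and aug_l: "tensor_aug F J A \<epsilon> \<in> jj_hom F (T\<lparr>mult := l\<rparr>) J"
begin

interpretation l: jacobi_jordan_algebra A "tensor_algebra F A J l" by (rule l)

text \<open>The coefficient of \<open>m i\<close> in the deformed product of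
  \<open>1 \<otimes> x\<close> and \<open>1 \<otimes> y\<close>, restricted so as to be an element
  of \<open>cochains2\<close>.\<close>

definition deformation_cocycle :: "'i \<Rightarrow> 'j \<Rightarrow> 'j \<Rightarrow> 'j" where
  "deformation_cocycle i = (\<lambda>x\<in>carrier J. \<lambda>y\<in>carrier J. coord i (l (t \<one>\<^bsub>A\<^esub> x) (t \<one>\<^bsub>A\<^esub> y)))"

lemmas l_bilinear = jacobi_jordan_bilinear[OF l]
lemmas l_simps = bilinear_map_simps[OF l_bilinear]

lemma aug_mult: "\<lbrakk>s \<in> carrier T; s' \<in> carrier T\<rbrakk> \<Longrightarrow> aug (l s s') = aug s \<otimes>\<^bsub>J\<^esub> aug s'"
  using aug_l by (simp add: jj_hom_def tensor_aug_eq)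

lemma l_comm: "\<lbrakk>s \<in> carrier T; s' \<in> carrier T\<rbrakk> \<Longrightarrow> l s s' = l s' s"
  using l.jj_comm by (simp add: tensor_algebra_simps)

lemma deformation_cocycle_cochain:
  assumes i: "i \<in> I"
  shows "deformation_cocycle i \<in> carrier (cochains2 F J)"
  unfolding deformation_cocycle_def
proof (rule cochains2I[OF bilinear_mapI])
  fix x y assume "x \<in> carrier J" "y \<in> carrier J"
  then show "coord i (l (t \<one>\<^bsub>A\<^esub> x) (t \<one>\<^bsub>A\<^esub> y)) = coord i (l (t \<one>\<^bsub>A\<^esub> y) (t \<one>\<^bsub>A\<^esub> x))"
    by (subst l_comm) simp_all
qed (use i in \<open>simp_all add: l_simps tensor_add_right tensor_smult_right J.module_axioms\<close>)

text \<open>Bilinearity over \<open>A\<close> moves \<open>a\<close> and \<open>b\<close> out of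
  \<open>l (t a x) (t b y)\<close>, so \<open>l\<close> is determined by its values on tensors
  \<open>1 \<otimes> x\<close>. There \<open>aug\<close> is fixed by the homomorphism condition, and
  \<open>coord i\<close> is the cocycle by definition.\<close>

lemma l_eq_standard_product:
  assumes "s \<in> carrier T" "s' \<in> carrier T"
  shows "l s s' = standard_product deformation_cocycle s s'"
proof (rule bilinear_tensor_eqI[OF l_bilinear standard_product_bilinear _ assms])
  fix a b x y assume ab [simp]: "a \<in> carrier A" "b \<in> carrier A" "x \<in> carrier J" "y \<in> carrier J"
  note \<psi> = deformation_cocycle_cochain
  have "l (t a x) (t b y) = tensor_smult F A J a (tensor_smult F A J b (l (t \<one>\<^bsub>A\<^esub> x) (t \<one>\<^bsub>A\<^esub> y)))"
    using l.jj_smult_left[of a "t \<one>\<^bsub>A\<^esub> x" "t b y"] l.jj_smult_right[of b "t \<one>\<^bsub>A\<^esub> x" "t \<one>\<^bsub>A\<^esub> y"]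
    by (simp add: tensor_algebra_simps tensor_smult_tensor)
  moreover have "coord i (l (t \<one>\<^bsub>A\<^esub> x) (t \<one>\<^bsub>A\<^esub> y)) = deformation_cocycle i x y" for i
    by (simp add: deformation_cocycle_def)
  ultimately show "l (t a x) (t b y) = standard_product deformation_cocycle (t a x) (t b y)"
    by (intro tensor_coord_eqI)
      (simp_all add: l_simps aug_mult standard_product_closed[OF \<psi>] aug_standard_product[OF \<psi>]
        coord_standard_product[OF \<psi>] cochains2_simps[OF \<psi>] J.jj_smult_left J.jj_smult_right
        J.smult_r_distr J.jj_comm[of y x] J.smult_assoc1[symmetric] J.M.a_ac m_comm)
qed (rule deformation_cocycle_cochain)

lemma deformation_cocycle_cocycle:
  assumes i: "i \<in> I"
  shows "deformation_cocycle i \<in> carrier (Z2 F J)"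
proof -
  note \<psi> = deformation_cocycle_cochain
  have "coboundary2 J (deformation_cocycle i) x y z = \<zero>\<^bsub>J\<^esub>"
    if xyz [simp]: "x \<in> carrier J" "y \<in> carrier J" "z \<in> carrier J" for x y z
  proof -
    let ?x = "t \<one>\<^bsub>A\<^esub> x" and ?y = "t \<one>\<^bsub>A\<^esub> y" and ?z = "t \<one>\<^bsub>A\<^esub> z"
    \<comment> \<open>Since \<open>u i 1 = 0\<close>, the outer factor has no coordinate
      \<open>i\<close>, and only two terms of the product formula survive. Their cyclic sum is
      \<open>coboundary2\<close>, and the Jacobi identity of \<open>l\<close> makes it zero.\<close>
    have *: "coord i (l (t \<one>\<^bsub>A\<^esub> x) (l (t \<one>\<^bsub>A\<^esub> y) (t \<one>\<^bsub>A\<^esub> z)))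
        = deformation_cocycle i x (y \<otimes>\<^bsub>J\<^esub> z) \<oplus>\<^bsub>J\<^esub> x \<otimes>\<^bsub>J\<^esub> deformation_cocycle i y z"
      if "x \<in> carrier J" "y \<in> carrier J" "z \<in> carrier J" for x y z
      using that i l_simps(1)[of "t \<one>\<^bsub>A\<^esub> y" "t \<one>\<^bsub>A\<^esub> z"] aug_mult[of "t \<one>\<^bsub>A\<^esub> y" "t \<one>\<^bsub>A\<^esub> z"]
        l_eq_standard_product[of "t \<one>\<^bsub>A\<^esub> x" "l (t \<one>\<^bsub>A\<^esub> y) (t \<one>\<^bsub>A\<^esub> z)"]
      by (simp add: coord_standard_product[OF \<psi>] cochains2_simps(1)[OF \<psi>])
        (simp add: deformation_cocycle_def)
    have "l ?x (l ?y ?z) \<oplus>\<^bsub>T\<^esub> l ?y (l ?z ?x) \<oplus>\<^bsub>T\<^esub> l ?z (l ?x ?y) = \<zero>\<^bsub>T\<^esub>"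
      using l.jj_jacobi[of ?x ?y ?z] by (simp add: tensor_algebra_simps)
    then have "coord i (l ?x (l ?y ?z) \<oplus>\<^bsub>T\<^esub> l ?y (l ?z ?x) \<oplus>\<^bsub>T\<^esub> l ?z (l ?x ?y)) = \<zero>\<^bsub>J\<^esub>"
      using i by simp
    then show ?thesis
      using i by (simp add: l_simps(1) * cochains2_simps(1)[OF \<psi>] coboundary2_def J.M.a_ac)
  qed
  then show ?thesis using \<psi>[OF i] by (simp add: Z2_carrier)
qed

end

section \<open>Equivalence of deformations as cohomology of their cocycles\<close>

context
  fixes \<psi> \<psi>' l l'
  assumes \<psi>: "\<And>i. i \<in> I \<Longrightarrow> \<psi> i \<in> carrier (cochains2 F J)"
    and \<psi>': "\<And>i. i \<in> I \<Longrightarrow> \<psi>' i \<in> carrier (cochains2 F J)"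
    and l: "\<And>s s'. \<lbrakk>s \<in> carrier T; s' \<in> carrier T\<rbrakk> \<Longrightarrow> l s s' = standard_product \<psi> s s'"
    and l': "\<And>s s'. \<lbrakk>s \<in> carrier T; s' \<in> carrier T\<rbrakk> \<Longrightarrow> l' s s' = standard_product \<psi>' s s'"
begin

text \<open>The witness \<open>g\<close> is coordinate \<open>i\<close> of
  \<open>\<rho> (1 \<otimes> x)\<close>. Coordinate \<open>i\<close> of the multiplicativity of
  \<open>\<rho>\<close> at \<open>1 \<otimes> x\<close> and \<open>1 \<otimes> y\<close> reads
  \<open>\<psi> x y + g (x y) = \<psi>' x y + x (g y) + y (g x)\<close>.\<close>

lemma equivalent_imp_cohomologous:
  assumes eq: "equivalent_deformations F J A \<epsilon> l l'" and i: "i \<in> I"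
  shows "\<exists>g\<in>module_hom F J J. \<forall>x\<in>carrier J. \<forall>y\<in>carrier J.
    \<psi>' i x y = \<psi> i x y \<oplus>\<^bsub>J\<^esub> coboundary1 J g x y"
proof -
  obtain \<rho> where \<rho>: "\<rho> \<in> jj_hom A (tensor_algebra F A J l) (tensor_algebra F A J l')"
    and aug_\<rho>: "\<And>s. s \<in> carrier T \<Longrightarrow> aug (\<rho> s) = aug s"
    using eq by (auto simp: equivalent_deformations_def tensor_aug_eq)
  have \<rho>_mult: "\<rho> (l s s') = l' (\<rho> s) (\<rho> s')" if "s \<in> carrier T" "s' \<in> carrier T" for s s'
    using \<rho> that by (simp add: jj_hom_def tensor_algebra_simps)
  have lin: "\<rho> \<in> module_hom A (tensor_algebra F A J l) (tensor_algebra F A J l')"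
    using \<rho> by (simp add: jj_hom_def)
  have \<rho>_hom: "\<rho> \<in> module_hom F T T" by (rule base_linear_imp_linear[OF lin])
  note \<rho>_closed [simp] = module_hom_in[OF \<rho>_hom]
  define g where "g x = coord i (\<rho> (t \<one>\<^bsub>A\<^esub> x))" for x
  have g: "g \<in> module_hom F J J"
    unfolding g_def
    by (rule module_hom_compose[OF module_hom_compose[OF bilinear_mapD(2)[OF bilinear_tensor A.one_closed] \<rho>_hom]
          coord_hom[OF i]])
  note g_closed [simp] = module_hom_in[OF g]
  \<comment> \<open>Linearity over \<open>A\<close> extends the definition of \<open>g\<close> to
    \<open>a \<otimes> x\<close>: coordinate \<open>i\<close> of
    \<open>a \<rho> (1 \<otimes> x)\<close> is
    \<open>\<epsilon> a \<odot> g x + u i a \<odot> x\<close>, and the first term is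
    \<open>g\<close> of \<open>aug (t a x)\<close>.\<close>
  have coord_\<rho>: "coord i (\<rho> s) = coord i s \<oplus>\<^bsub>J\<^esub> g (aug s)" if "s \<in> carrier T" for s
  proof (rule tensor_hom_eqI[OF J.module_axioms module_hom_compose[OF \<rho>_hom coord_hom[OF i]]
        module_hom_add_maps[OF J.module_axioms coord_hom[OF i] module_hom_compose[OF aug_hom g]] _ that])
    fix a x assume ax: "a \<in> carrier A" "x \<in> carrier J"
    have "\<rho> (t a x) = tensor_smult F A J a (\<rho> (t \<one>\<^bsub>A\<^esub> x))"
      using module_hom_smult[OF lin, of a "t \<one>\<^bsub>A\<^esub> x"] ax
      by (simp add: tensor_algebra_simps tensor_smult_tensor)
    then show "coord i (\<rho> (t a x)) = coord i (t a x) \<oplus>\<^bsub>J\<^esub> g (aug (t a x))"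
      using ax i by (simp add: aug_\<rho> g_def[symmetric] module_hom_smult[OF g] J.M.a_comm)
  qed
  have "\<psi>' i x y = \<psi> i x y \<oplus>\<^bsub>J\<^esub> coboundary1 J g x y"
    if xy [simp]: "x \<in> carrier J" "y \<in> carrier J" for x y
  proof -
    let ?x = "t \<one>\<^bsub>A\<^esub> x" and ?y = "t \<one>\<^bsub>A\<^esub> y"
    have "\<psi> i x y \<oplus>\<^bsub>J\<^esub> g (x \<otimes>\<^bsub>J\<^esub> y) = coord i (\<rho> (l ?x ?y))"
      using i by (simp add: l coord_\<rho> standard_product_closed[OF \<psi>] coord_standard_product[OF \<psi>]
          aug_standard_product[OF \<psi>] cochains2_simps(1)[OF \<psi>])
    also have "\<dots> = \<psi>' i x y \<oplus>\<^bsub>J\<^esub> (x \<otimes>\<^bsub>J\<^esub> g y \<oplus>\<^bsub>J\<^esub> y \<otimes>\<^bsub>J\<^esub> g x)"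
      using i by (simp add: \<rho>_mult l' coord_standard_product[OF \<psi>'] aug_\<rho> coord_\<rho>)
    finally have *: "\<psi>' i x y \<oplus>\<^bsub>J\<^esub> (x \<otimes>\<^bsub>J\<^esub> g y \<oplus>\<^bsub>J\<^esub> y \<otimes>\<^bsub>J\<^esub> g x) = \<psi> i x y \<oplus>\<^bsub>J\<^esub> g (x \<otimes>\<^bsub>J\<^esub> y)" ..
    have "\<psi>' i x y = (\<psi>' i x y \<oplus>\<^bsub>J\<^esub> (x \<otimes>\<^bsub>J\<^esub> g y \<oplus>\<^bsub>J\<^esub> y \<otimes>\<^bsub>J\<^esub> g x)) \<ominus>\<^bsub>J\<^esub> (x \<otimes>\<^bsub>J\<^esub> g y \<oplus>\<^bsub>J\<^esub> y \<otimes>\<^bsub>J\<^esub> g x)"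
      using cochains2_simps(1)[OF \<psi>'[OF i]] by (simp add: a_minus_def J.M.a_assoc J.M.r_neg)
    also have "\<dots> = \<psi> i x y \<oplus>\<^bsub>J\<^esub> coboundary1 J g x y"
      unfolding * using cochains2_simps(1)[OF \<psi>[OF i]]
      by (simp add: coboundary1_def a_minus_def J.M.minus_add J.M.a_ac)
    finally show ?thesis .
  qed
  then show ?thesis using g by blast
qed

lemma cohomologous_imp_equivalent:
  assumes g: "\<And>i. i \<in> I \<Longrightarrow> g i \<in> module_hom F J J"
    and coh: "\<And>i x y. \<lbrakk>i \<in> I; x \<in> carrier J; y \<in> carrier J\<rbrakk>
      \<Longrightarrow> \<psi>' i x y = \<psi> i x y \<oplus>\<^bsub>J\<^esub> coboundary1 J (g i) x y"
  shows "equivalent_deformations F J A \<epsilon> l l'"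
proof -
  note g_closed [simp] = module_hom_in[OF g]
  \<comment> \<open>The identity plus \<open>\<Sum> m i \<otimes> g i (aug s)\<close>. The
    correction does not change \<open>aug\<close>, so subtracting the same expression, as
    \<open>\<sigma>\<close> does, inverts the map.\<close>
  define \<rho> where "\<rho> s = assemble (aug s) (\<lambda>i. coord i s \<oplus>\<^bsub>J\<^esub> g i (aug s))" for s
  define \<sigma> where "\<sigma> s = assemble (aug s) (\<lambda>i. coord i s \<ominus>\<^bsub>J\<^esub> g i (aug s))" for s
  have \<rho> [simp]: "\<rho> s \<in> carrier T" "aug (\<rho> s) = aug s"
    "i \<in> I \<Longrightarrow> coord i (\<rho> s) = coord i s \<oplus>\<^bsub>J\<^esub> g i (aug s)" if "s \<in> carrier T" for s i
    using that by (simp_all add: \<rho>_def)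
  have \<sigma> [simp]: "\<sigma> s \<in> carrier T" "aug (\<sigma> s) = aug s"
    "i \<in> I \<Longrightarrow> coord i (\<sigma> s) = coord i s \<ominus>\<^bsub>J\<^esub> g i (aug s)" if "s \<in> carrier T" for s i
    using that by (simp_all add: \<sigma>_def)
  have "bij_betw \<rho> (carrier T) (carrier T)"
  proof (rule bij_betw_byWitness[where f' = \<sigma>])
    show "\<forall>s\<in>carrier T. \<sigma> (\<rho> s) = s"
      by (intro ballI tensor_coord_eqI) (simp_all add: a_minus_def J.M.a_assoc J.M.r_neg)
    show "\<forall>s\<in>carrier T. \<rho> (\<sigma> s) = s"
      by (intro ballI tensor_coord_eqI) (simp_all add: a_minus_def J.M.a_assoc J.M.l_neg)
  qed auto
  moreover have "\<rho> \<in> jj_hom A (tensor_algebra F A J l) (tensor_algebra F A J l')"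
    unfolding jj_hom_def
  proof (intro CollectI conjI module_homI ballI; unfold tensor_algebra_simps)
    fix s s' assume s [simp]: "s \<in> carrier T" "s' \<in> carrier T"
    show "\<rho> (s \<oplus>\<^bsub>T\<^esub> s') = \<rho> s \<oplus>\<^bsub>T\<^esub> \<rho> s'"
      by (rule tensor_coord_eqI) (simp_all add: module_hom_add[OF g] J.M.a_ac)
    show "\<rho> (l s s') = l' (\<rho> s) (\<rho> s')"
    proof (rule tensor_coord_eqI)
      fix i assume i: "i \<in> I"
      let ?x = "aug s" and ?y = "aug s'"
      have c: "\<psi> i ?x ?y \<in> carrier J" by (rule cochains2_simps(1)[OF \<psi>[OF i]]) simp_all
      \<comment> \<open>The hypothesis \<open>coh\<close> with the two negative terms of
        \<open>coboundary1\<close> moved to the left.\<close>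
      have eq: "\<psi>' i ?x ?y \<oplus>\<^bsub>J\<^esub> (?x \<otimes>\<^bsub>J\<^esub> g i ?y \<oplus>\<^bsub>J\<^esub> ?y \<otimes>\<^bsub>J\<^esub> g i ?x) = \<psi> i ?x ?y \<oplus>\<^bsub>J\<^esub> g i (?x \<otimes>\<^bsub>J\<^esub> ?y)"
      proof -
        have "?x \<otimes>\<^bsub>J\<^esub> g i ?y \<in> carrier J" "?y \<otimes>\<^bsub>J\<^esub> g i ?x \<in> carrier J" "g i (?x \<otimes>\<^bsub>J\<^esub> ?y) \<in> carrier J"
          using i by simp_all
        then show ?thesis
          using c i by (simp add: coh coboundary1_def J.M.a_assoc J.M.minus_minus_add)
      qed
      let ?r = "?x \<otimes>\<^bsub>J\<^esub> coord i s' \<oplus>\<^bsub>J\<^esub> ?y \<otimes>\<^bsub>J\<^esub> coord i s"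
      have "coord i (\<rho> (l s s')) = (\<psi> i ?x ?y \<oplus>\<^bsub>J\<^esub> g i (?x \<otimes>\<^bsub>J\<^esub> ?y)) \<oplus>\<^bsub>J\<^esub> ?r"
        using i c by (simp add: l standard_product_closed[OF \<psi>] coord_standard_product[OF \<psi>]
            aug_standard_product[OF \<psi>] J.M.a_ac)
      also have "\<dots> = (\<psi>' i ?x ?y \<oplus>\<^bsub>J\<^esub> (?x \<otimes>\<^bsub>J\<^esub> g i ?y \<oplus>\<^bsub>J\<^esub> ?y \<otimes>\<^bsub>J\<^esub> g i ?x)) \<oplus>\<^bsub>J\<^esub> ?r"
        by (simp only: eq)
      also have "\<dots> = coord i (l' (\<rho> s) (\<rho> s'))"
        using i cochains2_simps(1)[OF \<psi>'[OF i], of ?x ?y]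
        by (simp add: l' coord_standard_product[OF \<psi>'] J.jj_add_right J.M.a_ac)
      finally show "coord i (\<rho> (l s s')) = coord i (l' (\<rho> s) (\<rho> s'))" .
    qed (simp_all add: l l' standard_product_closed[OF \<psi>] standard_product_closed[OF \<psi>']
        aug_standard_product[OF \<psi>] aug_standard_product[OF \<psi>'])
    show "\<rho> s \<in> carrier T" by simp
    fix a assume "a \<in> carrier A"
    then show "\<rho> (tensor_smult F A J a s) = tensor_smult F A J a (\<rho> s)"
      by (intro tensor_coord_eqI)
        (simp_all add: module_hom_smult[OF g] J.smult_r_distr J.M.a_ac)
  qed
  ultimately show ?thesis
    unfolding equivalent_deformations_def tensor_aug_eq by auto
qed

end

end

section \<open>The second cohomology module\<close>

lemma cochains2_ops:
  "\<zero>\<^bsub>cochains2 F J\<^esub> = (\<lambda>x\<in>carrier J. \<lambda>y\<in>carrier J. \<zero>\<^bsub>J\<^esub>)"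
  "\<phi> \<oplus>\<^bsub>cochains2 F J\<^esub> \<psi> = (\<lambda>x\<in>carrier J. \<lambda>y\<in>carrier J. \<phi> x y \<oplus>\<^bsub>J\<^esub> \<psi> x y)"
  "c \<odot>\<^bsub>cochains2 F J\<^esub> \<phi> = (\<lambda>x\<in>carrier J. \<lambda>y\<in>carrier J. c \<odot>\<^bsub>J\<^esub> \<phi> x y)"
  by (simp_all add: cochains2_def)

lemma Z2_ops:
  "\<zero>\<^bsub>Z2 F J\<^esub> = \<zero>\<^bsub>cochains2 F J\<^esub>"
  "add (Z2 F J) = add (cochains2 F J)"
  "smult (Z2 F J) = smult (cochains2 F J)"
  by (simp_all add: Z2_def)

lemma cochains2_ext:
  assumes "\<phi> \<in> carrier (cochains2 F J)" "\<psi> \<in> carrier (cochains2 F J)"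
    and "\<And>x y. \<lbrakk>x \<in> carrier J; y \<in> carrier J\<rbrakk> \<Longrightarrow> \<phi> x y = \<psi> x y"
  shows "\<phi> = \<psi>"
proof -
  have E: "\<phi> \<in> carrier J \<rightarrow>\<^sub>E (carrier J \<rightarrow>\<^sub>E carrier J)" "\<psi> \<in> carrier J \<rightarrow>\<^sub>E (carrier J \<rightarrow>\<^sub>E carrier J)"
    using assms(1,2) by (auto simp: cochains2_def)
  show ?thesis
  proof (rule PiE_ext[OF E])
    fix x assume x: "x \<in> carrier J"
    show "\<phi> x = \<psi> x"
      by (rule PiE_ext[OF PiE_mem[OF E(1) x] PiE_mem[OF E(2) x]]) (rule assms(3)[OF x])
  qed
qed

text \<open>Bookkeeping for the proof that coboundaries are cocycles: there \<open>a\<close> is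
  \<open>x \<otimes> g (y \<otimes> z)\<close>, which occurs in the two summands with opposite
  signs.\<close>

lemma (in abelian_group) minus_minus_add_minus:
  assumes "g \<in> carrier G" "a \<in> carrier G" "b \<in> carrier G" "c \<in> carrier G" "d \<in> carrier G"
  shows "(g \<ominus> a \<ominus> b) \<oplus> (a \<ominus> c \<ominus> d) = g \<ominus> (b \<oplus> (c \<oplus> d))"
proof -
  have "(g \<ominus> a \<ominus> b) \<oplus> (a \<ominus> c \<ominus> d) = (a \<oplus> \<ominus> a) \<oplus> (g \<ominus> (b \<oplus> (c \<oplus> d)))"
    using assms by (simp add: a_minus_def minus_add a_ac)
  then show ?thesis using assms by (simp add: r_neg)
qed

lemma (in abelian_group) add_minus_add_minus:
  assumes "a \<in> carrier G" "b \<in> carrier G" "c \<in> carrier G" "d \<in> carrier G"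
  shows "(a \<ominus> b) \<oplus> (c \<ominus> d) = (a \<oplus> c) \<ominus> (b \<oplus> d)"
  using assms by (simp add: a_minus_def minus_add a_ac)

context jacobi_jordan_algebra
begin

lemma jj_minus_right:
  assumes "x \<in> carrier J" "y \<in> carrier J"
  shows "x \<otimes> (\<ominus> y) = \<ominus> (x \<otimes> y)"
  using jj_smult_right[of "\<ominus>\<^bsub>R\<^esub> \<one>\<^bsub>R\<^esub>" x y] jj_closed[OF assms] assms
  by (simp add: smult_minus_1)

lemma cochains2_module: "module R (cochains2 R J)"
proof (rule module_axiomsI)
  note c = cochains2_simps
  show "cring R" by (rule R.is_cring)
  show zero: "\<zero>\<^bsub>cochains2 R J\<^esub> \<in> carrier (cochains2 R J)"
    unfolding cochains2_ops by (rule cochains2I[OF bilinear_mapI]) (simp_all add: module_axioms)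
  have add: "\<phi> \<oplus>\<^bsub>cochains2 R J\<^esub> \<psi> \<in> carrier (cochains2 R J)"
    if "\<phi> \<in> carrier (cochains2 R J)" "\<psi> \<in> carrier (cochains2 R J)" for \<phi> \<psi>
    unfolding cochains2_ops
    by (rule cochains2I[OF bilinear_mapI])
      (use c(6)[OF that(1)] c(6)[OF that(2)] in \<open>simp_all add: module_axioms c(1-5)[OF that(1)]
        c(1-5)[OF that(2)] smult_r_distr M.a_ac\<close>)
  have smult: "a \<odot>\<^bsub>cochains2 R J\<^esub> \<phi> \<in> carrier (cochains2 R J)"
    if "a \<in> carrier R" "\<phi> \<in> carrier (cochains2 R J)" for a \<phi>
    unfolding cochains2_ops
    by (rule cochains2I[OF bilinear_mapI])
      (use that(1) c(6)[OF that(2)] in \<open>simp_all add: module_axioms c(1-5)[OF that(2)]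
        smult_r_distr smult_assoc1[symmetric] R.m_comm\<close>)
  fix \<phi> \<psi> \<chi> a b
  assume \<phi>: "\<phi> \<in> carrier (cochains2 R J)"
  show "\<phi> \<oplus>\<^bsub>cochains2 R J\<^esub> \<zero>\<^bsub>cochains2 R J\<^esub> = \<phi>"
    by (rule cochains2_ext[OF add[OF \<phi> zero] \<phi>]) (simp add: cochains2_ops c[OF \<phi>])
  show "\<one>\<^bsub>R\<^esub> \<odot>\<^bsub>cochains2 R J\<^esub> \<phi> = \<phi>"
    by (rule cochains2_ext[OF smult[OF R.one_closed \<phi>] \<phi>]) (simp add: cochains2_ops c(1)[OF \<phi>])
  show "\<zero>\<^bsub>R\<^esub> \<odot>\<^bsub>cochains2 R J\<^esub> \<phi> = \<zero>\<^bsub>cochains2 R J\<^esub>"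
    by (rule cochains2_ext[OF smult[OF R.zero_closed \<phi>] zero]) (simp add: cochains2_ops c(1)[OF \<phi>])
  {
    assume a: "a \<in> carrier R"
    then show "a \<odot>\<^bsub>cochains2 R J\<^esub> \<phi> \<in> carrier (cochains2 R J)" using \<phi> by (rule smult)
    assume b: "b \<in> carrier R"
    show "(a \<otimes>\<^bsub>R\<^esub> b) \<odot>\<^bsub>cochains2 R J\<^esub> \<phi> = a \<odot>\<^bsub>cochains2 R J\<^esub> (b \<odot>\<^bsub>cochains2 R J\<^esub> \<phi>)"
      by (rule cochains2_ext[OF smult[OF R.m_closed[OF a b] \<phi>] smult[OF a smult[OF b \<phi>]]])
        (simp add: cochains2_ops c(1)[OF \<phi>] smult_assoc1 a b)
    show "(a \<oplus>\<^bsub>R\<^esub> b) \<odot>\<^bsub>cochains2 R J\<^esub> \<phi>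
        = a \<odot>\<^bsub>cochains2 R J\<^esub> \<phi> \<oplus>\<^bsub>cochains2 R J\<^esub> b \<odot>\<^bsub>cochains2 R J\<^esub> \<phi>"
      by (rule cochains2_ext[OF smult[OF R.a_closed[OF a b] \<phi>] add[OF smult[OF a \<phi>] smult[OF b \<phi>]]])
        (simp add: cochains2_ops c(1)[OF \<phi>] smult_l_distr a b)
  }
  assume \<psi>: "\<psi> \<in> carrier (cochains2 R J)"
  show "\<phi> \<oplus>\<^bsub>cochains2 R J\<^esub> \<psi> \<in> carrier (cochains2 R J)" by (rule add[OF \<phi> \<psi>])
  show "\<phi> \<oplus>\<^bsub>cochains2 R J\<^esub> \<psi> = \<psi> \<oplus>\<^bsub>cochains2 R J\<^esub> \<phi>"
    by (rule cochains2_ext[OF add[OF \<phi> \<psi>] add[OF \<psi> \<phi>]])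
      (simp add: cochains2_ops c(1)[OF \<phi>] c(1)[OF \<psi>] M.a_comm)
  show "a \<odot>\<^bsub>cochains2 R J\<^esub> (\<phi> \<oplus>\<^bsub>cochains2 R J\<^esub> \<psi>)
      = a \<odot>\<^bsub>cochains2 R J\<^esub> \<phi> \<oplus>\<^bsub>cochains2 R J\<^esub> a \<odot>\<^bsub>cochains2 R J\<^esub> \<psi>" if a: "a \<in> carrier R"
    by (rule cochains2_ext[OF smult[OF a add[OF \<phi> \<psi>]] add[OF smult[OF a \<phi>] smult[OF a \<psi>]]])
      (simp add: cochains2_ops c(1)[OF \<phi>] c(1)[OF \<psi>] smult_r_distr a)
  assume \<chi>: "\<chi> \<in> carrier (cochains2 R J)"
  show "\<phi> \<oplus>\<^bsub>cochains2 R J\<^esub> \<psi> \<oplus>\<^bsub>cochains2 R J\<^esub> \<chi>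
      = \<phi> \<oplus>\<^bsub>cochains2 R J\<^esub> (\<psi> \<oplus>\<^bsub>cochains2 R J\<^esub> \<chi>)"
    by (rule cochains2_ext[OF add[OF add[OF \<phi> \<psi>] \<chi>] add[OF \<phi> add[OF \<psi> \<chi>]]])
      (simp add: cochains2_ops c(1)[OF \<phi>] c(1)[OF \<psi>] c(1)[OF \<chi>] M.a_assoc)
qed

lemma Z2_submodule: "submodule R (carrier (Z2 R J)) (cochains2 R J)"
proof -
  interpret C: module R "cochains2 R J" by (rule cochains2_module)
  show ?thesis
  proof (rule submodule.intro)
    show "module R (cochains2 R J)" by (rule cochains2_module)
    show "carrier (Z2 R J) \<subseteq> carrier (cochains2 R J)" by (auto simp: Z2_carrier)
    show "\<zero>\<^bsub>cochains2 R J\<^esub> \<in> carrier (Z2 R J)"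
      by (simp add: Z2_carrier coboundary2_def) (simp add: cochains2_ops jj_closed)
    fix \<phi> \<psi> assume "\<phi> \<in> carrier (Z2 R J)"
    then have \<phi>: "\<phi> \<in> carrier (cochains2 R J)" and d\<phi>: "\<And>x y z. \<lbrakk>x \<in> carrier J; y \<in> carrier J; z \<in> carrier J\<rbrakk>
      \<Longrightarrow> coboundary2 J \<phi> x y z = \<zero>" by (simp_all add: Z2_carrier)
    note c = cochains2_simps(1)[OF \<phi>]
    have "coboundary2 J (a \<odot>\<^bsub>cochains2 R J\<^esub> \<phi>) x y z = a \<odot> coboundary2 J \<phi> x y z"
      if "a \<in> carrier R" "x \<in> carrier J" "y \<in> carrier J" "z \<in> carrier J" for a x y z
      using that by (simp add: coboundary2_def cochains2_ops c jj_closed jj_smult_right smult_r_distr)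
    then show "a \<odot>\<^bsub>cochains2 R J\<^esub> \<phi> \<in> carrier (Z2 R J)" if "a \<in> carrier R" for a
      using that \<phi> by (simp add: Z2_carrier d\<phi>)
    assume "\<psi> \<in> carrier (Z2 R J)"
    then have \<psi>: "\<psi> \<in> carrier (cochains2 R J)" and d\<psi>: "\<And>x y z. \<lbrakk>x \<in> carrier J; y \<in> carrier J; z \<in> carrier J\<rbrakk>
      \<Longrightarrow> coboundary2 J \<psi> x y z = \<zero>" by (simp_all add: Z2_carrier)
    have "coboundary2 J (\<phi> \<oplus>\<^bsub>cochains2 R J\<^esub> \<psi>) x y z = coboundary2 J \<phi> x y z \<oplus> coboundary2 J \<psi> x y z"
      if "x \<in> carrier J" "y \<in> carrier J" "z \<in> carrier J" for x y z
      using that cochains2_simps(1)[OF \<psi>]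
      by (simp add: coboundary2_def cochains2_ops c jj_closed jj_add_right M.a_ac)
    then show "\<phi> \<oplus>\<^bsub>cochains2 R J\<^esub> \<psi> \<in> carrier (Z2 R J)"
      using \<phi> \<psi> by (simp add: Z2_carrier d\<phi> d\<psi>)
  qed
qed

lemma Z2_module: "module R (Z2 R J)"
proof -
  interpret C: module R "cochains2 R J" by (rule cochains2_module)
  have "Z2 R J = (cochains2 R J)\<lparr>carrier := carrier (Z2 R J)\<rparr>"
    by (simp add: Z2_def)
  then show ?thesis using C.submodule_is_module[OF Z2_submodule] by simp
qed

lemma coboundary1_apply:
  "\<lbrakk>x \<in> carrier J; y \<in> carrier J\<rbrakk> \<Longrightarrow> coboundary1 J g x y = g (x \<otimes> y) \<ominus> x \<otimes> g y \<ominus> y \<otimes> g x"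
  by (simp add: coboundary1_def)

lemma coboundary1_cochain:
  assumes g: "g \<in> module_hom R J J"
  shows "coboundary1 J g \<in> carrier (cochains2 R J)"
  unfolding coboundary1_def
  by (rule cochains2I[OF bilinear_mapI])
    (use module_hom_in[OF g] module_hom_add[OF g] module_hom_smult[OF g] in
      \<open>simp_all add: module_axioms jj_closed jj_add_left jj_add_right jj_smult_left jj_smult_right
        smult_r_distr a_minus_def M.minus_add smult_r_minus[symmetric] M.a_ac jj_comm\<close>)

text \<open>The identity \<open>d d = 0\<close>. After cancellation there remain \<open>g\<close> of
  a Jacobi sum and, for each of \<open>x\<close>, \<open>y\<close>, \<open>z\<close>, a Jacobi sum
  in which that argument is replaced by its image under \<open>g\<close>.\<close>

lemma coboundary1_cocycle:
  assumes g: "g \<in> module_hom R J J"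
  shows "coboundary1 J g \<in> carrier (Z2 R J)"
proof -
  note [simp] = module_hom_in[OF g] jj_closed
  have "coboundary2 J (coboundary1 J g) x y z = \<zero>"
    if xyz: "x \<in> carrier J" "y \<in> carrier J" "z \<in> carrier J" for x y z
  proof -
    have *: "coboundary1 J g x (y \<otimes> z) \<oplus> x \<otimes> coboundary1 J g y z
        = g (x \<otimes> (y \<otimes> z)) \<ominus> ((y \<otimes> z) \<otimes> g x \<oplus> (x \<otimes> (y \<otimes> g z) \<oplus> x \<otimes> (z \<otimes> g y)))"
      if "x \<in> carrier J" "y \<in> carrier J" "z \<in> carrier J" for x y z
    proof -
      have "x \<otimes> coboundary1 J g y z = x \<otimes> g (y \<otimes> z) \<ominus> x \<otimes> (y \<otimes> g z) \<ominus> x \<otimes> (z \<otimes> g y)"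
        using that by (simp add: coboundary1_apply a_minus_def jj_add_right jj_minus_right)
      then show ?thesis
        using that by (simp add: coboundary1_apply M.minus_minus_add_minus)
    qed
    note d = cochains2_simps(1)[OF coboundary1_cochain[OF g]]
    have "coboundary2 J (coboundary1 J g) x y z
        = (coboundary1 J g x (y \<otimes> z) \<oplus> x \<otimes> coboundary1 J g y z)
          \<oplus> ((coboundary1 J g y (z \<otimes> x) \<oplus> y \<otimes> coboundary1 J g z x)
          \<oplus> (coboundary1 J g z (x \<otimes> y) \<oplus> z \<otimes> coboundary1 J g x y))"
      using xyz by (simp add: coboundary2_def d M.a_ac)
    also have "\<dots> = (g (x \<otimes> (y \<otimes> z)) \<oplus> (g (y \<otimes> (z \<otimes> x)) \<oplus> g (z \<otimes> (x \<otimes> y)))) \<ominus>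
        (((y \<otimes> z) \<otimes> g x \<oplus> (x \<otimes> (y \<otimes> g z) \<oplus> x \<otimes> (z \<otimes> g y))) \<oplus>
        (((z \<otimes> x) \<otimes> g y \<oplus> (y \<otimes> (z \<otimes> g x) \<oplus> y \<otimes> (x \<otimes> g z))) \<oplus>
        ((x \<otimes> y) \<otimes> g z \<oplus> (z \<otimes> (x \<otimes> g y) \<oplus> z \<otimes> (y \<otimes> g x)))))"
      using xyz by (simp add: * M.add_minus_add_minus)
    also have "g (x \<otimes> (y \<otimes> z)) \<oplus> (g (y \<otimes> (z \<otimes> x)) \<oplus> g (z \<otimes> (x \<otimes> y)))
        = g (x \<otimes> (y \<otimes> z) \<oplus> y \<otimes> (z \<otimes> x) \<oplus> z \<otimes> (x \<otimes> y))"
      using xyz by (simp add: module_hom_add[OF g] M.a_assoc)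
    also have "\<dots> = \<zero>"
      using xyz module_hom_zero[OF module_axioms module_axioms g] by (simp add: jj_jacobi)
    \<comment> \<open>Regrouped according to which of \<open>g x\<close>, \<open>g y\<close>,
      \<open>g z\<close> occurs; each group is a Jacobi sum.\<close>
    also have "((y \<otimes> z) \<otimes> g x \<oplus> (x \<otimes> (y \<otimes> g z) \<oplus> x \<otimes> (z \<otimes> g y))) \<oplus>
        (((z \<otimes> x) \<otimes> g y \<oplus> (y \<otimes> (z \<otimes> g x) \<oplus> y \<otimes> (x \<otimes> g z))) \<oplus>
        ((x \<otimes> y) \<otimes> g z \<oplus> (z \<otimes> (x \<otimes> g y) \<oplus> z \<otimes> (y \<otimes> g x))))
       = (y \<otimes> (z \<otimes> g x) \<oplus> z \<otimes> (g x \<otimes> y) \<oplus> g x \<otimes> (y \<otimes> z)) \<oplus>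
        ((z \<otimes> (x \<otimes> g y) \<oplus> x \<otimes> (g y \<otimes> z) \<oplus> g y \<otimes> (z \<otimes> x)) \<oplus>
        (x \<otimes> (y \<otimes> g z) \<oplus> y \<otimes> (g z \<otimes> x) \<oplus> g z \<otimes> (x \<otimes> y)))"
      using xyz
      by (simp add: jj_comm[of "g x"] jj_comm[of "g y"] jj_comm[of "g z"] M.a_ac)
    also have "\<dots> = \<zero>" using xyz by (simp add: jj_jacobi)
    finally show ?thesis by (simp add: a_minus_def)
  qed
  then show ?thesis using coboundary1_cochain[OF g] by (simp add: Z2_carrier)
qed

text \<open>\<open>coboundary1\<close> is linear in \<open>g\<close>, so sums and multiples of
  coboundaries come from sums and multiples of linear maps; the inclusion in the cocycles is
  \<open>d d = 0\<close>.\<close>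

lemma B2_submodule: "submodule R (B2 R J) (Z2 R J)"
proof (rule submodule.intro)
  interpret C: module R "cochains2 R J" by (rule cochains2_module)
  show "module R (Z2 R J)" by (rule Z2_module)
  show "B2 R J \<subseteq> carrier (Z2 R J)" by (auto simp: B2_def coboundary1_cocycle)
  have minus_zero: "\<ominus> \<zero> = \<zero>" using M.r_neg[of \<zero>] by simp
  have "coboundary1 J (\<lambda>x. \<zero>) = \<zero>\<^bsub>cochains2 R J\<^esub>"
    by (rule cochains2_ext[OF coboundary1_cochain[OF module_hom_zero_map[OF module_axioms]] C.zero_closed])
      (simp add: coboundary1_apply cochains2_ops a_minus_def jj_closed minus_zero)
  then show "\<zero>\<^bsub>Z2 R J\<^esub> \<in> B2 R J"
    using module_hom_zero_map[OF module_axioms] unfolding B2_def Z2_ops by (metis image_eqI)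
  fix v w assume "v \<in> B2 R J"
  then obtain g where g: "g \<in> module_hom R J J" "v = coboundary1 J g" by (auto simp: B2_def)
  note [simp] = module_hom_in[OF g(1)] jj_closed
  show "c \<odot>\<^bsub>Z2 R J\<^esub> v \<in> B2 R J" if c: "c \<in> carrier R" for c
  proof -
    have cg: "(\<lambda>x. c \<odot> g x) \<in> module_hom R J J"
      by (rule module_hom_compose[OF g(1) module_hom_self_smult[OF c]])
    have "c \<odot>\<^bsub>cochains2 R J\<^esub> v = coboundary1 J (\<lambda>x. c \<odot> g x)"
      unfolding g(2)
      by (rule cochains2_ext[OF C.smult_closed[OF c coboundary1_cochain[OF g(1)]] coboundary1_cochain[OF cg]])
        (use c in \<open>simp add: coboundary1_apply cochains2_ops a_minus_def smult_r_distr
          smult_r_minus jj_smult_right\<close>)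
    then show ?thesis using cg unfolding B2_def Z2_ops by blast
  qed
  assume "w \<in> B2 R J"
  then obtain h where h: "h \<in> module_hom R J J" "w = coboundary1 J h" by (auto simp: B2_def)
  have gh: "(\<lambda>x. g x \<oplus> h x) \<in> module_hom R J J"
    by (rule module_hom_add_maps[OF module_axioms g(1) h(1)])
  have "v \<oplus>\<^bsub>cochains2 R J\<^esub> w = coboundary1 J (\<lambda>x. g x \<oplus> h x)"
    unfolding g(2) h(2)
    by (rule cochains2_ext[OF C.a_closed[OF coboundary1_cochain[OF g(1)] coboundary1_cochain[OF h(1)]]
          coboundary1_cochain[OF gh]])
      (use module_hom_in[OF h(1)] in \<open>simp add: coboundary1_apply cochains2_ops a_minus_def
        M.minus_add jj_add_right M.a_ac\<close>)
  then show "v \<oplus>\<^bsub>Z2 R J\<^esub> w \<in> B2 R J" using gh unfolding B2_def Z2_ops by blast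
qed

lemma H2_module: "module R (H2 R J)"
  unfolding H2_def by (rule quotient_module[OF B2_submodule])

text \<open>The right-hand side is the relation between cocycles that occurs in
  \<open>equivalent_imp_cohomologous\<close> and \<open>cohomologous_imp_equivalent\<close>, so
  equivalence of deformations becomes equality of classes.\<close>

lemma H2_class_eq_iff:
  assumes \<phi>: "\<phi> \<in> carrier (Z2 R J)" and \<psi>: "\<psi> \<in> carrier (Z2 R J)"
  shows "B2 R J +>\<^bsub>Z2 R J\<^esub> \<phi> = B2 R J +>\<^bsub>Z2 R J\<^esub> \<psi> \<longleftrightarrow>
    (\<exists>g\<in>module_hom R J J. \<forall>x\<in>carrier J. \<forall>y\<in>carrier J. \<phi> x y = \<psi> x y \<oplus> coboundary1 J g x y)"
proof -
  interpret Z: module R "Z2 R J" by (rule Z2_module)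
  have "B2 R J +>\<^bsub>Z2 R J\<^esub> \<phi> = B2 R J +>\<^bsub>Z2 R J\<^esub> \<psi> \<longleftrightarrow> \<phi> \<ominus>\<^bsub>Z2 R J\<^esub> \<psi> \<in> B2 R J"
    by (rule quotient_eq_iff[OF B2_submodule \<phi> \<psi>])
  also have "\<dots> \<longleftrightarrow> (\<exists>g\<in>module_hom R J J. \<phi> \<ominus>\<^bsub>Z2 R J\<^esub> \<psi> = coboundary1 J g)"
    by (auto simp: B2_def)
  also have "\<dots> \<longleftrightarrow> (\<exists>g\<in>module_hom R J J. \<phi> = \<psi> \<oplus>\<^bsub>Z2 R J\<^esub> coboundary1 J g)"
  proof (rule bex_cong[OF refl])
    fix g assume "g \<in> module_hom R J J"
    then have "coboundary1 J g \<in> carrier (Z2 R J)" by (rule coboundary1_cocycle)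
    then show "\<phi> \<ominus>\<^bsub>Z2 R J\<^esub> \<psi> = coboundary1 J g \<longleftrightarrow> \<phi> = \<psi> \<oplus>\<^bsub>Z2 R J\<^esub> coboundary1 J g"
      using \<phi> \<psi> unfolding a_minus_def
      by (metis Z.M.add.inv_solve_right Z.M.a_comm)
  qed
  also have "\<dots> \<longleftrightarrow> (\<exists>g\<in>module_hom R J J. \<forall>x\<in>carrier J. \<forall>y\<in>carrier J.
      \<phi> x y = \<psi> x y \<oplus> coboundary1 J g x y)"
  proof (rule bex_cong[OF refl])
    fix g assume g: "g \<in> module_hom R J J"
    have "\<phi> = \<psi> \<oplus>\<^bsub>Z2 R J\<^esub> coboundary1 J g \<longleftrightarrow>
        (\<forall>x\<in>carrier J. \<forall>y\<in>carrier J. \<phi> x y = (\<psi> \<oplus>\<^bsub>Z2 R J\<^esub> coboundary1 J g) x y)"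
      using \<phi> Z.M.a_closed[OF \<psi> coboundary1_cocycle[OF g]]
      by (auto simp: Z2_carrier intro: cochains2_ext)
    then show "\<phi> = \<psi> \<oplus>\<^bsub>Z2 R J\<^esub> coboundary1 J g \<longleftrightarrow>
        (\<forall>x\<in>carrier J. \<forall>y\<in>carrier J. \<phi> x y = \<psi> x y \<oplus> coboundary1 J g x y)"
      by (simp add: Z2_ops cochains2_ops)
  qed
  finally show ?thesis .
qed

end

section \<open>Coordinates of a finite-dimensional base\<close>

lemma regular_module_minus [simp]:
  "a_inv (regular_module R) = a_inv R" "a_minus (regular_module R) = a_minus R"
  by (simp_all add: a_inv_def a_minus_def[abs_def] m_inv_def[abs_def])

text \<open>\<open>k s\<close> is the coefficient at the basis vector \<open>s\<close>; linearity
  and duality both come from uniqueness of coefficients in a basis.\<close>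

lemma (in vectorspace) fin_dim_coordinates:
  assumes "fin_dim"
  obtains S k where "finite S" "S \<subseteq> carrier V"
    "\<And>s. s \<in> S \<Longrightarrow> k s \<in> module_hom K V (regular_module K)"
    "\<And>s s'. \<lbrakk>s \<in> S; s' \<in> S\<rbrakk> \<Longrightarrow> k s s' = (if s = s' then \<one>\<^bsub>K\<^esub> else \<zero>\<^bsub>K\<^esub>)"
    "\<And>v. v \<in> carrier V \<Longrightarrow> v = (\<Oplus>\<^bsub>V\<^esub>s\<in>S. k s v \<odot>\<^bsub>V\<^esub> s)"
proof -
  obtain S where S: "finite S" "basis S" using finite_basis_exists[OF assms] by blast
  then have SV: "S \<subseteq> carrier V" by (simp add: basis_def)
  have ex1: "\<exists>!a. a \<in> S \<rightarrow>\<^sub>E carrier K \<and> lincomb a S = v" if "v \<in> carrier V" for v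
    using basis_criterion[OF S(1) SV] S(2) that by blast
  define co where "co v = (THE a. a \<in> S \<rightarrow>\<^sub>E carrier K \<and> lincomb a S = v)" for v
  have co: "co v \<in> S \<rightarrow>\<^sub>E carrier K" "lincomb (co v) S = v" if "v \<in> carrier V" for v
    using theI'[OF ex1[OF that]] by (simp_all add: co_def)
  \<comment> \<open>Uniqueness in usable form: any coefficients that combine to \<open>v\<close> are
    the chosen ones, after restriction to \<open>S\<close>.\<close>
  have co_eq: "co v s = a s" if "a \<in> S \<rightarrow> carrier K" "lincomb a S = v" "s \<in> S" for v a s
  proof -
    have v: "v \<in> carrier V" using that(1,2) SV by auto
    have "lincomb (restrict a S) S = v"
      using that(1,2) SV by (subst lincomb_cong[of S S "restrict a S" a]) auto
    moreover have "restrict a S \<in> S \<rightarrow>\<^sub>E carrier K" using that(1) by auto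
    ultimately have "co v = restrict a S" using ex1[OF v] co[OF v] by blast
    then show ?thesis using that(3) by simp
  qed
  have co_in: "co v \<in> S \<rightarrow> carrier K" if "v \<in> carrier V" for v
    using co(1)[OF that] by auto
  show thesis
  proof (rule that[of S "\<lambda>s v. co v s"])
    show "(\<lambda>v. co v s) \<in> module_hom K V (regular_module K)" if s: "s \<in> S" for s
    proof (rule module_homI; simp)
      fix v assume v: "v \<in> carrier V"
      then show "co v s \<in> carrier K" using co(1) s by auto
      show "co (c \<odot>\<^bsub>V\<^esub> v) s = c \<otimes>\<^bsub>K\<^esub> co v s" if "c \<in> carrier K" for c
        using lincomb_smult[OF SV co_in[OF v] that] co(2)[OF v] co_in[OF v] that s
        by (intro co_eq) auto
      fix w assume w: "w \<in> carrier V"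
      show "co (v \<oplus>\<^bsub>V\<^esub> w) s = co v s \<oplus>\<^bsub>K\<^esub> co w s"
        using lincomb_sum[OF S(1) SV co_in[OF v] co_in[OF w]] co(2)[OF v] co(2)[OF w]
          co_in[OF v] co_in[OF w] s
        by (intro co_eq) auto
    qed
    show "co s' s = (if s = s' then \<one>\<^bsub>K\<^esub> else \<zero>\<^bsub>K\<^esub>)" if "s \<in> S" "s' \<in> S" for s s'
    proof (rule co_eq[of "\<lambda>s. if s = s' then \<one>\<^bsub>K\<^esub> else \<zero>\<^bsub>K\<^esub>"])
      have "lincomb (\<lambda>s. if s = s' then \<one>\<^bsub>K\<^esub> else \<zero>\<^bsub>K\<^esub>) S
          = (\<Oplus>\<^bsub>V\<^esub>s\<in>S. if s' = s then s else \<zero>\<^bsub>V\<^esub>)"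
        unfolding lincomb_def using SV by (intro M.finsum_cong') auto
      also have "\<dots> = s'"
        using SV S(1) that by (intro M.add.finprod_singleton) auto
      finally show "lincomb (\<lambda>s. if s = s' then \<one>\<^bsub>K\<^esub> else \<zero>\<^bsub>K\<^esub>) S = s'" .
    qed (use that in auto)
    show "v = (\<Oplus>\<^bsub>V\<^esub>s\<in>S. co v s \<odot>\<^bsub>V\<^esub> s)" if "v \<in> carrier V" for v
      using co(2)[OF that] by (simp add: lincomb_def)
  qed (use S SV in auto)
qed

context augmented_algebra
begin

lemma aug_hom: "\<epsilon> \<in> module_hom F A (regular_module F)"
  using ring_hom_closed[OF aug_ring_hom] ring_hom_add[OF aug_ring_hom] aug_smult
  by (intro module_homI) auto

lemma kernel_iff: "a \<in> a_kernel A F \<epsilon> \<longleftrightarrow> a \<in> carrier A \<and> \<epsilon> a = \<zero>\<^bsub>F\<^esub>"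
  by (auto simp: a_kernel_def')

text \<open>Write \<open>a = \<epsilon> a 1 + a'\<close> and \<open>b = \<epsilon> b 1 + b'\<close>
  with \<open>a'\<close>, \<open>b'\<close> in the kernel. Then \<open>a' b' = 0\<close>, and
  \<open>w\<close> kills the multiple of \<open>1\<close>. Thus a functional vanishing at
  \<open>1\<close> is a derivation along \<open>\<epsilon>\<close>; this is the source of
  \<open>u_mult\<close>.\<close>

lemma infinitesimal_product:
  assumes null: "\<And>a b. \<lbrakk>a \<in> a_kernel A F \<epsilon>; b \<in> a_kernel A F \<epsilon>\<rbrakk> \<Longrightarrow> a \<otimes> b = \<zero>"
    and w: "w \<in> module_hom F A (regular_module F)" "w \<one> = \<zero>\<^bsub>F\<^esub>"
    and a: "a \<in> carrier A" and b: "b \<in> carrier A"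
  shows "w (a \<otimes> b) = \<epsilon> a \<otimes>\<^bsub>F\<^esub> w b \<oplus>\<^bsub>F\<^esub> w a \<otimes>\<^bsub>F\<^esub> \<epsilon> b"
proof -
  note e = ring_hom_closed[OF aug_ring_hom] ring_hom_add[OF aug_ring_hom]
    ring_hom_mult[OF aug_ring_hom] ring_hom_one[OF aug_ring_hom] aug_smult
  have mod: "module F (regular_module F)" by (rule regular_module[OF R.is_cring])
  note w_simps = module_hom_in[OF w(1), simplified] module_hom_add[OF w(1), simplified]
    module_hom_smult[OF w(1), simplified]
  define a' where "a' = a \<ominus> \<epsilon> a \<odot> \<one>"
  define b' where "b' = b \<ominus> \<epsilon> b \<odot> \<one>"
  have a': "a' \<in> carrier A" "a = \<epsilon> a \<odot> \<one> \<oplus> a'"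
    using a by (simp_all add: a'_def e a_minus_def M.r_neg1 M.a_ac M.r_neg)
  have b': "b' \<in> carrier A" "b = \<epsilon> b \<odot> \<one> \<oplus> b'"
    using b by (simp_all add: b'_def e a_minus_def M.r_neg1 M.a_ac M.r_neg)
  have "\<epsilon> a' = \<zero>\<^bsub>F\<^esub>" "\<epsilon> b' = \<zero>\<^bsub>F\<^esub>"
    using a b module_hom_minus[OF module_axioms mod aug_hom, of _ "_ \<odot> \<one>"]
    by (simp_all add: a'_def b'_def e a_minus_def R.r_neg)
  then have null': "a' \<otimes> b' = \<zero>" using null a' b' by (simp add: kernel_iff)
  have wa: "w a = w a'" and wb: "w b = w b'"
    using a'(1) b'(1) a b w_simps w(2) by (subst a'(2) b'(2), simp add: e)+
  have "a \<otimes> b = (\<epsilon> a \<odot> \<one> \<oplus> a') \<otimes> (\<epsilon> b \<odot> \<one> \<oplus> b')"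
    using a'(2) b'(2) by simp
  also have "\<dots> = \<epsilon> a \<odot> (\<epsilon> b \<odot> \<one>) \<oplus> (\<epsilon> a \<odot> b' \<oplus> \<epsilon> b \<odot> a')"
    using a b a'(1) b'(1) null' smult_assoc2[of "\<epsilon> b" \<one> a']
    by (simp add: e l_distr r_distr smult_assoc2 M.a_ac m_comm[of a' "\<epsilon> b \<odot> \<one>"])
  finally show ?thesis
    using a b a'(1) b'(1) by (simp add: w_simps w(2) e wa wb R.m_comm)
qed

end

text \<open>If \<open>k\<close> are the coordinates for a basis \<open>S\<close> of \<open>A\<close> and \<open>k r 1 \<noteq> 0\<close>, then \<open>1\<close> can be exchanged
  for the basis vector \<open>r\<close>.\<close>
lemma coordinatized_base_exists:
  fixes A :: "('f, 'a, 'n) module_scheme"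
  assumes "augmented_algebra F A \<epsilon>" "jacobi_jordan_algebra F J" "vectorspace.fin_dim F A"
    and null: "\<And>a b. \<lbrakk>a \<in> a_kernel A F \<epsilon>; b \<in> a_kernel A F \<epsilon>\<rbrakk> \<Longrightarrow> a \<otimes>\<^bsub>A\<^esub> b = \<zero>\<^bsub>A\<^esub>"
  obtains I :: "'a set" and u m where "coordinatized_base F A J \<epsilon> I u m"
proof -
  interpret A: augmented_algebra F A \<epsilon> by fact
  interpret J: jacobi_jordan_algebra F J by fact
  interpret vectorspace F A by unfold_locales
  note e = ring_hom_closed[OF A.aug_ring_hom] ring_hom_add[OF A.aug_ring_hom]
    ring_hom_mult[OF A.aug_ring_hom] ring_hom_one[OF A.aug_ring_hom] A.aug_smult
  have mod: "module F (regular_module F)" by (rule regular_module[OF A.R.is_cring])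
  have e_minus: "\<epsilon> (a \<ominus>\<^bsub>A\<^esub> b) = \<epsilon> a \<ominus>\<^bsub>F\<^esub> \<epsilon> b" if "a \<in> carrier A" "b \<in> carrier A" for a b
    using module_hom_minus[OF A.module_axioms mod A.aug_hom that] by simp
  obtain S k where S: "finite S" "S \<subseteq> carrier A"
    and k: "\<And>s. s \<in> S \<Longrightarrow> k s \<in> module_hom F A (regular_module F)"
    and k_delta: "\<And>s s'. \<lbrakk>s \<in> S; s' \<in> S\<rbrakk> \<Longrightarrow> k s s' = (if s = s' then \<one>\<^bsub>F\<^esub> else \<zero>\<^bsub>F\<^esub>)"
    and k_sum: "\<And>v. v \<in> carrier A \<Longrightarrow> v = (\<Oplus>\<^bsub>A\<^esub>s\<in>S. k s v \<odot>\<^bsub>A\<^esub> s)"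
    by (rule fin_dim_coordinates[OF assms(3)]) (rule that)
  note k_closed = module_hom_in[OF k, simplified] and k_add = module_hom_add[OF k, simplified]
    and k_smult = module_hom_smult[OF k, simplified]
  have k_eqI: "v = w" if "v \<in> carrier A" "w \<in> carrier A" "\<And>s. s \<in> S \<Longrightarrow> k s v = k s w" for v w
  proof -
    have "(\<Oplus>\<^bsub>A\<^esub>s\<in>S. k s v \<odot>\<^bsub>A\<^esub> s) = (\<Oplus>\<^bsub>A\<^esub>s\<in>S. k s w \<odot>\<^bsub>A\<^esub> s)"
      using that S k_closed by (intro A.M.finsum_cong') auto
    then show ?thesis using k_sum[OF that(1)] k_sum[OF that(2)] by simp
  qed
  \<comment> \<open>If all coordinates of \<open>1\<close> vanished, then \<open>1 = 0\<close> in
    \<open>A\<close>, against \<open>\<epsilon> 1 = 1\<close>.\<close>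
  have "\<exists>r\<in>S. k r \<one>\<^bsub>A\<^esub> \<noteq> \<zero>\<^bsub>F\<^esub>"
  proof (rule ccontr)
    assume "\<not> ?thesis"
    then have "\<one>\<^bsub>A\<^esub> = \<zero>\<^bsub>A\<^esub>"
      by (intro k_eqI) (auto simp: module_hom_zero[OF A.module_axioms mod k])
    then have "\<one>\<^bsub>F\<^esub> = \<zero>\<^bsub>F\<^esub>"
      using e(4) module_hom_zero[OF A.module_axioms mod A.aug_hom] by simp
    then show False by simp
  qed
  then obtain r where r: "r \<in> S" "k r \<one>\<^bsub>A\<^esub> \<noteq> \<zero>\<^bsub>F\<^esub>" by blast
  define d where "d = k r \<one>\<^bsub>A\<^esub>"
  define d' where "d' = inv\<^bsub>F\<^esub> d"
  have d: "d \<in> carrier F" "d' \<in> carrier F" "d' \<otimes>\<^bsub>F\<^esub> d = \<one>\<^bsub>F\<^esub>"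
  proof -
    have "d \<in> Units F"
      using r k_closed[OF r(1), of "\<one>\<^bsub>A\<^esub>"] unfolding A.field_Units by (simp add: d_def)
    then show "d \<in> carrier F" "d' \<in> carrier F" "d' \<otimes>\<^bsub>F\<^esub> d = \<one>\<^bsub>F\<^esub>"
      by (simp_all add: d'_def A.R.Units_closed)
  qed
  define I where "I = S - {r}"
  \<comment> \<open>\<open>u s\<close> subtracts the multiple of \<open>k r\<close> that makes it
    vanish at \<open>1\<close>, and \<open>m s\<close> moves \<open>s\<close> into the kernel of
    \<open>\<epsilon>\<close>. Duality survives because \<open>u s\<close> kills \<open>1\<close>
    and \<open>k r\<close> vanishes at the other basis vectors.\<close>
  define u where "u s v = k s v \<ominus>\<^bsub>F\<^esub> (k s \<one>\<^bsub>A\<^esub> \<otimes>\<^bsub>F\<^esub> d') \<otimes>\<^bsub>F\<^esub> k r v" for s v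
  define m where "m s = s \<ominus>\<^bsub>A\<^esub> \<epsilon> s \<odot>\<^bsub>A\<^esub> \<one>\<^bsub>A\<^esub>" for s
  have IS: "s \<in> S" "s \<in> carrier A" "s \<noteq> r" if "s \<in> I" for s
    using that S(2) by (auto simp: I_def)
  have u_hom: "u s \<in> module_hom F A (regular_module F)" if "s \<in> I" for s
    using IS[OF that] r(1) d
    by (intro module_homI)
      (simp_all add: u_def k_closed k_add k_smult a_minus_def A.R.r_distr A.R.minus_add A.R.a_ac
        A.R.r_minus A.R.m_ac)
  have u_one: "u s \<one>\<^bsub>A\<^esub> = \<zero>\<^bsub>F\<^esub>" if "s \<in> I" for s
  proof -
    have "(k s \<one>\<^bsub>A\<^esub> \<otimes>\<^bsub>F\<^esub> d') \<otimes>\<^bsub>F\<^esub> k r \<one>\<^bsub>A\<^esub> = k s \<one>\<^bsub>A\<^esub>"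
      using IS[OF that] d k_closed[of s "\<one>\<^bsub>A\<^esub>"] by (simp add: A.R.m_assoc d_def[symmetric])
    then show ?thesis using IS[OF that] by (simp add: u_def k_closed)
  qed
  note u_simps = module_hom_in[OF u_hom, simplified] module_hom_add[OF u_hom, simplified]
    module_hom_smult[OF u_hom, simplified] module_hom_minus[OF A.module_axioms mod u_hom, simplified]
  show thesis
  proof (rule that[of I u m], unfold_locales)
    show "finite I" using S by (simp add: I_def)
    show "\<epsilon> \<in> module_hom F A (regular_module F)" by (rule A.aug_hom)
    show "\<epsilon> \<one>\<^bsub>A\<^esub> = \<one>\<^bsub>F\<^esub>" by (rule e)
    show "\<epsilon> (a \<otimes>\<^bsub>A\<^esub> b) = \<epsilon> a \<otimes>\<^bsub>F\<^esub> \<epsilon> b" if "a \<in> carrier A" "b \<in> carrier A" for a b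
      using that by (rule e)
    show "u s (a \<otimes>\<^bsub>A\<^esub> b) = \<epsilon> a \<otimes>\<^bsub>F\<^esub> u s b \<oplus>\<^bsub>F\<^esub> u s a \<otimes>\<^bsub>F\<^esub> \<epsilon> b"
      if "s \<in> I" "a \<in> carrier A" "b \<in> carrier A" for s a b
      by (rule A.infinitesimal_product[OF null u_hom[OF that(1)] u_one[OF that(1)] that(2,3)])
    show "u s \<in> module_hom F A (regular_module F)" if "s \<in> I" for s by (rule u_hom[OF that])
    show "u s \<one>\<^bsub>A\<^esub> = \<zero>\<^bsub>F\<^esub>" if "s \<in> I" for s by (rule u_one[OF that])
    show "m s \<in> carrier A" "\<epsilon> (m s) = \<zero>\<^bsub>F\<^esub>" if "s \<in> I" for s
      using IS[OF that] by (simp_all add: m_def e e_minus)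
    show "u s (m s') = (if s = s' then \<one>\<^bsub>F\<^esub> else \<zero>\<^bsub>F\<^esub>)" if "s \<in> I" "s' \<in> I" for s s'
    proof -
      have "u s (m s') = u s s'"
        using IS[OF that(1)] IS[OF that(2)] that
        by (simp add: m_def u_simps e u_one) (simp add: a_minus_def u_simps)
      also have "\<dots> = k s s'"
        using IS[OF that(1)] IS[OF that(2)] r(1) d
        by (simp add: u_def k_delta k_closed a_minus_def)
      finally show ?thesis using IS[OF that(1)] IS[OF that(2)] by (simp add: k_delta)
    qed
    show "a = b" if ab: "a \<in> carrier A" "b \<in> carrier A" "\<epsilon> a = \<epsilon> b" "\<And>s. s \<in> I \<Longrightarrow> u s a = u s b" for a b
    proof -
      define v where "v = a \<ominus>\<^bsub>A\<^esub> b"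
      have v: "v \<in> carrier A" "\<epsilon> v = \<zero>\<^bsub>F\<^esub>" using ab by (simp_all add: v_def e_minus e)
      have uv: "u s v = \<zero>\<^bsub>F\<^esub>" if "s \<in> I" for s
        using ab(1,2) ab(4)[OF that] that by (simp add: v_def u_simps)
      \<comment> \<open>Vanishing of all \<open>u s\<close> makes the coordinates of
        \<open>v\<close> proportional to those of \<open>1\<close>; then
        \<open>\<epsilon> v = 0\<close> forces the factor to be zero.\<close>
      have v1: "v = (d' \<otimes>\<^bsub>F\<^esub> k r v) \<odot>\<^bsub>A\<^esub> \<one>\<^bsub>A\<^esub>"
      proof (rule k_eqI)
        fix s assume s: "s \<in> S"
        show "k s v = k s ((d' \<otimes>\<^bsub>F\<^esub> k r v) \<odot>\<^bsub>A\<^esub> \<one>\<^bsub>A\<^esub>)"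
        proof (cases "s = r")
          case True
          have "(d' \<otimes>\<^bsub>F\<^esub> k r v) \<otimes>\<^bsub>F\<^esub> d = (d' \<otimes>\<^bsub>F\<^esub> d) \<otimes>\<^bsub>F\<^esub> k r v"
            using d(1,2) v(1) r(1) k_closed by (simp add: A.R.m_ac)
          then show ?thesis
            using d v r(1) k_closed True by (simp add: k_smult d_def[symmetric])
        next
          case False
          then have "k s v = (k s \<one>\<^bsub>A\<^esub> \<otimes>\<^bsub>F\<^esub> d') \<otimes>\<^bsub>F\<^esub> k r v"
            using uv[of s] s r(1) v d by (simp add: I_def u_def k_closed)
          then show ?thesis using s r(1) v d by (simp add: k_smult k_closed A.R.m_ac)
        qed
      qed (use v d r(1) in \<open>simp_all add: k_closed\<close>)
      have "\<epsilon> ((d' \<otimes>\<^bsub>F\<^esub> k r v) \<odot>\<^bsub>A\<^esub> \<one>\<^bsub>A\<^esub>) = \<zero>\<^bsub>F\<^esub>"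
        using v(2) v1 by argo
      then have "d' \<otimes>\<^bsub>F\<^esub> k r v = \<zero>\<^bsub>F\<^esub>"
        using v(1) d r(1) by (simp add: e k_closed)
      then have "v = \<zero>\<^bsub>A\<^esub>" by (subst v1) simp
      then show ?thesis using ab by (simp add: v_def)
    qed
  qed
qed

text \<open>The kernel is maximal because \<open>F\<close> is a field: an ideal above it with an
  element at which \<open>\<epsilon>\<close> is nonzero contains, after scaling, some
  \<open>b\<close> with \<open>\<epsilon> b = 1\<close>. As \<open>b - 1\<close> lies in the kernel,
  the ideal contains \<open>1\<close>.\<close>

lemma augmented_algebraI:
  fixes F :: "('f, 'm) ring_scheme" and A :: "('f, 'a, 'n) module_scheme"
  assumes "algebra F A" "field F" and hom: "\<epsilon> \<in> ring_hom A F"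
    and smult: "\<And>c a. \<lbrakk>c \<in> carrier F; a \<in> carrier A\<rbrakk> \<Longrightarrow> \<epsilon> (c \<odot>\<^bsub>A\<^esub> a) = c \<otimes>\<^bsub>F\<^esub> \<epsilon> a"
  shows "augmented_algebra F A \<epsilon>"
proof -
  have K: "a \<in> a_kernel A F \<epsilon> \<longleftrightarrow> a \<in> carrier A \<and> \<epsilon> a = \<zero>\<^bsub>F\<^esub>" for a
    by (auto simp: a_kernel_def')
  interpret algebra F A by fact
  interpret F: field F by fact
  interpret h: ring_hom_ring A F \<epsilon>
    by (rule ring_hom_ringI2[OF cring.axioms(1)[OF M_cring] cring.axioms(1)[OF R_cring] hom])
  have "maximalideal (a_kernel A F \<epsilon>) A"
  proof (rule maximalidealI[OF h.kernel_is_ideal])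
    show "carrier A \<noteq> a_kernel A F \<epsilon>"
      using K[of "\<one>\<^bsub>A\<^esub>"] by auto
    fix L assume L: "ideal L A" "a_kernel A F \<epsilon> \<subseteq> L" "L \<subseteq> carrier A"
    interpret L: ideal L A by fact
    show "L = a_kernel A F \<epsilon> \<or> L = carrier A"
    proof (rule disjCI)
      assume "L \<noteq> carrier A"
      have "\<epsilon> a = \<zero>\<^bsub>F\<^esub>" if a: "a \<in> L" for a
      proof (rule ccontr)
        assume nz: "\<epsilon> a \<noteq> \<zero>\<^bsub>F\<^esub>"
        have aA: "a \<in> carrier A" using a by (rule L.Icarr)
        then have U: "\<epsilon> a \<in> Units F" using nz by (simp add: F.field_Units)
        define b where "b = inv\<^bsub>F\<^esub> (\<epsilon> a) \<odot>\<^bsub>A\<^esub> a"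
        have b: "b = (inv\<^bsub>F\<^esub> (\<epsilon> a) \<odot>\<^bsub>A\<^esub> \<one>\<^bsub>A\<^esub>) \<otimes>\<^bsub>A\<^esub> a"
          using U aA by (simp add: b_def smult_assoc2)
        have bL: "b \<in> L" using U a unfolding b by (intro L.I_l_closed) auto
        have "\<epsilon> b = \<one>\<^bsub>F\<^esub>" using U aA by (simp add: b_def smult)
        then have "b \<ominus>\<^bsub>A\<^esub> \<one>\<^bsub>A\<^esub> \<in> L"
          using L(2) K L.Icarr[OF bL] by (auto simp: a_minus_def R.r_neg)
        then have "b \<ominus>\<^bsub>A\<^esub> (b \<ominus>\<^bsub>A\<^esub> \<one>\<^bsub>A\<^esub>) \<in> L"
          using bL by (simp add: a_minus_def)
        moreover have "b \<ominus>\<^bsub>A\<^esub> (b \<ominus>\<^bsub>A\<^esub> \<one>\<^bsub>A\<^esub>) = \<one>\<^bsub>A\<^esub>"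
          using L.Icarr[OF bL] by (simp add: a_minus_def M.minus_add M.a_assoc[symmetric] M.r_neg)
        ultimately show False using L.one_imp_carrier \<open>L \<noteq> carrier A\<close> by simp
      qed
      then show "L = a_kernel A F \<epsilon>" using L(2,3) K by auto
    qed
  qed
  then show ?thesis
    using assms by (intro augmented_algebra.intro augmented_algebra_axioms.intro) auto
qed

text \<open>A prime ideal contains the square-zero kernel of the augmentation, which is maximal.\<close>
lemma (in augmented_algebra) infinitesimal_local_ring:
  assumes null: "\<And>a b. \<lbrakk>a \<in> a_kernel A F \<epsilon>; b \<in> a_kernel A F \<epsilon>\<rbrakk> \<Longrightarrow> a \<otimes> b = \<zero>"
  shows "local_ring A"
  unfolding local_ring_def
proof (intro conjI ex1I[of _ "a_kernel A F \<epsilon>"])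
  show "cring A" by (rule M_cring)
  show "maximalideal (a_kernel A F \<epsilon>) A" by (rule aug_maximal)
  fix L assume L: "maximalideal L A"
  interpret L: maximalideal L A by fact
  interpret P: primeideal L A by (rule maximalideal_prime[OF L])
  have "a_kernel A F \<epsilon> \<subseteq> L"
  proof
    fix a assume a: "a \<in> a_kernel A F \<epsilon>"
    then have "a \<in> carrier A" by (simp add: kernel_iff)
    then show "a \<in> L" using P.I_prime[of a a] null[OF a a] by auto
  qed
  then show "L = a_kernel A F \<epsilon>"
    using maximalideal.I_maximal[OF aug_maximal L.is_ideal] L.Icarr L.I_notcarr by blast
qed

section \<open>The deformation with base \<open>F \<oplus> H'\<close>\<close>

lemma null_extension_simps:
  "carrier (null_extension F V) = carrier F \<times> carrier V"
  "\<one>\<^bsub>null_extension F V\<^esub> = (\<one>\<^bsub>F\<^esub>, \<zero>\<^bsub>V\<^esub>)"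
  "\<zero>\<^bsub>null_extension F V\<^esub> = (\<zero>\<^bsub>F\<^esub>, \<zero>\<^bsub>V\<^esub>)"
  "p \<otimes>\<^bsub>null_extension F V\<^esub> q
    = (fst p \<otimes>\<^bsub>F\<^esub> fst q, fst p \<odot>\<^bsub>V\<^esub> snd q \<oplus>\<^bsub>V\<^esub> fst q \<odot>\<^bsub>V\<^esub> snd p)"
  "p \<oplus>\<^bsub>null_extension F V\<^esub> q = (fst p \<oplus>\<^bsub>F\<^esub> fst q, snd p \<oplus>\<^bsub>V\<^esub> snd q)"
  "c \<odot>\<^bsub>null_extension F V\<^esub> p = (c \<otimes>\<^bsub>F\<^esub> fst p, c \<odot>\<^bsub>V\<^esub> snd p)"
  by (simp_all add: null_extension_def case_prod_beta)

lemma null_extension_algebra: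
  assumes "module F V"
  shows "algebra F (null_extension F V)"
proof -
  interpret module F V by fact
  note [simp] = null_extension_simps
  have mod: "module F (null_extension F V)"
    by (rule module_axiomsI)
      (auto simp: R.is_cring R.a_ac R.m_assoc M.a_ac smult_assoc1 smult_l_distr smult_r_distr
        R.l_distr R.r_distr)
  interpret N: module F "null_extension F V" by (rule mod)
  have "cring (null_extension F V)"
  proof (rule cringI)
    show "abelian_group (null_extension F V)" by (rule N.abelian_group_axioms)
    show "comm_monoid (null_extension F V)"
      by (rule comm_monoidI)
        (auto simp: R.m_ac M.a_ac smult_assoc1[symmetric] smult_r_distr)
  qed (auto simp: R.l_distr M.a_ac smult_l_distr smult_r_distr)
  then show ?thesis
    by (intro algebra.intro mod algebra_axioms.intro)
      (auto simp: R.m_ac smult_assoc1[symmetric] smult_r_distr)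
qed

lemma null_extension_augmented:
  assumes "module F V" "field F"
  shows "augmented_algebra F (null_extension F V) fst"
  by (rule augmented_algebraI[OF null_extension_algebra[OF assms(1)] assms(2)])
    (auto simp: null_extension_simps ring_hom_def)

lemma null_extension_null:
  assumes "module F V" "p \<in> a_kernel (null_extension F V) F fst" "q \<in> a_kernel (null_extension F V) F fst"
  shows "p \<otimes>\<^bsub>null_extension F V\<^esub> q = \<zero>\<^bsub>null_extension F V\<^esub>"
proof -
  interpret module F V by fact
  show ?thesis using assms(2,3) by (auto simp: a_kernel_def' null_extension_simps)
qed

lemma dual_module: "module F V \<Longrightarrow> module F (dual_module F V)"
  unfolding dual_module_def by (rule hom_module) (simp_all add: module.axioms(1) regular_module)

lemma dual_module_simps:
  "carrier (dual_module F V) = module_hom F V (regular_module F) \<inter> extensional (carrier V)"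
  "\<zero>\<^bsub>dual_module F V\<^esub> = (\<lambda>v\<in>carrier V. \<zero>\<^bsub>F\<^esub>)"
  "\<xi> \<oplus>\<^bsub>dual_module F V\<^esub> \<zeta> = (\<lambda>v\<in>carrier V. \<xi> v \<oplus>\<^bsub>F\<^esub> \<zeta> v)"
  "c \<odot>\<^bsub>dual_module F V\<^esub> \<xi> = (\<lambda>v\<in>carrier V. c \<otimes>\<^bsub>F\<^esub> \<xi> v)"
  by (simp_all add: dual_module_def hom_module_simps)

lemma hom_eq_on_generators:
  assumes V: "module F V" and W: "module F W"
    and f: "f \<in> module_hom F V W" and g: "g \<in> module_hom F V W"
    and S: "S \<subseteq> carrier V" "\<And>s. s \<in> S \<Longrightarrow> f s = g s"
    and k: "\<And>s. s \<in> S \<Longrightarrow> k s \<in> carrier F" "v = (\<Oplus>\<^bsub>V\<^esub>s\<in>S. k s \<odot>\<^bsub>V\<^esub> s)"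
  shows "f v = g v"
proof -
  interpret V: module F V by fact
  interpret W: module F W by fact
  have fin: "(\<lambda>s. k s \<odot>\<^bsub>V\<^esub> s) \<in> S \<rightarrow> carrier V" using S(1) k(1) by auto
  have "(\<Oplus>\<^bsub>W\<^esub>s\<in>S. f (k s \<odot>\<^bsub>V\<^esub> s)) = (\<Oplus>\<^bsub>W\<^esub>s\<in>S. g (k s \<odot>\<^bsub>V\<^esub> s))"
    using S k(1) module_hom_in[OF g]
    by (intro W.M.finsum_cong') (auto simp: module_hom_smult[OF f] module_hom_smult[OF g] subset_iff)
  then show ?thesis
    unfolding k(2) module_hom_finsum[OF V W f fin] module_hom_finsum[OF V W g fin] .
qed

lemma (in coordinatized_base) tensor_aug_jj_hom:
  assumes "\<And>i. i \<in> I \<Longrightarrow> \<psi> i \<in> carrier (cochains2 F J)"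
    and "\<And>s s'. \<lbrakk>s \<in> carrier T; s' \<in> carrier T\<rbrakk> \<Longrightarrow> l s s' = standard_product \<psi> s s'"
  shows "tensor_aug F J A \<epsilon> \<in> jj_hom F (T\<lparr>mult := l\<rparr>) J"
  using aug_hom
  by (simp add: jj_hom_def tensor_aug_eq module_hom_def assms(2) aug_standard_product[OF assms(1)])

section \<open>Coordinates on the base \<open>E = F + H'\<close>, and the product \<open>eta\<close>
  in terms of them\<close>

locale universal_setup = field F + jacobi_jordan_algebra F J
  for F :: "('f, 'm) ring_scheme" and J :: "('f, 'j) module" +
  fixes \<mu> :: "('j \<Rightarrow> 'j \<Rightarrow> 'j) set \<Rightarrow> 'j \<Rightarrow> 'j \<Rightarrow> 'j"
  assumes fin_dim: "vectorspace.fin_dim F (H2 F J)"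
    and mu_hom: "\<mu> \<in> module_hom F (H2 F J) (Z2 F J)"
    and mu_in: "\<alpha> \<in> carrier (H2 F J) \<Longrightarrow> \<mu> \<alpha> \<in> \<alpha>"
begin

abbreviation "H \<equiv> H2 F J"
abbreviation "E \<equiv> eta_base F J"

sublocale H: vectorspace F H
  by (intro vectorspace.intro H2_module field_axioms)

lemma E_algebra: "algebra F E"
  unfolding eta_base_def by (rule null_extension_algebra[OF dual_module[OF H2_module]])

lemma E_augmented: "augmented_algebra F E fst"
  unfolding eta_base_def by (rule null_extension_augmented[OF dual_module[OF H2_module] field_axioms])

lemma E_null: "\<lbrakk>p \<in> a_kernel E F fst; q \<in> a_kernel E F fst\<rbrakk> \<Longrightarrow> p \<otimes>\<^bsub>E\<^esub> q = \<zero>\<^bsub>E\<^esub>"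
  unfolding eta_base_def by (rule null_extension_null[OF dual_module[OF H2_module]])

lemmas E_simps = null_extension_simps[of F "dual_module F H", folded eta_base_def]

lemma E_evaluation_hom:
  assumes "\<alpha> \<in> carrier H"
  shows "(\<lambda>p. snd p \<alpha>) \<in> module_hom F E (regular_module F)"
  using assms
  by (intro module_homI)
    (auto simp: E_simps dual_module_simps dest: module_hom_in[where x = \<alpha>])

end

text \<open>A basis \<open>S\<close> of the cohomology with its coefficient functionals
  \<open>k\<close>: an auxiliary choice that the final statement does not mention.\<close>

locale universal_coordinates = universal_setup F J \<mu>
  for F :: "('f, 'm) ring_scheme" and J :: "('f, 'j) module" and \<mu> +
  fixes S :: "('j \<Rightarrow> 'j \<Rightarrow> 'j) set set" and k :: "('j \<Rightarrow> 'j \<Rightarrow> 'j) set \<Rightarrow> ('j \<Rightarrow> 'j \<Rightarrow> 'j) set \<Rightarrow> 'f"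
  assumes finite_S: "finite S" and S_subset: "S \<subseteq> carrier (H2 F J)"
    and k_hom: "s \<in> S \<Longrightarrow> k s \<in> module_hom F (H2 F J) (regular_module F)"
    and k_delta: "\<lbrakk>s \<in> S; s' \<in> S\<rbrakk> \<Longrightarrow> k s s' = (if s = s' then \<one>\<^bsub>F\<^esub> else \<zero>\<^bsub>F\<^esub>)"
    and k_sum: "\<alpha> \<in> carrier (H2 F J)
      \<Longrightarrow> \<alpha> = (\<Oplus>\<^bsub>H2 F J\<^esub>s\<in>S. k s \<alpha> \<odot>\<^bsub>H2 F J\<^esub> s)"
begin

lemma S_in: "s \<in> S \<Longrightarrow> s \<in> carrier H"
  using S_subset by blast

lemma H_hom_eqI:
  assumes "module F W" "f \<in> module_hom F H W" "g \<in> module_hom F H W"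
    and "\<And>s. s \<in> S \<Longrightarrow> f s = g s" "\<alpha> \<in> carrier H"
  shows "f \<alpha> = g \<alpha>"
  by (rule hom_eq_on_generators[OF H2_module assms(1-3) S_subset assms(4)])
    (use k_sum[OF assms(5)] module_hom_in[OF k_hom assms(5)] in simp_all)

text \<open>The vector of the dual basis belonging to \<open>s\<close>, placed in the ideal
  \<open>H'\<close> of \<open>E\<close>; \<open>k s\<close> is restricted because elements of the
  dual module are extensional.\<close>

definition dual_vector :: "('j \<Rightarrow> 'j \<Rightarrow> 'j) set \<Rightarrow> 'f \<times> (('j \<Rightarrow> 'j \<Rightarrow> 'j) set \<Rightarrow> 'f)" where
  "dual_vector s = (\<zero>\<^bsub>F\<^esub>, \<lambda>\<alpha>\<in>carrier H. k s \<alpha>)"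

lemma dual_vector_closed: "s \<in> S \<Longrightarrow> dual_vector s \<in> carrier E"
  using restrict_in_hom_module[OF H2_module k_hom]
  by (simp add: dual_vector_def E_simps dual_module_def)

text \<open>The functionals dual to the \<open>dual_vector s\<close> are the evaluations at the
  classes in \<open>S\<close>. Together with \<open>fst\<close> they separate points because a
  functional on \<open>H\<close> is fixed by its values on \<open>S\<close>.\<close>

sublocale eta: coordinatized_base F E J fst S "\<lambda>s p. snd p s" dual_vector
proof -
  interpret E: augmented_algebra F E fst by (rule E_augmented)
  show "coordinatized_base F E J fst S (\<lambda>s p. snd p s) dual_vector"
  proof unfold_locales
    show "finite S" by (rule finite_S)
    show "fst \<in> module_hom F E (regular_module F)" by (rule E.aug_hom)
    show "(\<lambda>p. snd p s) \<in> module_hom F E (regular_module F)" if "s \<in> S" for s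
      by (rule E_evaluation_hom[OF S_in[OF that]])
    show "dual_vector s \<in> carrier E" if "s \<in> S" for s by (rule dual_vector_closed[OF that])
    show "fst \<one>\<^bsub>E\<^esub> = \<one>\<^bsub>F\<^esub>" by (simp add: E_simps)
    show one: "snd \<one>\<^bsub>E\<^esub> s = \<zero>\<^bsub>F\<^esub>" if "s \<in> S" for s
      using S_in[OF that] by (simp add: E_simps dual_module_simps)
    show "fst (dual_vector s) = \<zero>\<^bsub>F\<^esub>" if "s \<in> S" for s by (simp add: dual_vector_def)
    show "snd (dual_vector s') s = (if s = s' then \<one>\<^bsub>F\<^esub> else \<zero>\<^bsub>F\<^esub>)" if "s \<in> S" "s' \<in> S" for s s'
      using that k_delta[of s' s] S_in by (auto simp: dual_vector_def)
    show "fst (p \<otimes>\<^bsub>E\<^esub> q) = fst p \<otimes>\<^bsub>F\<^esub> fst q" for p q by (simp add: E_simps)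
    show "snd (p \<otimes>\<^bsub>E\<^esub> q) s = fst p \<otimes>\<^bsub>F\<^esub> snd q s \<oplus>\<^bsub>F\<^esub> snd p s \<otimes>\<^bsub>F\<^esub> fst q"
      if "s \<in> S" "p \<in> carrier E" "q \<in> carrier E" for p q s
      by (rule E.infinitesimal_product[OF E_null E_evaluation_hom[OF S_in[OF that(1)]] one[OF that(1)] that(2,3)])
    show "p = q" if pq: "p \<in> carrier E" "q \<in> carrier E" "fst p = fst q"
      "\<And>s. s \<in> S \<Longrightarrow> snd p s = snd q s" for p q
    proof (rule prod_eqI[OF pq(3)])
      have p: "snd p \<in> module_hom F H (regular_module F)" "snd p \<in> extensional (carrier H)"
        and q: "snd q \<in> module_hom F H (regular_module F)" "snd q \<in> extensional (carrier H)"
        using pq(1,2) by (auto simp: E_simps dual_module_simps)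
      show "snd p = snd q"
        by (rule extensionalityI[OF p(2) q(2)])
          (rule H_hom_eqI[OF regular_module[OF is_cring] p(1) q(1) pq(4)])
    qed
  qed
qed

text \<open>For \<open>\<alpha>\<close> in \<open>S\<close> this is \<open>eta.coord\<close>. Other
  classes are allowed because the classes belonging to a push-out need not lie in the basis.\<close>

abbreviation "evaluation \<alpha> \<equiv> eta.contraction (\<lambda>p. snd p \<alpha>)"

lemma evaluation_hom: "\<alpha> \<in> carrier H \<Longrightarrow> evaluation \<alpha> \<in> module_hom F eta.T J"
  by (rule eta.contraction_hom[OF E_evaluation_hom])

lemma Hom_module: "module F (hom_module F H J)"
  by (rule hom_module[OF H2_module module_axioms])

lemma eta_ident_bilinear:
  "bilinear_map F E J (direct_sum J (hom_module F H J))
     (\<lambda>(a, \<xi>) x. (a \<odot>\<^bsub>J\<^esub> x, \<lambda>\<alpha>\<in>carrier H. \<xi> \<alpha> \<odot>\<^bsub>J\<^esub> x))"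
proof -
  have hom: "(\<lambda>\<alpha>\<in>carrier H. \<xi> \<alpha> \<odot>\<^bsub>J\<^esub> x) \<in> carrier (hom_module F H J)"
    if "\<xi> \<in> carrier (dual_module F H)" "x \<in> carrier J" for \<xi> x
  proof (rule restrict_in_hom_module[OF H2_module])
    have \<xi>: "\<xi> \<in> module_hom F H (regular_module F)" using that by (simp add: dual_module_simps)
    show "(\<lambda>\<alpha>. \<xi> \<alpha> \<odot>\<^bsub>J\<^esub> x) \<in> module_hom F H J"
      using that(2) module_hom_in[OF \<xi>] module_hom_add[OF \<xi>] module_hom_smult[OF \<xi>]
      by (intro module_homI) (simp_all add: smult_l_distr smult_assoc1)
  qed
  have in_F: "\<xi> \<alpha> \<in> carrier F" if "\<xi> \<in> carrier (dual_module F H)" "\<alpha> \<in> carrier H" for \<xi> \<alpha>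
    using that module_hom_in[of \<xi> F H "regular_module F"] by (simp add: dual_module_simps)
  show ?thesis
    by (rule bilinear_mapI)
      (auto simp: direct_sum_def E_simps hom in_F hom_module_simps(3,4) dual_module_simps(3,4)
        smult_l_distr smult_r_distr smult_assoc1[symmetric] m_comm intro!: restrict_ext)
qed

text \<open>Linear maps on the tensor product are compared on pure tensors, one component at a time;
  the second component lies in \<open>Hom(H, J)\<close> and so is extensional, which gives equality
  of functions.\<close>

lemma eta_ident_eq:
  assumes s: "s \<in> carrier eta.T"
  shows "eta_ident F J s = (eta.aug s, \<lambda>\<alpha>\<in>carrier H. evaluation \<alpha> s)"
proof -
  let ?P = "direct_sum J (hom_module F H J)"
  have P: "module F ?P" by (rule direct_sum_is_module[OF module_axioms Hom_module])
  have hom: "eta_ident F J \<in> module_hom F eta.T ?P"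
    unfolding eta_ident_def by (rule eta.tensor_lift_hom[OF P eta_ident_bilinear])
  have tensor: "eta_ident F J (eta.t p x) = (fst p \<odot>\<^bsub>J\<^esub> x, \<lambda>\<alpha>\<in>carrier H. snd p \<alpha> \<odot>\<^bsub>J\<^esub> x)"
    if "p \<in> carrier E" "x \<in> carrier J" for p x
    unfolding eta_ident_def using eta.tensor_lift_tensor[OF P eta_ident_bilinear that]
    by (simp add: case_prod_beta)
  have fst_hom: "fst \<in> module_hom F ?P J"
    by (rule module_homI) (auto simp: direct_sum_def)
  have "fst (eta_ident F J s) = eta.aug s"
    by (rule eta.tensor_hom_eqI[OF module_axioms module_hom_compose[OF hom fst_hom] eta.aug_hom _ s])
      (simp add: tensor)
  moreover have "snd (eta_ident F J s) \<alpha> = evaluation \<alpha> s" if \<alpha>: "\<alpha> \<in> carrier H" for \<alpha>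
  proof -
    have ev: "(\<lambda>p. snd p \<alpha>) \<in> module_hom F ?P J"
      using \<alpha> by (intro module_homI)
        (auto simp: direct_sum_def hom_module_simps dest: module_hom_in[where x = \<alpha>])
    show ?thesis
      by (rule eta.tensor_hom_eqI[OF module_axioms module_hom_compose[OF hom ev] evaluation_hom[OF \<alpha>] _ s])
        (simp add: tensor \<alpha> eta.contraction_tensor[OF E_evaluation_hom[OF \<alpha>]])
  qed
  moreover have "snd (eta_ident F J s) \<in> extensional (carrier H)"
    using module_hom_in[OF hom s] by (auto simp: direct_sum_def hom_module_simps)
  ultimately show ?thesis
    by (intro prod_eqI) (auto intro: extensionalityI)
qed

lemma eta_ident_inj: "inj_on (eta_ident F J) (carrier eta.T)"
proof (rule inj_onI)
  fix s s' assume s: "s \<in> carrier eta.T" "s' \<in> carrier eta.T" and eq: "eta_ident F J s = eta_ident F J s'"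
  then have ev: "(\<lambda>\<alpha>\<in>carrier H. evaluation \<alpha> s) = (\<lambda>\<alpha>\<in>carrier H. evaluation \<alpha> s')"
    and aug: "eta.aug s = eta.aug s'" by (simp_all add: eta_ident_eq)
  have "evaluation \<alpha> s = evaluation \<alpha> s'" if "\<alpha> \<in> carrier H" for \<alpha>
    using fun_cong[OF ev, of \<alpha>] that by simp
  then show "s = s'" using s aug by (intro eta.tensor_coord_eqI) (auto simp: S_in)
qed

text \<open>Read off from \<open>eta_ident\<close>, whose second component is an element of
  \<open>Hom(H, J)\<close>.\<close>

lemma evaluation_varies_linearly:
  assumes "s \<in> carrier eta.T"
  shows "(\<lambda>\<alpha>. evaluation \<alpha> s) \<in> module_hom F H J"
proof -
  have "eta_ident F J \<in> module_hom F eta.T (direct_sum J (hom_module F H J))"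
    unfolding eta_ident_def
    by (rule eta.tensor_lift_hom[OF direct_sum_is_module[OF module_axioms Hom_module] eta_ident_bilinear])
  from module_hom_in[OF this assms]
  have "(\<lambda>\<alpha>\<in>carrier H. evaluation \<alpha> s) \<in> module_hom F H J"
    by (simp add: eta_ident_eq[OF assms] direct_sum_def hom_module_simps)
  then show ?thesis by (rule module_hom_cong[OF H2_module]) simp
qed

lemma mu_Z2: "\<alpha> \<in> carrier H \<Longrightarrow> \<mu> \<alpha> \<in> carrier (Z2 F J)"
  by (rule module_hom_in[OF mu_hom])

lemma mu_cochain: "\<alpha> \<in> carrier H \<Longrightarrow> \<mu> \<alpha> \<in> carrier (cochains2 F J)"
  using mu_Z2 by (simp add: Z2_carrier)

lemma mu_varies_linearly:
  assumes "x \<in> carrier J" "y \<in> carrier J"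
  shows "(\<lambda>\<alpha>. \<mu> \<alpha> x y) \<in> module_hom F H J"
  using assms cochains2_simps(1)[OF mu_cochain]
  by (intro module_homI)
    (simp_all add: module_hom_add[OF mu_hom] module_hom_smult[OF mu_hom] Z2_ops cochains2_ops)

text \<open>For \<open>\<alpha>\<close> in \<open>S\<close> this is the coordinate formula of the
  standard product. Both sides are linear in \<open>\<alpha>\<close>, the right one because
  \<open>\<mu>\<close> is linear, so it extends to all classes.\<close>

lemma evaluation_standard_product:
  assumes \<alpha>: "\<alpha> \<in> carrier H" and s: "s \<in> carrier eta.T" "s' \<in> carrier eta.T"
  shows "evaluation \<alpha> (eta.standard_product \<mu> s s') = \<mu> \<alpha> (eta.aug s) (eta.aug s')
    \<oplus>\<^bsub>J\<^esub> (eta.aug s \<otimes>\<^bsub>J\<^esub> evaluation \<alpha> s' \<oplus>\<^bsub>J\<^esub> eta.aug s' \<otimes>\<^bsub>J\<^esub> evaluation \<alpha> s)"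
proof -
  note \<mu>S = mu_cochain[OF S_in]
  have mult: "(\<lambda>y. x \<otimes>\<^bsub>J\<^esub> y) \<in> module_hom F J J" if "x \<in> carrier J" for x
    using that by (intro module_homI) (simp_all add: jj_closed jj_add_right jj_smult_right)
  note aug = eta.aug_simps(1)[OF s(1)] eta.aug_simps(1)[OF s(2)]
  show ?thesis
    by (rule H_hom_eqI[OF module_axioms
        evaluation_varies_linearly[OF eta.standard_product_closed[OF \<mu>S s]]
        module_hom_add_maps[OF module_axioms mu_varies_linearly[OF aug]
          module_hom_add_maps[OF module_axioms
            module_hom_compose[OF evaluation_varies_linearly[OF s(2)] mult[OF aug(1)]]
            module_hom_compose[OF evaluation_varies_linearly[OF s(1)] mult[OF aug(2)]]]] _ \<alpha>])
      (simp_all add: eta.coord_standard_product[OF \<mu>S _ s])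
qed

text \<open>\<open>eta\<close> pulls \<open>eta_prod\<close> back along \<open>eta_ident\<close>.
  The standard product is a preimage of the required value, and injectivity of
  \<open>eta_ident\<close> makes it the one that \<open>inv_into\<close> returns.\<close>

lemma eta_eq:
  assumes s: "s \<in> carrier eta.T" "s' \<in> carrier eta.T"
  shows "eta F J \<mu> s s' = eta.standard_product \<mu> s s'"
proof -
  note \<mu>S = mu_cochain[OF S_in]
  have closed: "eta.standard_product \<mu> s s' \<in> carrier eta.T"
    by (rule eta.standard_product_closed[OF \<mu>S s])
  have "eta_prod F J \<mu> (eta_ident F J s) (eta_ident F J s') = eta_ident F J (eta.standard_product \<mu> s s')"
  proof -
    have "\<mu> \<alpha> (eta.aug s) (eta.aug s') \<oplus>\<^bsub>J\<^esub> eta.aug s \<otimes>\<^bsub>J\<^esub> evaluation \<alpha> s' \<oplus>\<^bsub>J\<^esub> eta.aug s' \<otimes>\<^bsub>J\<^esub> evaluation \<alpha> s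
        = evaluation \<alpha> (eta.standard_product \<mu> s s')" if \<alpha>: "\<alpha> \<in> carrier H" for \<alpha>
      using s module_hom_in[OF evaluation_hom[OF \<alpha>]] cochains2_simps(1)[OF mu_cochain[OF \<alpha>]]
      by (simp add: evaluation_standard_product[OF \<alpha> s] jj_closed M.a_assoc)
    then show ?thesis
      unfolding eta_ident_eq[OF s(1)] eta_ident_eq[OF s(2)] eta_ident_eq[OF closed] eta_prod_def
      by (simp add: eta.aug_standard_product[OF \<mu>S s] cong: restrict_cong)
  qed
  then show ?thesis
    unfolding eta_def using inv_into_f_f[OF eta_ident_inj closed] by simp
qed

lemma eta_infinitesimal: "infinitesimal_deformation F J E fst (eta F J \<mu>)"
  unfolding infinitesimal_deformation_def deformation_def
proof (intro conjI ballI)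
  interpret E: augmented_algebra F E fst by (rule E_augmented)
  show "augmented_algebra F E fst" by (rule E_augmented)
  show "local_ring E" by (rule E.infinitesimal_local_ring[OF E_null])
  show "p \<otimes>\<^bsub>E\<^esub> q = \<zero>\<^bsub>E\<^esub>" if "p \<in> a_kernel E F fst" "q \<in> a_kernel E F fst" for p q
    using that by (rule E_null)
  show "jacobi_jordan_algebra E (tensor_algebra F E J (eta F J \<mu>))"
    by (rule eta.standard_product_jacobi_jordan[OF mu_Z2[OF S_in] eta_eq])
  show "tensor_aug F J E fst \<in> jj_hom F (tensor_space F E J\<lparr>mult := eta F J \<mu>\<rparr>) J"
    by (rule eta.tensor_aug_jj_hom[OF mu_cochain[OF S_in] eta_eq])
qed

end

context coordinatized_base
begin

lemma base_hom_eqI: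
  assumes W: "module F W" and f: "f \<in> module_hom F A W" and g: "g \<in> module_hom F A W"
    and one: "f \<one>\<^bsub>A\<^esub> = g \<one>\<^bsub>A\<^esub>" and m: "\<And>i. i \<in> I \<Longrightarrow> f (m i) = g (m i)"
    and a: "a \<in> carrier A"
  shows "f a = g a"
proof -
  interpret W: module F W by fact
  have s: "(\<lambda>i. u i a \<odot>\<^bsub>A\<^esub> m i) \<in> I \<rightarrow> carrier A" using a by simp
  have "(\<Oplus>\<^bsub>W\<^esub>i\<in>I. f (u i a \<odot>\<^bsub>A\<^esub> m i)) = (\<Oplus>\<^bsub>W\<^esub>i\<in>I. g (u i a \<odot>\<^bsub>A\<^esub> m i))"
    using a module_hom_in[OF g]
    by (intro W.M.finsum_cong') (auto simp: module_hom_smult[OF f] module_hom_smult[OF g] m)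
  then have "f (\<epsilon> a \<odot>\<^bsub>A\<^esub> \<one>\<^bsub>A\<^esub> \<oplus>\<^bsub>A\<^esub> (\<Oplus>\<^bsub>A\<^esub>i\<in>I. u i a \<odot>\<^bsub>A\<^esub> m i))
      = g (\<epsilon> a \<odot>\<^bsub>A\<^esub> \<one>\<^bsub>A\<^esub> \<oplus>\<^bsub>A\<^esub> (\<Oplus>\<^bsub>A\<^esub>i\<in>I. u i a \<odot>\<^bsub>A\<^esub> m i))"
    using a s module_hom_finsum[OF A.module_axioms W f s] module_hom_finsum[OF A.module_axioms W g s]
    by (simp add: module_hom_add[OF f] module_hom_add[OF g] module_hom_smult[OF f]
        module_hom_smult[OF g] one)
  then show ?thesis using base_expansion[OF a] by simp
qed

end

section \<open>Push-outs and universality\<close>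

text \<open>\<open>\<beta>\<close> inherits bilinearity from the known linear map \<open>h\<close>,
  so a lift can be computed at once. Applied twice, this evaluates the nested lifts in
  \<open>pushout\<close>.\<close>

lemma (in tensor_product) tensor_lift_eq_hom:
  assumes M: "module F M" and h: "h \<in> module_hom F T M"
    and \<beta>: "\<And>a x. \<lbrakk>a \<in> carrier A; x \<in> carrier J\<rbrakk> \<Longrightarrow> \<beta> a x = h (t a x)"
    and s: "s \<in> carrier T"
  shows "tensor_lift F A J M \<beta> s = h s"
proof -
  have bil: "bilinear_map F A J M \<beta>"
    by (rule bilinear_mapI)
      (simp_all add: \<beta> module_hom_in[OF h] module_hom_add[OF h] module_hom_smult[OF h]
        tensor_add_left tensor_add_right tensor_smult_left tensor_smult_right)
  show ?thesis
    by (rule tensor_hom_eqI[OF M tensor_lift_hom[OF M bil] h _ s])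
      (simp add: tensor_lift_tensor[OF M bil] \<beta>)
qed

locale pushout_setup = universal_coordinates F J \<mu> S k + B: coordinatized_base F B J \<epsilon> I u m
  for F :: "('f, 'm) ring_scheme" and J :: "('f, 'j) module" and \<mu> S k
    and B :: "('f, 'b, 'n) module_scheme" and \<epsilon> and I :: "'i set" and u m
begin

text \<open>\<open>\<alpha> i\<close> is the functional \<open>u i \<circ> \<phi>\<close> on \<open>H'\<close> under the identification \<open>H'' = H\<close>.\<close>
abbreviation represents ::
  "('f \<times> (('j \<Rightarrow> 'j \<Rightarrow> 'j) set \<Rightarrow> 'f) \<Rightarrow> 'b) \<Rightarrow> ('i \<Rightarrow> ('j \<Rightarrow> 'j \<Rightarrow> 'j) set) \<Rightarrow> bool" where
  "represents \<phi> \<alpha> \<equiv> \<alpha> \<in> I \<rightarrow> carrier H \<and> (\<forall>i\<in>I. \<forall>p\<in>carrier E. u i (\<phi> p) = snd p (\<alpha> i))"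

lemma E_one_evaluation: "\<alpha> \<in> carrier H \<Longrightarrow> snd \<one>\<^bsub>E\<^esub> \<alpha> = \<zero>\<^bsub>F\<^esub>"
  by (simp add: E_simps(2) dual_module_simps)

lemma k_combination:
  assumes "\<And>s. s \<in> S \<Longrightarrow> c s \<in> carrier F" "s \<in> S"
  shows "k s (\<Oplus>\<^bsub>H\<^esub>s'\<in>S. c s' \<odot>\<^bsub>H\<^esub> s') = c s"
proof -
  interpret RF: module F "regular_module F" by (rule eta.regular_F)
  have "k s (\<Oplus>\<^bsub>H\<^esub>s'\<in>S. c s' \<odot>\<^bsub>H\<^esub> s') = (\<Oplus>\<^bsub>regular_module F\<^esub>s'\<in>S. k s (c s' \<odot>\<^bsub>H\<^esub> s'))"
    using assms S_in by (intro module_hom_finsum[OF H2_module eta.regular_F k_hom]) auto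
  also have "\<dots> = (\<Oplus>\<^bsub>regular_module F\<^esub>s'\<in>S.
      (if s = s' then \<one>\<^bsub>F\<^esub> else \<zero>\<^bsub>F\<^esub>) \<odot>\<^bsub>regular_module F\<^esub> c s')"
    using assms S_in by (intro RF.M.finsum_cong') (auto simp: module_hom_smult[OF k_hom] k_delta)
  also have "\<dots> = c s"
    using assms by (intro eta.finsum_delta[OF eta.regular_F]) auto
  finally show ?thesis .
qed

text \<open>This is the identification \<open>H'' = H\<close> for finite-dimensional
  \<open>H\<close>, applied to each functional \<open>u i \<circ> \<phi>\<close>.\<close>

lemma base_hom_represents:
  assumes \<phi>: "\<phi> \<in> base_homs F E fst B \<epsilon>"
  obtains \<alpha> where "represents \<phi> \<alpha>"
proof -
  have \<phi>_hom: "\<phi> \<in> module_hom F E B" and \<phi>_one: "\<phi> \<one>\<^bsub>E\<^esub> = \<one>\<^bsub>B\<^esub>"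
    using \<phi> by (auto simp: base_homs_def ring_hom_def)
  \<comment> \<open>The coefficient of this class at \<open>s\<close> is the value of
    \<open>u i \<circ> \<phi>\<close> at the dual basis vector of \<open>s\<close>. Agreement with
    evaluation at the class is then checked at \<open>1\<close> and at the dual basis.\<close>
  define \<alpha> where "\<alpha> i = (\<Oplus>\<^bsub>H\<^esub>s\<in>S. u i (\<phi> (dual_vector s)) \<odot>\<^bsub>H\<^esub> s)" for i
  have c: "u i (\<phi> (dual_vector s)) \<in> carrier F" if "i \<in> I" "s \<in> S" for i s
    using that module_hom_in[OF \<phi>_hom dual_vector_closed] by simp
  have \<alpha>: "\<alpha> i \<in> carrier H" if "i \<in> I" for i
    using c[OF that] S_in unfolding \<alpha>_def by (intro H.M.finsum_closed) auto
  have "u i (\<phi> p) = snd p (\<alpha> i)" if i: "i \<in> I" and p: "p \<in> carrier E" for i p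
  proof (rule eta.base_hom_eqI[OF eta.regular_F module_hom_compose[OF \<phi>_hom B.u_hom[OF i]]
        E_evaluation_hom[OF \<alpha>[OF i]] _ _ p])
    show "u i (\<phi> \<one>\<^bsub>E\<^esub>) = snd \<one>\<^bsub>E\<^esub> (\<alpha> i)"
      using i \<alpha>[OF i] by (simp add: \<phi>_one E_one_evaluation)
    show "u i (\<phi> (dual_vector s)) = snd (dual_vector s) (\<alpha> i)" if "s \<in> S" for s
    proof -
      have "snd (dual_vector s) (\<alpha> i) = k s (\<alpha> i)"
        using \<alpha>[OF i] by (simp add: dual_vector_def)
      also have "\<dots> = u i (\<phi> (dual_vector s))"
        unfolding \<alpha>_def by (rule k_combination[OF c[OF i] that])
      finally show ?thesis ..
    qed
  qed
  then show thesis using that \<alpha> by blast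
qed

text \<open>Coordinate \<open>i\<close> of \<open>\<phi> \<otimes> id\<close> is evaluation at
  \<open>\<alpha> i\<close>, which sends the \<open>\<eta>\<close>-product of
  \<open>1 \<otimes> x\<close> and \<open>1 \<otimes> y\<close> to
  \<open>\<mu> (\<alpha> i) x y\<close>; bilinearity over \<open>B\<close> extends this to all
  tensors.\<close>

lemma pushout_eq_standard_product:
  assumes \<phi>: "\<phi> \<in> base_homs F E fst B \<epsilon>" and rep: "represents \<phi> \<alpha>"
    and s: "s \<in> carrier B.T" "s' \<in> carrier B.T"
  shows "pushout F J E B \<phi> (eta F J \<mu>) s s' = B.standard_product (\<lambda>i. \<mu> (\<alpha> i)) s s'"
proof -
  have \<phi>_hom: "\<phi> \<in> module_hom F E B" and \<phi>_eps: "\<And>p. p \<in> carrier E \<Longrightarrow> \<epsilon> (\<phi> p) = fst p"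
    using \<phi> by (auto simp: base_homs_def)
  have \<alpha>: "\<alpha> i \<in> carrier H" and u_\<phi>: "\<And>p. p \<in> carrier E \<Longrightarrow> u i (\<phi> p) = snd p (\<alpha> i)" if "i \<in> I" for i
    using rep that by auto
  note \<psi> = mu_cochain[OF \<alpha>]
  note \<phi>_simps = module_hom_in[OF \<phi>_hom] module_hom_add[OF \<phi>_hom] module_hom_smult[OF \<phi>_hom]
  have bil: "bilinear_map F E J B.T (\<lambda>a x. B.t (\<phi> a) x)"
    by (rule bilinear_mapI) (simp_all add: \<phi>_simps B.tensor_add_left B.tensor_add_right
        B.tensor_smult_left B.tensor_smult_right)
  let ?f = "tensor_base_map F J E B \<phi>"
  have f_hom: "?f \<in> module_hom F eta.T B.T"
    unfolding tensor_base_map_def by (rule eta.tensor_lift_hom[OF B.T.module_axioms bil])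
  have f_tensor: "?f (eta.t a x) = B.t (\<phi> a) x" if "a \<in> carrier E" "x \<in> carrier J" for a x
    unfolding tensor_base_map_def by (rule eta.tensor_lift_tensor[OF B.T.module_axioms bil that])
  have aug_f: "B.aug (?f r) = eta.aug r" if "r \<in> carrier eta.T" for r
    by (rule eta.tensor_hom_eqI[OF module_axioms module_hom_compose[OF f_hom B.aug_hom] eta.aug_hom _ that])
      (simp add: f_tensor \<phi>_simps(1) \<phi>_eps)
  have coord_f: "B.coord i (?f r) = evaluation (\<alpha> i) r" if i: "i \<in> I" and r: "r \<in> carrier eta.T" for i r
    by (rule eta.tensor_hom_eqI[OF module_axioms module_hom_compose[OF f_hom B.coord_hom[OF i]]
          evaluation_hom[OF \<alpha>[OF i]] _ r])
      (simp add: f_tensor \<phi>_simps(1) i u_\<phi> eta.contraction_tensor[OF E_evaluation_hom[OF \<alpha>]])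
  define P where "P x y = ?f (eta F J \<mu> (eta.t \<one>\<^bsub>E\<^esub> x) (eta.t \<one>\<^bsub>E\<^esub> y))" for x y
  have P: "P x y \<in> carrier B.T" "B.aug (P x y) = x \<otimes>\<^bsub>J\<^esub> y"
    "\<And>i. i \<in> I \<Longrightarrow> B.coord i (P x y) = \<mu> (\<alpha> i) x y" if "x \<in> carrier J" "y \<in> carrier J" for x y
  proof -
    let ?e = "eta F J \<mu> (eta.t \<one>\<^bsub>E\<^esub> x) (eta.t \<one>\<^bsub>E\<^esub> y)"
    have tx: "eta.t \<one>\<^bsub>E\<^esub> x \<in> carrier eta.T" "eta.t \<one>\<^bsub>E\<^esub> y \<in> carrier eta.T" using that by simp_all
    have e: "?e \<in> carrier eta.T" "eta.aug ?e = x \<otimes>\<^bsub>J\<^esub> y"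
      using that tx mu_cochain[OF S_in]
      by (simp_all add: eta_eq eta.standard_product_closed eta.aug_standard_product)
    show "P x y \<in> carrier B.T" "B.aug (P x y) = x \<otimes>\<^bsub>J\<^esub> y"
      using module_hom_in[OF f_hom e(1)] aug_f[OF e(1)] e(2) by (simp_all add: P_def)
    fix i assume i: "i \<in> I"
    \<comment> \<open>The unit of \<open>E\<close> has no component in \<open>H'\<close>, so only
      the term with \<open>\<mu>\<close> remains in the product formula.\<close>
    have "evaluation (\<alpha> i) (eta.t \<one>\<^bsub>E\<^esub> z) = \<zero>\<^bsub>J\<^esub>" if "z \<in> carrier J" for z
      using that \<alpha>[OF i]
      by (simp add: eta.contraction_tensor[OF E_evaluation_hom[OF \<alpha>[OF i]]] E_one_evaluation)
    then show "B.coord i (P x y) = \<mu> (\<alpha> i) x y"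
      using coord_f[OF i e(1)] evaluation_standard_product[OF \<alpha>[OF i] tx] that
        cochains2_simps(1)[OF \<psi>[OF i] that]
      by (simp add: P_def eta_eq[OF tx])
  qed
  let ?l = "B.standard_product (\<lambda>i. \<mu> (\<alpha> i))"
  have bil_l: "bilinear_map F B.T B.T B.T ?l" by (rule B.standard_product_bilinear[OF \<psi>])
  \<comment> \<open>\<open>u_mult\<close> applied to the product of \<open>b\<close> and
    \<open>c\<close> yields the two cross terms of the standard product.\<close>
  have pure: "tensor_smult F B J (b \<otimes>\<^bsub>B\<^esub> c) (P x y) = ?l (B.t b x) (B.t c y)"
    if bc: "b \<in> carrier B" "c \<in> carrier B" "x \<in> carrier J" "y \<in> carrier J" for b c x y
    by (rule B.tensor_coord_eqI)
      (use bc in \<open>simp_all add: P B.standard_product_closed[OF \<psi>] B.aug_standard_product[OF \<psi>]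
        B.coord_standard_product[OF \<psi>] cochains2_simps[OF \<psi>] B.eps_mult B.u_mult jj_closed
        jj_smult_left jj_smult_right jj_comm[of y x] smult_assoc1[symmetric] smult_l_distr M.a_ac m_ac\<close>)
  have inner: "tensor_lift F B J B.T (\<lambda>c y. tensor_smult F B J (b \<otimes>\<^bsub>B\<^esub> c) (P x y)) s'
      = ?l (B.t b x) s'" if "b \<in> carrier B" "x \<in> carrier J" for b x
    using that pure
    by (intro B.tensor_lift_eq_hom[OF B.T.module_axioms bilinear_mapD(2)[OF bil_l] _ s(2)]) simp_all
  have "pushout F J E B \<phi> (eta F J \<mu>) s s' = tensor_lift F B J B.T (\<lambda>b x.
      tensor_lift F B J B.T (\<lambda>c y. tensor_smult F B J (b \<otimes>\<^bsub>B\<^esub> c) (P x y)) s') s"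
    by (simp add: pushout_def P_def)
  also have "\<dots> = ?l s s'"
    by (rule B.tensor_lift_eq_hom[OF B.T.module_axioms bilinear_mapD(1)[OF bil_l s(2)] _ s(1)])
      (rule inner)
  finally show ?thesis .
qed

text \<open>A class is a coset and is generated by any of its members, so \<open>mu_in\<close> says
  that \<open>\<mu>\<close> is a section of the projection onto cohomology.\<close>

lemma mu_class: "\<alpha> \<in> carrier H \<Longrightarrow> B2 F J +>\<^bsub>Z2 F J\<^esub> \<mu> \<alpha> = \<alpha>"
  using quotient_of_mem(2)[OF B2_submodule, folded H2_def, OF _ mu_in] by simp

lemma class_closed: "\<psi> \<in> carrier (Z2 F J) \<Longrightarrow> B2 F J +>\<^bsub>Z2 F J\<^esub> \<psi> \<in> carrier H"
  unfolding H2_def by (simp add: quotient_carrier[OF B2_submodule])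

lemma equivalent_pushout_iff:
  assumes \<psi>: "\<And>i. i \<in> I \<Longrightarrow> \<psi> i \<in> carrier (Z2 F J)"
    and l: "\<And>s s'. \<lbrakk>s \<in> carrier B.T; s' \<in> carrier B.T\<rbrakk> \<Longrightarrow> l s s' = B.standard_product \<psi> s s'"
    and \<phi>: "\<phi> \<in> base_homs F E fst B \<epsilon>" and rep: "represents \<phi> \<alpha>"
  shows "equivalent_deformations F J B \<epsilon> l (pushout F J E B \<phi> (eta F J \<mu>))
    \<longleftrightarrow> (\<forall>i\<in>I. \<alpha> i = B2 F J +>\<^bsub>Z2 F J\<^esub> \<psi> i)" (is "?eq \<longleftrightarrow> ?coh")
proof -
  have \<alpha>: "\<alpha> i \<in> carrier H" if "i \<in> I" for i using rep that by auto
  have \<psi>': "\<psi> i \<in> carrier (cochains2 F J)" if "i \<in> I" for i using \<psi>[OF that] by (simp add: Z2_carrier)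
  note \<mu>' = mu_cochain[OF \<alpha>]
  note po = pushout_eq_standard_product[OF \<phi> rep]
  have coh: "\<alpha> i = B2 F J +>\<^bsub>Z2 F J\<^esub> \<psi> i \<longleftrightarrow> (\<exists>g\<in>module_hom F J J. \<forall>x\<in>carrier J. \<forall>y\<in>carrier J.
      \<mu> (\<alpha> i) x y = \<psi> i x y \<oplus>\<^bsub>J\<^esub> coboundary1 J g x y)" if i: "i \<in> I" for i
    using H2_class_eq_iff[OF mu_Z2[OF \<alpha>[OF i]] \<psi>[OF i]] mu_class[OF \<alpha>[OF i]] by simp
  show ?thesis
  proof
    assume eq: ?eq
    show ?coh
    proof
      fix i assume i: "i \<in> I"
      show "\<alpha> i = B2 F J +>\<^bsub>Z2 F J\<^esub> \<psi> i"
        unfolding coh[OF i] by (rule B.equivalent_imp_cohomologous[OF \<psi>' \<mu>' l po eq i])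
    qed
  next
    assume ?coh
    then have "\<forall>i\<in>I. \<exists>g\<in>module_hom F J J. \<forall>x\<in>carrier J. \<forall>y\<in>carrier J.
        \<mu> (\<alpha> i) x y = \<psi> i x y \<oplus>\<^bsub>J\<^esub> coboundary1 J g x y"
      using coh by blast
    \<comment> \<open>One linear map is chosen for each \<open>i\<close>; the family together
      defines a single isomorphism of deformations.\<close>
    then obtain g where g: "\<forall>i\<in>I. g i \<in> module_hom F J J \<and> (\<forall>x\<in>carrier J. \<forall>y\<in>carrier J.
        \<mu> (\<alpha> i) x y = \<psi> i x y \<oplus>\<^bsub>J\<^esub> coboundary1 J (g i) x y)"
      unfolding Bex_def by (rule bchoice[THEN exE])
    show ?eq
      by (rule B.cohomologous_imp_equivalent[OF \<psi>' \<mu>' l po]) (use g in simp_all)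
  qed
qed

text \<open>The formula is forced by coordinates: \<open>\<epsilon>\<close> of the value must be
  \<open>fst p\<close>, and \<open>u i\<close> of it must be
  \<open>snd p (\<alpha> i)\<close>.\<close>

definition classifying_map ::
  "('i \<Rightarrow> ('j \<Rightarrow> 'j \<Rightarrow> 'j) set) \<Rightarrow> 'f \<times> (('j \<Rightarrow> 'j \<Rightarrow> 'j) set \<Rightarrow> 'f) \<Rightarrow> 'b" where
  "classifying_map \<alpha> = (\<lambda>p\<in>carrier E. fst p \<odot>\<^bsub>B\<^esub> \<one>\<^bsub>B\<^esub> \<oplus>\<^bsub>B\<^esub> (\<Oplus>\<^bsub>B\<^esub>i\<in>I. snd p (\<alpha> i) \<odot>\<^bsub>B\<^esub> m i))"

lemma classifying_map:
  assumes \<alpha>: "\<alpha> \<in> I \<rightarrow> carrier H"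
  shows "classifying_map \<alpha> \<in> base_homs F E fst B \<epsilon>" "represents (classifying_map \<alpha>) \<alpha>"
proof -
  interpret EA: algebra F E by (rule E_algebra)
  let ?\<phi> = "classifying_map \<alpha>"
  have \<alpha>_in: "\<alpha> i \<in> carrier H" if "i \<in> I" for i using \<alpha> that by auto
  note ev = module_hom_in[OF E_evaluation_hom, simplified] module_hom_add[OF E_evaluation_hom, simplified]
    module_hom_smult[OF E_evaluation_hom, simplified]
  have fst_in: "fst p \<in> carrier F" if "p \<in> carrier E" for p using that by (auto simp: E_simps)
  have \<phi>: "?\<phi> p \<in> carrier B" "\<epsilon> (?\<phi> p) = fst p" "\<And>i. i \<in> I \<Longrightarrow> u i (?\<phi> p) = snd p (\<alpha> i)"
    if "p \<in> carrier E" for p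
    using that B.base_combination[OF fst_in[OF that], of "\<lambda>i. snd p (\<alpha> i)"] ev(1)[OF \<alpha>_in that]
    by (simp_all add: classifying_map_def)
  show "represents ?\<phi> \<alpha>" using \<alpha> \<phi> by auto
  have "?\<phi> \<in> module_hom F E B"
    by (rule module_homI; (rule B.coord_eqI)?)
      (simp_all add: \<phi> ev \<alpha>_in E_simps(5,6)[THEN arg_cong[where f = fst], simplified])
  moreover have "?\<phi> \<in> ring_hom E B"
  proof (rule ring_hom_memI)
    fix p q assume pq: "p \<in> carrier E" "q \<in> carrier E"
    \<comment> \<open>At every class \<open>E\<close> obeys the product rule that
      \<open>u_mult\<close> states for \<open>B\<close>, so the two products have equal
      coordinates.\<close>
    have "snd (p \<otimes>\<^bsub>E\<^esub> q) (\<alpha> i) = fst p \<otimes>\<^bsub>F\<^esub> snd q (\<alpha> i) \<oplus>\<^bsub>F\<^esub> snd p (\<alpha> i) \<otimes>\<^bsub>F\<^esub> fst q" if "i \<in> I" for i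
      using pq \<alpha>_in[OF that] ev(1)[OF \<alpha>_in[OF that]] fst_in
      by (simp add: E_simps(4) dual_module_simps m_comm)
    then show "?\<phi> (p \<otimes>\<^bsub>E\<^esub> q) = ?\<phi> p \<otimes>\<^bsub>B\<^esub> ?\<phi> q"
      using pq by (intro B.coord_eqI) (simp_all add: \<phi> B.eps_mult B.u_mult eta.eps_mult)
    show "?\<phi> p \<in> carrier B" by (rule \<phi>(1)[OF pq(1)])
    show "?\<phi> (p \<oplus>\<^bsub>E\<^esub> q) = ?\<phi> p \<oplus>\<^bsub>B\<^esub> ?\<phi> q"
      by (rule module_hom_add[OF \<open>?\<phi> \<in> module_hom F E B\<close> pq])
  next
    show "?\<phi> \<one>\<^bsub>E\<^esub> = \<one>\<^bsub>B\<^esub>"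
      by (rule B.coord_eqI) (simp_all add: \<phi> \<alpha>_in E_one_evaluation)
  qed
  ultimately show "?\<phi> \<in> base_homs F E fst B \<epsilon>"
    using \<phi>(2) by (simp add: base_homs_def classifying_map_def)
qed

lemma universal:
  assumes "infinitesimal_deformation F J B \<epsilon> l"
  shows "\<exists>!\<phi>. \<phi> \<in> base_homs F E fst B \<epsilon> \<and>
    equivalent_deformations F J B \<epsilon> l (pushout F J E B \<phi> (eta F J \<mu>))"
proof -
  have jj: "jacobi_jordan_algebra B (tensor_algebra F B J l)"
    and aug: "tensor_aug F J B \<epsilon> \<in> jj_hom F (B.T\<lparr>mult := l\<rparr>) J"
    using assms by (simp_all add: infinitesimal_deformation_def deformation_def)
  define \<psi> where "\<psi> = B.deformation_cocycle l"
  have \<psi>: "\<psi> i \<in> carrier (Z2 F J)" if "i \<in> I" for i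
    unfolding \<psi>_def by (rule B.deformation_cocycle_cocycle[OF jj aug that])
  have l: "l s s' = B.standard_product \<psi> s s'" if "s \<in> carrier B.T" "s' \<in> carrier B.T" for s s'
    unfolding \<psi>_def by (rule B.l_eq_standard_product[OF jj aug that])
  define \<alpha> where "\<alpha> i = B2 F J +>\<^bsub>Z2 F J\<^esub> \<psi> i" for i
  have \<alpha>: "\<alpha> \<in> I \<rightarrow> carrier H" using \<psi> class_closed by (auto simp: \<alpha>_def)
  have iff: "equivalent_deformations F J B \<epsilon> l (pushout F J E B \<phi> (eta F J \<mu>)) \<longleftrightarrow> (\<forall>i\<in>I. \<beta> i = \<alpha> i)"
    if "\<phi> \<in> base_homs F E fst B \<epsilon>" "represents \<phi> \<beta>" for \<phi> \<beta>
    unfolding \<alpha>_def by (rule equivalent_pushout_iff[OF \<psi> l that])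
  show ?thesis
  proof (rule ex1I[of _ "classifying_map \<alpha>"])
    show "classifying_map \<alpha> \<in> base_homs F E fst B \<epsilon> \<and>
        equivalent_deformations F J B \<epsilon> l (pushout F J E B (classifying_map \<alpha>) (eta F J \<mu>))"
      using classifying_map(1)[OF \<alpha>] iff[OF classifying_map[OF \<alpha>]] by simp
    fix \<phi> assume \<phi>: "\<phi> \<in> base_homs F E fst B \<epsilon> \<and>
        equivalent_deformations F J B \<epsilon> l (pushout F J E B \<phi> (eta F J \<mu>))"
    obtain \<beta> where \<beta>: "represents \<phi> \<beta>"
      by (rule base_hom_represents[OF conjunct1[OF \<phi>]])
    then have eq: "\<beta> i = \<alpha> i" if "i \<in> I" for i
      using iff[of \<phi> \<beta>] \<phi> that by blast
    \<comment> \<open>Equivalence forces the classes that represent \<open>\<phi>\<close> to be the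
      \<open>\<alpha> i\<close>; with the augmentation they give all coordinates of
      \<open>\<phi> p\<close>.\<close>
    have "\<phi> p = classifying_map \<alpha> p" if p: "p \<in> carrier E" for p
    proof (rule B.coord_eqI)
      show "\<phi> p \<in> carrier B" "classifying_map \<alpha> p \<in> carrier B" "\<epsilon> (\<phi> p) = \<epsilon> (classifying_map \<alpha> p)"
        using \<phi> classifying_map(1)[OF \<alpha>] p by (auto simp: base_homs_def dest: module_hom_in)
      show "u i (\<phi> p) = u i (classifying_map \<alpha> p)" if "i \<in> I" for i
        using \<beta> classifying_map(2)[OF \<alpha>] eq[OF that] p that by simp
    qed
    moreover have "\<phi> \<in> extensional (carrier E)" "classifying_map \<alpha> \<in> extensional (carrier E)"
      using \<phi> by (simp_all add: base_homs_def classifying_map_def)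
    ultimately show "\<phi> = classifying_map \<alpha>" by (blast intro: extensionalityI)
  qed
qed

end

theorem theorem5p1:
  fixes F :: "'f ring" and J :: "('f, 'j) module"
    and \<mu> :: "('j \<Rightarrow> 'j \<Rightarrow> 'j) set \<Rightarrow> 'j \<Rightarrow> 'j \<Rightarrow> 'j"
  assumes "algebraically_closed F"
    and "characteristic F \<noteq> 2" and "characteristic F \<noteq> 3"
    and "jacobi_jordan_algebra F J"
    and "vectorspace.fin_dim F (H2 F J)"
    and "\<mu> \<in> module_hom F (H2 F J) (Z2 F J)"
    and "\<And>\<alpha>. \<alpha> \<in> carrier (H2 F J) \<Longrightarrow> \<mu> \<alpha> \<in> \<alpha>"
  shows "infinitesimal_deformation F J (eta_base F J) fst (eta F J \<mu>) \<and>
    (\<forall>(B :: ('f, 'b) module) \<epsilon> l.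
       vectorspace.fin_dim F B \<and> infinitesimal_deformation F J B \<epsilon> l \<longrightarrow>
       (\<exists>!\<phi>. \<phi> \<in> base_homs F (eta_base F J) fst B \<epsilon> \<and>
          equivalent_deformations F J B \<epsilon> l (pushout F J (eta_base F J) B \<phi> (eta F J \<mu>))))"
proof -
  interpret algebraically_closed F by fact
  interpret jacobi_jordan_algebra F J by fact
  interpret universal_setup F J \<mu>
    by unfold_locales fact+
  \<comment> \<open>Finite dimension of the cohomology enters here, as a finite basis with its dual
    functionals.\<close>
  obtain S k where "universal_coordinates F J \<mu> S k"
    by (rule H.fin_dim_coordinates[OF fin_dim])
      (rule that, intro universal_coordinates.intro universal_setup_axioms universal_coordinates_axioms.intro)
  then interpret universal_coordinates F J \<mu> S k .
  show ?thesis
  proof (intro conjI allI impI eta_infinitesimal)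
    fix B :: "('f, 'b) module" and \<epsilon> l
    assume B: "vectorspace.fin_dim F B \<and> infinitesimal_deformation F J B \<epsilon> l"
    then have aug: "augmented_algebra F B \<epsilon>"
      and null: "\<And>a b. \<lbrakk>a \<in> a_kernel B F \<epsilon>; b \<in> a_kernel B F \<epsilon>\<rbrakk> \<Longrightarrow> a \<otimes>\<^bsub>B\<^esub> b = \<zero>\<^bsub>B\<^esub>"
      by (auto simp: infinitesimal_deformation_def deformation_def)
    \<comment> \<open>The coordinates of \<open>B\<close> are indexed by elements of
      \<open>B\<close>, namely a basis with one vector exchanged for \<open>1\<close>.\<close>
    obtain I :: "'b set" and u m where "coordinatized_base F B J \<epsilon> I u m"
      by (rule coordinatized_base_exists[OF aug jacobi_jordan_algebra_axioms conjunct1[OF B] null])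
    then interpret pushout_setup F J \<mu> S k B \<epsilon> I u m
      by (intro pushout_setup.intro universal_coordinates_axioms)
    show "\<exists>!\<phi>. \<phi> \<in> base_homs F (eta_base F J) fst B \<epsilon> \<and>
        equivalent_deformations F J B \<epsilon> l (pushout F J (eta_base F J) B \<phi> (eta F J \<mu>))"
      using B by (intro universal) simp
  qed
qed

end
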